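(* Let $\phi\colon D\to\mathbb{D}$ be a holomorphic function with Clark measures $\mu_\alpha$, $\alpha\in\mathbb{T}$. For every $\alpha\in\mathbb{T}$, the mapping $\mathcal{C}_{\phi,\alpha}$ induces a partial isometry of $L^2(\mu_\alpha)$ onto $\phi^*(H^2(D))$, with kernel $L^2(\mu_\alpha)\ominus H^2(\mu_\alpha)$. In other words, $f\in\ker\mathcal{C}_{\phi,\alpha}$ if and only if $\mathcal{C}(f\cdot\mu_\alpha)=0$. Furthermore, $$\mathcal{C}_{\phi,\alpha}(\mathcal{C}(\,\cdot\,,z))=\frac{1}{1-\alpha\overline{\phi(z)}}\,\mathcal{C}_\phi(\,\cdot\,,z)$$ for every $\alpha\in\mathbb{T}$ and for every $z\in D$.
   Context: Setting. $D\subseteq\mathbb{C}^n$ is a bounded symmetric domain (a bounded connected open set such that for every $z\in D$ there is a holomorphic involution of $D$ having $z$ as an isolated fixed point) which is convex and circular ($\alpha z\in D$ for all $z\in D$ and $\alpha\in\mathbb{T}$). Here $\mathbb{D}$ is the open unit disc in $\mathbb{C}$ and $\mathbb{T}=\partial\mathbb{D}$. $\mathrm{b}D$ is the Silov boundary of $D$: the smallest closed subset of $\partial D$ such that $\sup_D|f|=\max_{\mathrm{b}D}|f|$ for every holomorphic $f$ on $D$ extending continuously to the closure $\overline{D}$. $K$ is the compact group of linear automorphisms of $D$; it acts transitively on $\mathrm{b}D$, and it is assumed that $K\subseteq U(n)$ and that $\mathrm{b}D$ is contained in the Euclidean unit sphere. $\beta$ is the unique $K$-invariant probability measure on $\mathrm{b}D$.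 Kernels. The Hardy space $H^2(D)$ is the space of holomorphic $f$ on $D$ with $\|f\|^2=\sup_{0\le\rho<1}\int_{\mathrm{b}D}|f(\rho\zeta)|^2\,\mathrm{d}\beta(\zeta)<\infty$; $\mathcal{C}$ is its reproducing kernel, $\mathcal{C}(z,z')=\overline{\mathcal{C}(z',z)}$, which extends to a sesqui-holomorphic function on a neighbourhood of $D\times\overline{D}$ (and, symmetrically, of $\overline{D}\times D$). For a Radon measure $\mu$ on $\mathrm{b}D$, $\mathcal{C}(\mu)(z)=\int_{\mathrm{b}D}\mathcal{C}(z,\zeta)\,\mathrm{d}\mu(\zeta)$, and $(\mathcal{P}\mu)(z)=\int_{\mathrm{b}D}\mathcal{P}(z,\zeta)\,\mathrm{d}\mu(\zeta)$ with $\mathcal{P}(z,\zeta)=|\mathcal{C}(z,\zeta)|^2/\mathcal{C}(z,z)$. Clark measures. For $\alpha\in\mathbb{T}$, $\mu_\alpha$ is the unique positive Radon measure on $\mathrm{b}D$ such that $\mathcal{P}(\mu_\alpha)=\mathrm{Re}\left(\frac{\alpha+\phi}{\alpha-\phi}\right)$ on $D$. Spaces and operators. $\mathcal{C}_\phi(z,z')=(1-\phi(z)\overline{\phi(z')})\,\mathcal{C}(z,z')$ on $D\times D$, which is a positive kernel, and $\phi^*(H^2(D))$ is the Hilbert space of functions on $D$ with reproducing kernel $\mathcal{C}_\phi$. For $f\in L^1(\mu_\alpha)$, $\mathcal{C}_{\phi,\alpha}(f)=(1-\overline{\alpha}\phi)\,\mathcal{C}(f\cdot\mu_\alpha)$.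 $H^2(\mu_\alpha)$ is the closure in $L^2(\mu_\alpha)$ of the space of holomorphic polynomials on $\mathbb{C}^n$ (equivalently, of the span of the functions $\mathcal{C}(\,\cdot\,,z)$, $z\in D$). $\ominus$ denotes orthogonal complement. *)

theory Defs
  imports "HOL-Probability.Probability"
begin

section \<open>Holomorphic functions of several variables\<close>

text \<open>Only used for open \<open>D\<close>.\<close>

definition hol_on :: "(complex^'n \<Rightarrow> complex) \<Rightarrow> (complex^'n) set \<Rightarrow> bool" where
  "hol_on f D \<longleftrightarrow>
     (\<forall>z\<in>D. \<exists>L. (f has_derivative L) (at z) \<and> (\<forall>c v. L (c *s v) = c * L v))"

definition hol_map_on :: "(complex^'n \<Rightarrow> complex^'m) \<Rightarrow> (complex^'n) set \<Rightarrow> bool" where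
  "hol_map_on F D \<longleftrightarrow> (\<forall>i. hol_on (\<lambda>z. F z $ i) D)"

text \<open>Holomorphic in the first and antiholomorphic in the second variable, jointly.\<close>

definition sesqui_hol_on ::
    "(complex^'n \<Rightarrow> complex^'n \<Rightarrow> complex) \<Rightarrow> ((complex^'n) \<times> (complex^'n)) set \<Rightarrow> bool" where
  "sesqui_hol_on k W \<longleftrightarrow>
     (\<forall>p\<in>W. \<exists>L M. ((\<lambda>(z, w). k z w) has_derivative (\<lambda>(u, v). L u + M v)) (at p)
        \<and> (\<forall>c u. L (c *s u) = c * L u) \<and> (\<forall>c v. M (c *s v) = cnj c * M v))"

definition hol_polynomial :: "(complex^'n \<Rightarrow> complex) \<Rightarrow> bool" where
  "hol_polynomial p \<longleftrightarrow>
     (\<exists>(A :: ('n \<Rightarrow> nat) set) c. finite A \<and> p = (\<lambda>z. \<Sum>a\<in>A. c a * (\<Prod>i\<in>UNIV. (z $ i) ^ a i)))"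

section \<open>The domain, its Silov boundary and its invariant measure\<close>

definition bounded_symmetric_domain :: "(complex^'n) set \<Rightarrow> bool" where
  "bounded_symmetric_domain D \<longleftrightarrow> D \<noteq> {} \<and> open D \<and> connected D \<and> bounded D \<and>
     (\<forall>z\<in>D. \<exists>s. hol_map_on s D \<and> s ` D \<subseteq> D \<and> (\<forall>w\<in>D. s (s w) = w)
        \<and> z isolated_in {w\<in>D. s w = w})"

definition circular :: "(complex^'n) set \<Rightarrow> bool" where
  "circular D \<longleftrightarrow> (\<forall>\<alpha>\<in>sphere 0 1. \<forall>z\<in>D. \<alpha> *s z \<in> D)"

definition norming_boundary :: "(complex^'n) set \<Rightarrow> (complex^'n) set \<Rightarrow> bool" where
  "norming_boundary D S \<longleftrightarrow> closed S \<and> S \<subseteq> frontier D \<and>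
     (\<forall>f. continuous_on (closure D) f \<and> hol_on f D \<longrightarrow>
        (\<exists>x\<in>S. (\<forall>y\<in>S. cmod (f y) \<le> cmod (f x)) \<and> cmod (f x) = (SUP z\<in>D. cmod (f z))))"

definition silov_boundary :: "(complex^'n) set \<Rightarrow> (complex^'n) set \<Rightarrow> bool" where
  "silov_boundary D S \<longleftrightarrow> norming_boundary D S \<and> (\<forall>S'. norming_boundary D S' \<longrightarrow> S \<subseteq> S')"

definition linear_automorphisms :: "(complex^'n) set \<Rightarrow> (complex^'n^'n) set" where
  "linear_automorphisms D = {A. invertible A \<and> (*v) A ` D = D}"

definition unitary_matrices :: "(complex^'n^'n) set" where
  "unitary_matrices = {A. (\<chi> i j. cnj (A $ j $ i)) ** A = mat 1}"

text \<open>On a compact subset of \<open>\<complex>\<^sup>n\<close> the positive Radon measures are exactly the finite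
  Borel measures.\<close>

definition radon_measure_on :: "(complex^'n) set \<Rightarrow> (complex^'n) measure \<Rightarrow> bool" where
  "radon_measure_on S M \<longleftrightarrow> finite_measure M \<and> sets M = sets (restrict_space borel S)"

definition invariant_prob ::
    "(complex^'n) set \<Rightarrow> (complex^'n) set \<Rightarrow> (complex^'n) measure \<Rightarrow> bool" where
  "invariant_prob D S \<beta> \<longleftrightarrow> radon_measure_on S \<beta> \<and> prob_space \<beta> \<and>
     (\<forall>A\<in>linear_automorphisms D. distr \<beta> \<beta> ((*v) A) = \<beta>)"

section \<open>Hilbert spaces of functions and reproducing kernels\<close>

text \<open>A space of functions on \<open>X\<close> is represented by a set of total functions vanishing outside
  \<open>X\<close>, so that equality of functions on \<open>X\<close> is equality in HOL.\<close>

definition restrict0 :: "'a set \<Rightarrow> ('a \<Rightarrow> complex) \<Rightarrow> 'a \<Rightarrow> complex" where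
  "restrict0 X f = (\<lambda>x. if x \<in> X then f x else 0)"

definition function_subspace :: "('a \<Rightarrow> complex) set \<Rightarrow> bool" where
  "function_subspace H \<longleftrightarrow> (\<lambda>x. 0) \<in> H \<and> (\<forall>f\<in>H. \<forall>g\<in>H. (\<lambda>x. f x + g x) \<in> H) \<and>
     (\<forall>c. \<forall>f\<in>H. (\<lambda>x. c * f x) \<in> H)"

definition complex_inner_on ::
    "('a \<Rightarrow> complex) set \<Rightarrow> (('a \<Rightarrow> complex) \<Rightarrow> ('a \<Rightarrow> complex) \<Rightarrow> complex) \<Rightarrow> bool" where
  "complex_inner_on H ip \<longleftrightarrow>
     (\<forall>f\<in>H. \<forall>g\<in>H. \<forall>h\<in>H. ip (\<lambda>x. f x + g x) h = ip f h + ip g h) \<and>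
     (\<forall>c. \<forall>f\<in>H. \<forall>g\<in>H. ip (\<lambda>x. c * f x) g = c * ip f g) \<and>
     (\<forall>f\<in>H. \<forall>g\<in>H. ip g f = cnj (ip f g)) \<and>
     (\<forall>f\<in>H. 0 \<le> Re (ip f f)) \<and>
     (\<forall>f\<in>H. ip f f = 0 \<longrightarrow> f = (\<lambda>x. 0))"

definition ip_norm ::
    "(('a \<Rightarrow> complex) \<Rightarrow> ('a \<Rightarrow> complex) \<Rightarrow> complex) \<Rightarrow> ('a \<Rightarrow> complex) \<Rightarrow> real" where
  "ip_norm ip f = sqrt (Re (ip f f))"

definition ip_complete ::
    "('a \<Rightarrow> complex) set \<Rightarrow> (('a \<Rightarrow> complex) \<Rightarrow> ('a \<Rightarrow> complex) \<Rightarrow> complex) \<Rightarrow> bool" where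
  "ip_complete H ip \<longleftrightarrow>
     (\<forall>F :: nat \<Rightarrow> 'a \<Rightarrow> complex. range F \<subseteq> H \<and>
        (\<forall>e>0. \<exists>N. \<forall>m\<ge>N. \<forall>n\<ge>N. ip_norm ip (\<lambda>x. F m x - F n x) < e) \<longrightarrow>
        (\<exists>f\<in>H. (\<lambda>n. ip_norm ip (\<lambda>x. F n x - f x)) \<longlonglongrightarrow> 0))"

text \<open>\<open>(H, ip)\<close> is the Hilbert space of functions on \<open>X\<close> with reproducing kernel \<open>k\<close>
  (such a Hilbert space is determined by \<open>k\<close>).\<close>

definition reproducing_kernel_hilbert_space ::
    "'a set \<Rightarrow> ('a \<Rightarrow> complex) set \<Rightarrow> (('a \<Rightarrow> complex) \<Rightarrow> ('a \<Rightarrow> complex) \<Rightarrow> complex)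
      \<Rightarrow> ('a \<Rightarrow> 'a \<Rightarrow> complex) \<Rightarrow> bool" where
  "reproducing_kernel_hilbert_space X H ip k \<longleftrightarrow>
     (\<forall>f\<in>H. restrict0 X f = f) \<and> function_subspace H \<and> complex_inner_on H ip \<and> ip_complete H ip \<and>
     (\<forall>x\<in>X. restrict0 X (\<lambda>y. k y x) \<in> H \<and> (\<forall>f\<in>H. f x = ip f (restrict0 X (\<lambda>y. k y x))))"

section \<open>The Hardy space, its kernel, and the Poisson and Cauchy integrals\<close>

definition hardy_mean :: "(complex^'n) measure \<Rightarrow> (complex^'n \<Rightarrow> complex) \<Rightarrow> real \<Rightarrow> real" where
  "hardy_mean \<beta> f \<rho> = (\<integral>\<zeta>. (cmod (f (\<rho> *\<^sub>R \<zeta>)))\<^sup>2 \<partial>\<beta>)"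

definition hardy_space ::
    "(complex^'n) set \<Rightarrow> (complex^'n) measure \<Rightarrow> (complex^'n \<Rightarrow> complex) set" where
  "hardy_space D \<beta> =
     {f. hol_on f D \<and> restrict0 D f = f \<and> bdd_above (hardy_mean \<beta> f ` {0..<1})}"

definition hardy_norm_sq :: "(complex^'n) measure \<Rightarrow> (complex^'n \<Rightarrow> complex) \<Rightarrow> real" where
  "hardy_norm_sq \<beta> f = (SUP \<rho>\<in>{0..<1}. hardy_mean \<beta> f \<rho>)"

text \<open>The inner product belonging to the Hardy norm, by polarization.\<close>

definition hardy_ip ::
    "(complex^'n) measure \<Rightarrow> (complex^'n \<Rightarrow> complex) \<Rightarrow> (complex^'n \<Rightarrow> complex) \<Rightarrow> complex" where
  "hardy_ip \<beta> f g =
     (\<Sum>k<4. \<i> ^ k * of_real (hardy_norm_sq \<beta> (\<lambda>z. f z + \<i> ^ k * g z))) / 4"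

text \<open>The reproducing kernel of the Hardy space together with its (unique) sesqui-holomorphic
  extension to pairs with one entry in the closure of \<open>D\<close>.  Only the values on
  \<open>D \<times> closure D\<close> and \<open>closure D \<times> D\<close> are relevant.\<close>

definition hardy_kernel ::
    "(complex^'n) set \<Rightarrow> (complex^'n) measure \<Rightarrow> (complex^'n \<Rightarrow> complex^'n \<Rightarrow> complex) \<Rightarrow> bool" where
  "hardy_kernel D \<beta> C \<longleftrightarrow>
     reproducing_kernel_hilbert_space D (hardy_space D \<beta>) (hardy_ip \<beta>) C \<and>
     (\<forall>z\<in>D. \<forall>w\<in>closure D. C w z = cnj (C z w)) \<and>
     (\<exists>W. open W \<and> D \<times> closure D \<subseteq> W \<and> closure D \<times> D \<subseteq> W \<and> sesqui_hol_on C W)"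

text \<open>The diagonal value \<open>C z z\<close> is a positive real number for \<open>z \<in> D\<close>.\<close>

definition poisson_kernel ::
    "(complex^'n \<Rightarrow> complex^'n \<Rightarrow> complex) \<Rightarrow> complex^'n \<Rightarrow> complex^'n \<Rightarrow> real" where
  "poisson_kernel C z \<zeta> = (cmod (C z \<zeta>))\<^sup>2 / Re (C z z)"

definition poisson_integral ::
    "(complex^'n \<Rightarrow> complex^'n \<Rightarrow> complex) \<Rightarrow> (complex^'n) measure \<Rightarrow> complex^'n \<Rightarrow> real" where
  "poisson_integral C M z = (\<integral>\<zeta>. poisson_kernel C z \<zeta> \<partial>M)"

text \<open>\<open>cauchy_integral C M f\<close> is the Cauchy-type integral \<open>C(f \<cdot> M)\<close> of the complex measure
  with density \<open>f\<close> with respect to \<open>M\<close>.\<close>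

definition cauchy_integral ::
    "(complex^'n \<Rightarrow> complex^'n \<Rightarrow> complex) \<Rightarrow> (complex^'n) measure \<Rightarrow> (complex^'n \<Rightarrow> complex)
      \<Rightarrow> complex^'n \<Rightarrow> complex" where
  "cauchy_integral C M f z = (\<integral>\<zeta>. C z \<zeta> * f \<zeta> \<partial>M)"

definition clark_measure ::
    "(complex^'n) set \<Rightarrow> (complex^'n) set \<Rightarrow> (complex^'n \<Rightarrow> complex^'n \<Rightarrow> complex)
      \<Rightarrow> (complex^'n \<Rightarrow> complex) \<Rightarrow> complex \<Rightarrow> (complex^'n) measure \<Rightarrow> bool" where
  "clark_measure D S C \<phi> \<alpha> M \<longleftrightarrow> radon_measure_on S M \<and>
     (\<forall>z\<in>D. poisson_integral C M z = Re ((\<alpha> + \<phi> z) / (\<alpha> - \<phi> z)))"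

definition phi_kernel ::
    "(complex^'n \<Rightarrow> complex^'n \<Rightarrow> complex) \<Rightarrow> (complex^'n \<Rightarrow> complex)
      \<Rightarrow> complex^'n \<Rightarrow> complex^'n \<Rightarrow> complex" where
  "phi_kernel C \<phi> z w = (1 - \<phi> z * cnj (\<phi> w)) * C z w"

definition clark_operator ::
    "(complex^'n) set \<Rightarrow> (complex^'n \<Rightarrow> complex^'n \<Rightarrow> complex) \<Rightarrow> (complex^'n \<Rightarrow> complex) \<Rightarrow> complex
      \<Rightarrow> (complex^'n) measure \<Rightarrow> (complex^'n \<Rightarrow> complex) \<Rightarrow> complex^'n \<Rightarrow> complex" where
  "clark_operator D C \<phi> \<alpha> M f =
     restrict0 D (\<lambda>z. (1 - cnj \<alpha> * \<phi> z) * cauchy_integral C M f z)"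

section \<open>Square-integrable functions and partial isometries\<close>

text \<open>\<open>L\<^sup>2\<close> is represented by square-integrable functions rather than by classes modulo
  almost everywhere equality.\<close>

definition L2_space :: "'a measure \<Rightarrow> ('a \<Rightarrow> complex) set" where
  "L2_space M = {f \<in> borel_measurable M. integrable M (\<lambda>x. (cmod (f x))\<^sup>2)}"

definition L2_ip :: "'a measure \<Rightarrow> ('a \<Rightarrow> complex) \<Rightarrow> ('a \<Rightarrow> complex) \<Rightarrow> complex" where
  "L2_ip M f g = (\<integral>x. f x * cnj (g x) \<partial>M)"

definition H2_measure :: "(complex^'n) measure \<Rightarrow> (complex^'n \<Rightarrow> complex) set" where
  "H2_measure M = {f \<in> L2_space M.
     \<forall>e>0. \<exists>p. hol_polynomial p \<and> ip_norm (L2_ip M) (\<lambda>x. f x - p x) < e}"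

definition ortho_complement ::
    "('a \<Rightarrow> complex) set \<Rightarrow> (('a \<Rightarrow> complex) \<Rightarrow> ('a \<Rightarrow> complex) \<Rightarrow> complex)
      \<Rightarrow> ('a \<Rightarrow> complex) set \<Rightarrow> ('a \<Rightarrow> complex) set" where
  "ortho_complement V ip U = {f \<in> V. \<forall>g\<in>U. ip f g = 0}"

definition kernel_on ::
    "('a \<Rightarrow> complex) set \<Rightarrow> (('a \<Rightarrow> complex) \<Rightarrow> 'b \<Rightarrow> complex) \<Rightarrow> ('a \<Rightarrow> complex) set" where
  "kernel_on V T = {f \<in> V. T f = (\<lambda>x. 0)}"

text \<open>A linear map that is isometric on the orthogonal complement of its kernel.  If
  \<open>V = L2_space M\<close>, functions vanishing almost everywhere lie in that complement and have norm
  \<open>0\<close>, so \<open>T\<close> annihilates them, that is, \<open>T\<close> acts on classes.\<close>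

definition partial_isometry_on ::
    "('a \<Rightarrow> complex) set \<Rightarrow> (('a \<Rightarrow> complex) \<Rightarrow> ('a \<Rightarrow> complex) \<Rightarrow> complex)
      \<Rightarrow> ('b \<Rightarrow> complex) set \<Rightarrow> (('b \<Rightarrow> complex) \<Rightarrow> ('b \<Rightarrow> complex) \<Rightarrow> complex)
      \<Rightarrow> (('a \<Rightarrow> complex) \<Rightarrow> 'b \<Rightarrow> complex) \<Rightarrow> bool" where
  "partial_isometry_on V ipV H ipH T \<longleftrightarrow> T ` V \<subseteq> H \<and>
     (\<forall>f\<in>V. \<forall>g\<in>V. T (\<lambda>x. f x + g x) = (\<lambda>y. T f y + T g y)) \<and>
     (\<forall>c. \<forall>f\<in>V. T (\<lambda>x. c * f x) = (\<lambda>y. c * T f y)) \<and>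
     (\<forall>f \<in> ortho_complement V ipV (kernel_on V T). ip_norm ipH (T f) = ip_norm ipV f)"

end

theory Submission
  imports Defs "HOL-Complex_Analysis.Complex_Analysis"
begin

text \<open>
  The theorem rests on one identity.  For \<open>z, w \<in> D\<close>, with \<open>\<mu> = \<mu>\<^sub>\<alpha>\<close>,
    \<open>(1 - cnj \<alpha> \<phi>(z)) (1 - \<alpha> cnj (\<phi>(w))) \<integral> C(z, x) C(x, w) d\<mu>(x) = (1 - \<phi>(z) cnj (\<phi>(w))) C(z, w)\<close>
  (\<open>clark_gram\<close>).  On the diagonal \<open>z = w\<close> it is the equation \<open>P(\<mu>) = Re ((\<alpha> + \<phi>) / (\<alpha> - \<phi>))\<close> that
  defines the Clark measure, and it extends to all pairs because both sides are holomorphic in \<open>z\<close> and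
  antiholomorphic in \<open>w\<close>.  It says that the functions \<open>u\<^sub>w = (1 - \<alpha> cnj (\<phi>(w))) C(\<cdot>, w)\<close> in
  \<open>L\<^sup>2(\<mu>)\<close> have the Gram matrix of the kernel functions of \<open>H\<close>, and that the Clark operator sends
  one family to the other.  Since the operator is \<open>f \<mapsto> (z \<mapsto> \<langle>f, u\<^sub>z\<rangle>)\<close>, general Hilbert space
  theory (\<open>feature_map_partial_isometry\<close>, with the completeness \<open>L2_complete\<close>) shows that it is a partial
  isometry onto \<open>H\<close> whose kernel is the orthogonal complement of the \<open>C(\<cdot>, z)\<close>, \<open>z \<in> D\<close>.

  It remains to see that the functions \<open>C(\<cdot>, z)\<close> and the holomorphic polynomials have the same
  orthogonal complement in \<open>L\<^sup>2(\<mu>)\<close> (\<open>cauchy_integral_zero_iff_orthogonal\<close>).  In one direction,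
  \<open>C(\<cdot>, z)\<close> is continuous on the closure of \<open>D\<close> and holomorphic on \<open>D\<close>, hence a uniform limit of its
  dilations, and these are uniform limits of polynomials: the Taylor coefficients of \<open>c \<mapsto> g(c v)\<close> at
  \<open>0\<close> are polynomials in \<open>v\<close>.  In the other direction, a polynomial satisfies
  \<open>p(r x) = \<integral> p(y) C(x, r y) d\<beta>(y)\<close> for \<open>r < 1\<close> and \<open>x\<close> in the Silov boundary, so that its dilations
  are superpositions of kernel functions, and Fubini's theorem applies (\<open>orthogonal_dilated\<close>).

  This formula combines the reproducing property of \<open>C\<close>, written as an integral over the Silov
  boundary (\<open>kernel_reproduces\<close>), with the symmetry \<open>C(r x, y) = C(x, r y)\<close> (\<open>kernel_dilate\<close>).  Both come
  from circularity: the Silov boundary, the measure \<open>\<beta>\<close> and therefore the kernel are invariant under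
  the rotations \<open>z \<mapsto> a z\<close> with \<open>\<bar>a\<bar> = 1\<close>, and the maximum principle passes from the circle to the
  disc.
\<close>

section \<open>Semi-inner product spaces and feature maps\<close>

text \<open>The inner product is not assumed definite: \<open>L\<^sup>2\<close> is represented by functions, and those that
  vanish almost everywhere are null vectors.  The reproducing kernel space, where it is definite, is an
  instance as well.\<close>

locale semi_inner_space =
  fixes X :: "('a \<Rightarrow> complex) set"
    and ip :: "('a \<Rightarrow> complex) \<Rightarrow> ('a \<Rightarrow> complex) \<Rightarrow> complex"
  assumes subspace: "function_subspace X"
    and ip_add_left: "\<lbrakk>f \<in> X; g \<in> X; h \<in> X\<rbrakk> \<Longrightarrow> ip (\<lambda>x. f x + g x) h = ip f h + ip g h"
    and ip_scale_left: "\<lbrakk>f \<in> X; g \<in> X\<rbrakk> \<Longrightarrow> ip (\<lambda>x. c * f x) g = c * ip f g"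
    and ip_swap: "\<lbrakk>f \<in> X; g \<in> X\<rbrakk> \<Longrightarrow> ip g f = cnj (ip f g)"
    and ip_self_nonneg: "f \<in> X \<Longrightarrow> 0 \<le> Re (ip f f)"
begin

lemma zero_mem: "(\<lambda>x. 0) \<in> X"
  and add_mem: "\<lbrakk>f \<in> X; g \<in> X\<rbrakk> \<Longrightarrow> (\<lambda>x. f x + g x) \<in> X"
  and scale_mem: "f \<in> X \<Longrightarrow> (\<lambda>x. c * f x) \<in> X"
  using subspace by (auto simp: function_subspace_def)

lemma diff_mem: "\<lbrakk>f \<in> X; g \<in> X\<rbrakk> \<Longrightarrow> (\<lambda>x. f x - g x) \<in> X"
  using add_mem[OF _ scale_mem[of g "-1"]] by simp

lemma ip_diff_left: "\<lbrakk>f \<in> X; g \<in> X; h \<in> X\<rbrakk> \<Longrightarrow> ip (\<lambda>x. f x - g x) h = ip f h - ip g h"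
  using ip_add_left[OF _ scale_mem[of g "-1"]] ip_scale_left[of g h "-1"] by simp

lemma ip_add_right: "\<lbrakk>f \<in> X; g \<in> X; h \<in> X\<rbrakk> \<Longrightarrow> ip f (\<lambda>x. g x + h x) = ip f g + ip f h"
  using ip_add_left[of g h f] by (simp add: ip_swap[of _ f] add_mem)

lemma ip_scale_right: "\<lbrakk>f \<in> X; g \<in> X\<rbrakk> \<Longrightarrow> ip f (\<lambda>x. c * g x) = cnj c * ip f g"
  using ip_scale_left[of g f c] by (simp add: ip_swap[of _ f] scale_mem)

lemma ip_diff_right: "\<lbrakk>f \<in> X; g \<in> X; h \<in> X\<rbrakk> \<Longrightarrow> ip f (\<lambda>x. g x - h x) = ip f g - ip f h"
  using ip_diff_left[of g h f] by (simp add: ip_swap[of _ f] diff_mem)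

lemma ip_norm_square: "f \<in> X \<Longrightarrow> (ip_norm ip f)\<^sup>2 = Re (ip f f)"
  by (simp add: ip_norm_def ip_self_nonneg)

lemma ip_norm_nonneg: "f \<in> X \<Longrightarrow> 0 \<le> ip_norm ip f"
  by (simp add: ip_norm_def ip_self_nonneg)

lemma ip_self_eq: "f \<in> X \<Longrightarrow> ip f f = of_real ((ip_norm ip f)\<^sup>2)"
  using ip_swap[of f f] by (simp add: ip_norm_square complex_eq_iff)

lemma ip_norm_diff_scale_square:
  assumes "f \<in> X" "g \<in> X"
  shows "(ip_norm ip (\<lambda>x. f x - c * g x))\<^sup>2 =
    (ip_norm ip f)\<^sup>2 - 2 * Re (cnj c * ip f g) + (cmod c)\<^sup>2 * (ip_norm ip g)\<^sup>2"
proof -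
  have m: "(\<lambda>x. c * g x) \<in> X" "(\<lambda>x. f x - c * g x) \<in> X"
    using assms scale_mem diff_mem by auto
  have "ip (\<lambda>x. f x - c * g x) (\<lambda>x. f x - c * g x) =
      ip f f - cnj c * ip f g - c * cnj (ip f g) + c * cnj c * ip g g"
    using assms m by (simp add: ip_diff_left ip_diff_right ip_scale_left ip_scale_right
        ip_swap[of f g] algebra_simps)
  also have "c * cnj c * ip g g = of_real ((cmod c)\<^sup>2 * (ip_norm ip g)\<^sup>2)"
    using assms by (simp add: ip_self_eq flip: complex_norm_square)
  finally show ?thesis
    using assms m by (simp add: ip_norm_square)
qed

lemma ip_norm_scale_square: "f \<in> X \<Longrightarrow> (ip_norm ip (\<lambda>x. c * f x))\<^sup>2 = (cmod c)\<^sup>2 * (ip_norm ip f)\<^sup>2"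
  using ip_norm_diff_scale_square[of "\<lambda>x. 0" f "- c"] ip_scale_left[of "\<lambda>x. 0" _ 0] zero_mem
  by (simp add: ip_norm_def)

text \<open>Expand \<open>0 \<le> \<parallel>f - t \<langle>f, g\<rangle> g\<parallel>\<^sup>2\<close> for real \<open>t\<close>; null vectors \<open>g\<close> have to be allowed,
  which is why \<open>t\<close> stays free until the end.\<close>

lemma Cauchy_Schwarz:
  assumes "f \<in> X" "g \<in> X"
  shows "cmod (ip f g) \<le> ip_norm ip f * ip_norm ip g"
proof -
  define a where "a = (cmod (ip f g))\<^sup>2"
  define F where "F = (ip_norm ip f)\<^sup>2"
  define G where "G = (ip_norm ip g)\<^sup>2"
  have a0: "a \<ge> 0" and G0: "G \<ge> 0" by (auto simp: a_def G_def)
  have quad: "0 \<le> F - 2 * t * a + t\<^sup>2 * a * G" for t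
  proof -
    have "0 \<le> (ip_norm ip (\<lambda>x. f x - (of_real t * ip f g) * g x))\<^sup>2" by simp
    also have "\<dots> = F - 2 * t * a + t\<^sup>2 * a * G"
      unfolding ip_norm_diff_scale_square[OF assms] F_def G_def a_def
      by (simp add: norm_mult power_mult_distrib cmod_power2)
         (simp add: power2_eq_square algebra_simps)
    finally show ?thesis .
  qed
  have "a \<le> F * G"
  proof (cases "G = 0")
    case True
    have "a = 0"
    proof (rule ccontr)
      assume "a \<noteq> 0"
      then show False using quad[of "(F + 1) / (2 * a)"] True by (simp add: field_simps)
    qed
    then show ?thesis by (simp add: F_def G_def)
  next
    case False
    then show ?thesis using quad[of "1 / G"] G0 by (simp add: field_simps power2_eq_square)
  qed
  then have "(cmod (ip f g))\<^sup>2 \<le> (ip_norm ip f * ip_norm ip g)\<^sup>2"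
    by (simp add: a_def F_def G_def power_mult_distrib)
  then show ?thesis
    by (rule power2_le_imp_le) (simp add: ip_norm_nonneg assms)
qed

lemma ip_tendsto_left:
  assumes "\<And>n. s n \<in> X" "f \<in> X" "u \<in> X"
    and "(\<lambda>n. ip_norm ip (\<lambda>x. s n x - f x)) \<longlonglongrightarrow> 0"
  shows "(\<lambda>n. ip (s n) u) \<longlonglongrightarrow> ip f u"
proof -
  have "(\<lambda>n. ip (s n) u - ip f u) \<longlonglongrightarrow> 0"
  proof (rule Lim_null_comparison)
    show "\<forall>\<^sub>F n in sequentially. norm (ip (s n) u - ip f u)
        \<le> ip_norm ip (\<lambda>x. s n x - f x) * ip_norm ip u"
      using Cauchy_Schwarz[OF diff_mem[OF assms(1,2)] assms(3)]
      by (simp add: ip_diff_left assms)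
    show "(\<lambda>n. ip_norm ip (\<lambda>x. s n x - f x) * ip_norm ip u) \<longlonglongrightarrow> 0"
      using tendsto_mult_right[OF assms(4), of "ip_norm ip u"] by simp
  qed
  then show ?thesis using LIM_zero_iff by blast
qed

lemma ip_norm_add_le:
  assumes "f \<in> X" "g \<in> X"
  shows "ip_norm ip (\<lambda>x. f x + g x) \<le> ip_norm ip f + ip_norm ip g"
proof (rule power2_le_imp_le)
  have "(ip_norm ip (\<lambda>x. f x + g x))\<^sup>2 =
      (ip_norm ip f)\<^sup>2 + 2 * Re (ip f g) + (ip_norm ip g)\<^sup>2"
    using ip_norm_diff_scale_square[OF assms, of "-1"] by simp
  also have "Re (ip f g) \<le> ip_norm ip f * ip_norm ip g"
    using Cauchy_Schwarz[OF assms] complex_Re_le_cmod order_trans by blast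
  finally show "(ip_norm ip (\<lambda>x. f x + g x))\<^sup>2 \<le> (ip_norm ip f + ip_norm ip g)\<^sup>2"
    by (simp add: power2_sum)
qed (simp add: assms ip_norm_nonneg)

lemma ip_norm_tendsto:
  assumes "\<And>n. s n \<in> X" "f \<in> X"
    and "(\<lambda>n. ip_norm ip (\<lambda>x. s n x - f x)) \<longlonglongrightarrow> 0"
  shows "(\<lambda>n. ip_norm ip (s n)) \<longlonglongrightarrow> ip_norm ip f"
proof -
  have "(\<lambda>n. ip_norm ip (s n) - ip_norm ip f) \<longlonglongrightarrow> 0"
  proof (rule Lim_null_comparison[OF _ assms(3)], rule always_eventually, rule allI)
    fix n
    have d: "(\<lambda>x. s n x - f x) \<in> X" using diff_mem assms by blast
    have "ip_norm ip (s n) \<le> ip_norm ip (\<lambda>x. s n x - f x) + ip_norm ip f"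
      using ip_norm_add_le[OF d assms(2)] by simp
    moreover have "ip_norm ip f \<le> ip_norm ip (s n) + ip_norm ip (\<lambda>x. s n x - f x)"
    proof -
      have "ip_norm ip (\<lambda>x. - 1 * (s n x - f x)) = ip_norm ip (\<lambda>x. s n x - f x)"
        using ip_norm_scale_square[OF d, of "-1"] ip_norm_nonneg[OF d] ip_norm_nonneg[OF scale_mem[OF d]]
        ip_norm_nonneg[OF diff_mem[OF assms(2) assms(1)[of n]]]
        by (simp add: power2_eq_iff_nonneg)
      then show ?thesis
        using ip_norm_add_le[OF assms(1)[of n] scale_mem[OF d, of "-1"]] by simp
    qed
    ultimately show "norm (ip_norm ip (s n) - ip_norm ip f) \<le> ip_norm ip (\<lambda>x. s n x - f x)"
      by (simp add: abs_le_iff)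
  qed
  then show ?thesis using LIM_zero_iff by blast
qed

text \<open>A sequence of \<open>M\<close> that minimises the distance to \<open>f\<close> is Cauchy by the parallelogram law and
  its residuals become orthogonal to \<open>M\<close>.  It plays the part of the orthogonal projection onto the
  closure of \<open>M\<close>, whose value is only determined up to null vectors.\<close>

lemma near_projection:
  assumes M: "function_subspace M" "M \<subseteq> X" and f: "f \<in> X"
  obtains s where "\<And>n. s n \<in> M"
    and "\<And>e. e > 0 \<Longrightarrow> \<exists>N. \<forall>m\<ge>N. \<forall>n\<ge>N. ip_norm ip (\<lambda>x. s m x - s n x) < e"
    and "\<And>u. u \<in> M \<Longrightarrow> (\<lambda>n. ip (s n) u) \<longlonglongrightarrow> ip f u"
proof -
  define dist2 where "dist2 t = (ip_norm ip (\<lambda>x. f x - t x))\<^sup>2" for t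
  define d where "d = (INF t\<in>M. dist2 t)"
  have zM: "(\<lambda>x. 0) \<in> M" and aM: "\<And>g h. \<lbrakk>g \<in> M; h \<in> M\<rbrakk> \<Longrightarrow> (\<lambda>x. g x + h x) \<in> M"
    and sM: "\<And>c g. g \<in> M \<Longrightarrow> (\<lambda>x. c * g x) \<in> M"
    using M(1) by (auto simp: function_subspace_def)
  have bdd: "bdd_below (dist2 ` M)" by (rule bdd_belowI[of _ 0]) (auto simp: dist2_def)
  have d_le: "d \<le> dist2 t" if "t \<in> M" for t
    unfolding d_def using bdd that by (rule cINF_lower)
  have "\<exists>t\<in>M. dist2 t < d + 1 / real (Suc n)" for n
  proof -
    have "(INF t\<in>M. dist2 t) < d + 1 / real (Suc n)" unfolding d_def by simp
    then show ?thesis using cINF_less_iff[OF _ bdd] zM by blast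
  qed
  then obtain s where s: "\<And>n. s n \<in> M" "\<And>n. dist2 (s n) < d + 1 / real (Suc n)"
    by metis
  have sX: "\<And>n. s n \<in> X" using s M by blast
  have resX: "(\<lambda>x. f x - s n x) \<in> X" for n using diff_mem f sX by blast
  have orth: "(cmod (ip (\<lambda>x. f x - s n x) u))\<^sup>2 \<le> (1 / real (Suc n)) * ((ip_norm ip u)\<^sup>2 + 1)"
    if u: "u \<in> M" for u n
  proof -
    have uX: "u \<in> X" using u M by blast
    define a where "a = ip (\<lambda>x. f x - s n x) u"
    define U where "U = (ip_norm ip u)\<^sup>2"
    \<comment> \<open>The optimal step is \<open>1 / U\<close>; the added \<open>1\<close> keeps \<open>t\<close> finite and positive for null vectors \<open>u\<close>.\<close>
    define t where "t = 1 / (U + 1)"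
    have U0: "U \<ge> 0" by (simp add: U_def)
    have t: "t > 0" "t * U \<le> 1" using U0 by (auto simp: t_def field_simps)
    have "d \<le> dist2 (\<lambda>x. s n x + (of_real t * a) * u x)"
      by (intro d_le aM s sM u)
    also have "\<dots> = (ip_norm ip (\<lambda>x. (f x - s n x) - (of_real t * a) * u x))\<^sup>2"
      by (simp add: dist2_def algebra_simps)
    also have "\<dots> = dist2 (s n) - 2 * t * (cmod a)\<^sup>2 + t\<^sup>2 * (cmod a)\<^sup>2 * U"
      unfolding ip_norm_diff_scale_square[OF resX uX] dist2_def U_def a_def[symmetric]
      by (simp add: norm_mult power_mult_distrib cmod_power2)
         (simp add: power2_eq_square algebra_simps)
    finally have "2 * t * (cmod a)\<^sup>2 - (t * (cmod a)\<^sup>2) * (t * U) \<le> dist2 (s n) - d"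
      by (simp add: power2_eq_square algebra_simps)
    moreover have "(t * (cmod a)\<^sup>2) * (t * U) \<le> t * (cmod a)\<^sup>2"
      using t by (intro mult_left_le) auto
    ultimately have "t * (cmod a)\<^sup>2 \<le> 1 / real (Suc n)"
      using s(2)[of n] by linarith
    then show ?thesis using U0 unfolding t_def a_def U_def by (simp add: field_simps)
  qed
  have conv: "(\<lambda>n. ip (s n) u) \<longlonglongrightarrow> ip f u" if u: "u \<in> M" for u
  proof -
    have uX: "u \<in> X" using u M by blast
    have "(\<lambda>n. (1 / real (Suc n)) * ((ip_norm ip u)\<^sup>2 + 1)) \<longlonglongrightarrow> 0"
      using tendsto_mult_right[OF LIMSEQ_inverse_real_of_nat, of "(ip_norm ip u)\<^sup>2 + 1"]
      by (simp add: inverse_eq_divide)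
    then have "(\<lambda>n. (cmod (ip (\<lambda>x. f x - s n x) u))\<^sup>2) \<longlonglongrightarrow> 0"
      by (rule Lim_null_comparison[rotated]) (use orth[OF u] in simp)
    then have "(\<lambda>n. sqrt ((cmod (ip (\<lambda>x. f x - s n x) u))\<^sup>2)) \<longlonglongrightarrow> sqrt 0"
      by (rule tendsto_real_sqrt)
    then have "(\<lambda>n. ip (\<lambda>x. f x - s n x) u) \<longlonglongrightarrow> 0"
      by (simp add: tendsto_norm_zero_iff)
    then have "(\<lambda>n. ip f u - ip (s n) u) \<longlonglongrightarrow> 0"
      by (simp add: ip_diff_left f sX uX)
    from tendsto_diff[OF tendsto_const[of "ip f u"] this] show ?thesis by simp
  qed
  have dist_s: "(ip_norm ip (\<lambda>x. s m x - s n x))\<^sup>2 \<le> 2 / real (Suc n) + 2 / real (Suc m)" for m n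
  proof -
    let ?p = "\<lambda>x. f x - s n x" and ?q = "\<lambda>x. f x - s m x"
    let ?h = "\<lambda>x. (1/2) * (s m x + s n x)"
    have hM: "?h \<in> M" by (intro sM aM s)
    have hX: "(\<lambda>x. f x - ?h x) \<in> X" using diff_mem[OF f] hM M by blast
    have "(ip_norm ip (\<lambda>x. ?p x - 1 * ?q x))\<^sup>2 + (ip_norm ip (\<lambda>x. ?p x - (-1) * ?q x))\<^sup>2
        = 2 * dist2 (s n) + 2 * dist2 (s m)"
      unfolding ip_norm_diff_scale_square[OF resX resX] by (simp add: dist2_def)
    moreover have "(\<lambda>x. ?p x - (-1) * ?q x) = (\<lambda>x. 2 * (f x - ?h x))"
      by (auto simp: algebra_simps)
    moreover have "(ip_norm ip (\<lambda>x. 2 * (f x - ?h x)))\<^sup>2 = 4 * dist2 ?h"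
      unfolding dist2_def ip_norm_scale_square[OF hX] by simp
    moreover have "d \<le> dist2 ?h" using d_le hM by blast
    moreover have "(\<lambda>x. ?p x - 1 * ?q x) = (\<lambda>x. s m x - s n x)"
      by auto
    ultimately show ?thesis using s(2)[of n] s(2)[of m] by simp
  qed
  have cau: "\<exists>N. \<forall>m\<ge>N. \<forall>n\<ge>N. ip_norm ip (\<lambda>x. s m x - s n x) < e" if e: "e > 0" for e
  proof -
    have "(\<lambda>n. 4 * inverse (real (Suc n))) \<longlonglongrightarrow> 0"
      using tendsto_mult_left[OF LIMSEQ_inverse_real_of_nat, of 4] by simp
    then have "\<forall>\<^sub>F n in sequentially. 4 * inverse (real (Suc n)) < e\<^sup>2"
      by (rule order_tendstoD(2)) (use e in simp)
    then obtain N where "\<forall>n\<ge>N. 4 * inverse (real (Suc n)) < e\<^sup>2"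
      unfolding eventually_sequentially by blast
    then have N: "4 / real (Suc N) < e\<^sup>2" by (simp add: inverse_eq_divide)
    have "ip_norm ip (\<lambda>x. s m x - s n x) < e" if mn: "m \<ge> N" "n \<ge> N" for m n
    proof -
      have "2 / real (Suc n) \<le> 2 / real (Suc N)" "2 / real (Suc m) \<le> 2 / real (Suc N)"
        using mn by (auto intro!: divide_left_mono)
      then have "(ip_norm ip (\<lambda>x. s m x - s n x))\<^sup>2 < e\<^sup>2" using dist_s[of m n] N by linarith
      then show ?thesis using e by (simp add: power2_less_imp_less)
    qed
    then show ?thesis by blast
  qed
  show ?thesis using that s(1) cau conv by blast
qed

end

lemma function_subspace_add: "\<lbrakk>function_subspace M; f \<in> M; g \<in> M\<rbrakk> \<Longrightarrow> (\<lambda>x. f x + g x) \<in> M"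
  and function_subspace_scale: "\<lbrakk>function_subspace M; f \<in> M\<rbrakk> \<Longrightarrow> (\<lambda>x. c * f x) \<in> M"
  by (simp_all add: function_subspace_def)

text \<open>The span grows by one multiple of a generator at a time, so that a linear map or an inner
  product on the span is handled by induction.\<close>

inductive_set lin_span :: "('a \<Rightarrow> complex) set \<Rightarrow> ('a \<Rightarrow> complex) set" for U where
  zero: "(\<lambda>x. 0) \<in> lin_span U"
| step: "\<lbrakk>f \<in> lin_span U; g \<in> U\<rbrakk> \<Longrightarrow> (\<lambda>x. f x + c * g x) \<in> lin_span U"

lemma lin_span_generator: "g \<in> U \<Longrightarrow> g \<in> lin_span U"
  using lin_span.step[OF lin_span.zero, of g U 1] by simp

lemma function_subspace_lin_span: "function_subspace (lin_span U)"
  unfolding function_subspace_def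
proof (intro conjI ballI allI)
  show "(\<lambda>x. 0) \<in> lin_span U" by (rule lin_span.zero)
next
  fix f g assume "f \<in> lin_span U" "g \<in> lin_span U"
  from this(2,1) show "(\<lambda>x. f x + g x) \<in> lin_span U"
  proof induction
    case (step g h c)
    then show ?case using lin_span.step[of "\<lambda>x. f x + g x" U h c] by (simp add: add.assoc)
  qed simp
next
  fix c f assume "f \<in> lin_span U"
  then show "(\<lambda>x. c * f x) \<in> lin_span U"
  proof induction
    case (step f g d)
    then show ?case using lin_span.step[of "\<lambda>x. c * f x" U g "c * d"] by (simp add: algebra_simps)
  qed (simp add: lin_span.zero)
qed

lemma lin_span_subset: "\<lbrakk>function_subspace X; U \<subseteq> X; f \<in> lin_span U\<rbrakk> \<Longrightarrow> f \<in> X"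
  by (erule lin_span.induct) (auto simp: function_subspace_def)

lemma complex_inner_on_semi_inner_space:
  assumes "function_subspace H" "complex_inner_on H ip"
  shows "semi_inner_space H ip"
proof -
  note inner = assms(2)[unfolded complex_inner_on_def]
  note add = inner[THEN conjunct1] and scale = inner[THEN conjunct2, THEN conjunct1]
    and swap = inner[THEN conjunct2, THEN conjunct2, THEN conjunct1]
    and nonneg = inner[THEN conjunct2, THEN conjunct2, THEN conjunct2, THEN conjunct1]
  show ?thesis
  proof unfold_locales
    fix f g assume "f \<in> H" "g \<in> H"
    then show "ip g f = cnj (ip f g)" by (rule swap[rule_format])
  qed (simp_all add: assms(1) add scale nonneg)
qed

lemma ip_completeD:
  assumes "ip_complete H ip" and "\<And>n. F n \<in> H"
    and "\<And>e. e > 0 \<Longrightarrow> \<exists>N. \<forall>m\<ge>N. \<forall>n\<ge>N. ip_norm ip (\<lambda>x. F m x - F n x) < e"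
  obtains f where "f \<in> H" "(\<lambda>n. ip_norm ip (\<lambda>x. F n x - f x)) \<longlonglongrightarrow> 0"
proof -
  have "range F \<subseteq> H" using assms(2) by blast
  with assms(1,3) have "\<exists>f\<in>H. (\<lambda>n. ip_norm ip (\<lambda>x. F n x - f x)) \<longlonglongrightarrow> 0"
    unfolding ip_complete_def by simp
  then show ?thesis using that by blast
qed

text \<open>The functions \<open>u w\<close> and the kernel functions \<open>k \<cdot> w\<close> have the same Gram matrix, and \<open>T (u w)\<close> is
  \<open>k \<cdot> w\<close>.  Hence \<open>T\<close> is an isometry from the span of the features onto the span of the kernel
  functions, and it extends to the closures because evaluation at a point is continuous on both sides:
  a minimising sequence for \<open>f\<close> is carried to a sequence converging to \<open>T f\<close>, and a minimising
  sequence for \<open>h \<in> H\<close> is pulled back to a sequence whose limit is a preimage of \<open>h\<close>.\<close>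

theorem feature_map_partial_isometry:
  fixes X :: "('a \<Rightarrow> complex) set" and H :: "('b \<Rightarrow> complex) set"
  assumes X: "semi_inner_space X ipX" and complete: "ip_complete X ipX"
    and H: "reproducing_kernel_hilbert_space D H ipH k"
    and u: "\<And>w. w \<in> D \<Longrightarrow> u w \<in> X"
    and gram: "\<And>z w. \<lbrakk>z \<in> D; w \<in> D\<rbrakk> \<Longrightarrow> ipX (u w) (u z) = k z w"
    and T: "\<And>f. f \<in> X \<Longrightarrow> T f = restrict0 D (\<lambda>z. ipX f (u z))"
  shows "partial_isometry_on X ipX H ipH T"
    and "T ` X = H"
    and "kernel_on X T = ortho_complement X ipX (u ` D)"
proof -
  interpret X: semi_inner_space X ipX by (fact X)
  interpret H: semi_inner_space H ipH
    using H by (intro complex_inner_on_semi_inner_space)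
      (auto simp: reproducing_kernel_hilbert_space_def)
  let ?k = "\<lambda>w. restrict0 D (\<lambda>y. k y w)"
  have kH: "?k w \<in> H" if "w \<in> D" for w
    using H that by (auto simp: reproducing_kernel_hilbert_space_def)
  have repr: "f w = ipH f (?k w)" if "w \<in> D" "f \<in> H" for f w
    using H that by (auto simp: reproducing_kernel_hilbert_space_def)
  have H0: "f z = 0" if "f \<in> H" "z \<notin> D" for f z
  proof -
    have "restrict0 D f = f" using H that by (auto simp: reproducing_kernel_hilbert_space_def)
    then show ?thesis using that by (metis restrict0_def)
  qed
  have completeH: "ip_complete H ipH"
    using H by (simp add: reproducing_kernel_hilbert_space_def)
  have Tadd: "T (\<lambda>x. f x + g x) = (\<lambda>y. T f y + T g y)" if "f \<in> X" "g \<in> X" for f g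
    using that X.add_mem[OF that] by (auto simp: T restrict0_def X.ip_add_left u fun_eq_iff)
  have Tscale: "T (\<lambda>x. c * f x) = (\<lambda>y. c * T f y)" if "f \<in> X" for c f
    using that X.scale_mem[OF that] by (auto simp: T restrict0_def X.ip_scale_left u fun_eq_iff)
  have Tdiff: "T (\<lambda>x. f x - g x) = (\<lambda>y. T f y - T g y)" if "f \<in> X" "g \<in> X" for f g
    using that X.diff_mem[OF that] by (auto simp: T restrict0_def X.ip_diff_left u fun_eq_iff)
  have Tz: "T (\<lambda>x. 0) = (\<lambda>y. 0)"
    using Tscale[OF X.zero_mem, of 0] by simp
  have Tu: "T (u w) = ?k w" if "w \<in> D" for w
    using that by (auto simp: T u restrict0_def gram fun_eq_iff)
  let ?M = "lin_span (u ` D)"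
  have Msub: "function_subspace ?M" by (rule function_subspace_lin_span)
  have MX: "?M \<subseteq> X" using lin_span_subset[OF X.subspace] u by blast
  have TM_H: "T s \<in> H" if "s \<in> ?M" for s
    using that
  proof induction
    case (step f g c)
    then obtain w where w: "w \<in> D" "g = u w" by blast
    have "f \<in> X" using step MX by blast
    then show ?case
      using step w by (simp add: Tadd Tscale X.scale_mem u Tu H.add_mem H.scale_mem kH)
  qed (simp add: Tz H.zero_mem)
  \<comment> \<open>On the span of the features \<open>T\<close> preserves inner products: both sides are evaluation of \<open>T s\<close>
    when the second argument is a feature.\<close>
  have isoM: "ipH (T s) (T t) = ipX s t" if s: "s \<in> ?M" and "t \<in> ?M" for s t
    using that(2)
  proof induction
    case zero
    show ?case using H.ip_scale_right[OF TM_H[OF s] H.zero_mem, of 0] Tz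
      X.ip_scale_right[of s "\<lambda>x. 0" 0] s MX X.zero_mem by auto
  next
    case (step f g c)
    then obtain w where w: "w \<in> D" "g = u w" by blast
    have X: "f \<in> X" "s \<in> X" "u w \<in> X" using step MX s u w by auto
    have "ipH (T s) (?k w) = ipX s (u w)"
      using repr[OF w(1) TM_H[OF s]] w X by (simp add: T restrict0_def)
    then show ?case
      using step w X TM_H[OF s] TM_H[OF step.hyps(1)]
      by (simp add: Tadd Tscale X.scale_mem Tu H.scale_mem kH H.ip_add_right X.ip_add_right
          H.ip_scale_right X.ip_scale_right)
  qed
  have normM: "ip_norm ipH (T s) = ip_norm ipX s" if "s \<in> ?M" for s
    using isoM[OF that that] by (simp add: ip_norm_def)
  have M_diff: "(\<lambda>x. s x - t x) \<in> ?M" if "s \<in> ?M" "t \<in> ?M" for s t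
    using function_subspace_add[OF Msub that(1) function_subspace_scale[OF Msub that(2), of "-1"]]
    by simp
  have norm_diff: "ip_norm ipH (\<lambda>x. T s x - T t x) = ip_norm ipX (\<lambda>x. s x - t x)"
    if "s \<in> ?M" "t \<in> ?M" for s t
    using normM[OF M_diff[OF that]] Tdiff[OF subsetD[OF MX that(1)] subsetD[OF MX that(2)]] by simp
  \<comment> \<open>A limit of \<open>T s\<^sub>n\<close> is determined by its values on \<open>D\<close>.\<close>
  have limit_T: "T f = h"
    if s: "\<And>n. s n \<in> ?M" and f: "f \<in> X" and h: "h \<in> H"
      and sf: "\<And>z. z \<in> D \<Longrightarrow> (\<lambda>n. ipX (s n) (u z)) \<longlonglongrightarrow> ipX f (u z)"
      and Th: "\<And>z. z \<in> D \<Longrightarrow> (\<lambda>n. ipH (T (s n)) (?k z)) \<longlonglongrightarrow> ipH h (?k z)" for s f h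
  proof
    fix z show "T f z = h z"
    proof (cases "z \<in> D")
      case True
      have "ipH (T (s n)) (?k z) = ipX (s n) (u z)" for n
        using repr[OF True TM_H[OF s]] subsetD[OF MX s] True by (simp add: T restrict0_def)
      then have "ipH h (?k z) = ipX f (u z)"
        using Th[OF True] sf[OF True] LIMSEQ_unique by simp
      then show ?thesis using repr[OF True h] True f by (simp add: T restrict0_def)
    qed (simp add: H0 h T f restrict0_def)
  qed
  have approx: "\<exists>s. (\<forall>n. s n \<in> ?M) \<and>
      (\<forall>e>0. \<exists>N. \<forall>m\<ge>N. \<forall>n\<ge>N. ip_norm ipX (\<lambda>x. s m x - s n x) < e) \<and>
      (\<lambda>n. ip_norm ipH (\<lambda>x. T (s n) x - T f x)) \<longlonglongrightarrow> 0 \<and> T f \<in> H" if f: "f \<in> X" for f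
  proof -
    obtain s where s: "\<And>n. s n \<in> ?M"
      and cau: "\<And>e. e > 0 \<Longrightarrow> \<exists>N. \<forall>m\<ge>N. \<forall>n\<ge>N. ip_norm ipX (\<lambda>x. s m x - s n x) < e"
      and conv: "\<And>v. v \<in> ?M \<Longrightarrow> (\<lambda>n. ipX (s n) v) \<longlonglongrightarrow> ipX f v"
      using X.near_projection[OF Msub MX f] by blast
    have Ts: "T (s n) \<in> H" for n using TM_H[OF s] .
    have Tcau: "\<exists>N. \<forall>m\<ge>N. \<forall>n\<ge>N. ip_norm ipH (\<lambda>x. T (s m) x - T (s n) x) < e" if "e > 0" for e
      unfolding norm_diff[OF s s] using cau[OF that] .
    obtain h where h: "h \<in> H" "(\<lambda>n. ip_norm ipH (\<lambda>x. T (s n) x - h x)) \<longlonglongrightarrow> 0"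
      using ip_completeD[OF completeH, of "\<lambda>n. T (s n)", OF Ts Tcau] by blast
    have "T f = h"
    proof (rule limit_T[OF s f h(1)])
      fix z assume z: "z \<in> D"
      then show "(\<lambda>n. ipX (s n) (u z)) \<longlonglongrightarrow> ipX f (u z)"
        by (intro conv lin_span_generator imageI)
      show "(\<lambda>n. ipH (T (s n)) (?k z)) \<longlonglongrightarrow> ipH h (?k z)"
        by (intro H.ip_tendsto_left Ts h kH z)
    qed
    with s cau h show ?thesis by blast
  qed
  have TX: "T f \<in> H" if "f \<in> X" for f using approx[OF that] by blast
  show TXH: "T ` X = H"
  proof
    show "T ` X \<subseteq> H" using TX by blast
    show "H \<subseteq> T ` X"
    proof
      fix h assume h: "h \<in> H"
      have "function_subspace (T ` ?M)" unfolding function_subspace_def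
      proof (intro conjI ballI allI)
        show "(\<lambda>x. 0) \<in> T ` ?M" using Tz lin_span.zero[of "u ` D"] by (metis image_eqI)
      next
        fix f g assume "f \<in> T ` ?M" "g \<in> T ` ?M"
        then obtain s t where st: "s \<in> ?M" "t \<in> ?M" "f = T s" "g = T t" by blast
        then have "(\<lambda>x. s x + t x) \<in> ?M" by (intro function_subspace_add Msub)
        moreover have "(\<lambda>x. f x + g x) = T (\<lambda>x. s x + t x)"
          using st by (simp add: Tadd subsetD[OF MX])
        ultimately show "(\<lambda>x. f x + g x) \<in> T ` ?M" by blast
      next
        fix c f assume "f \<in> T ` ?M"
        then obtain s where st: "s \<in> ?M" "f = T s" by blast
        then have "(\<lambda>x. c * s x) \<in> ?M" by (intro function_subspace_scale Msub)
        moreover have "(\<lambda>x. c * f x) = T (\<lambda>x. c * s x)"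
          using st by (simp add: Tscale subsetD[OF MX])
        ultimately show "(\<lambda>x. c * f x) \<in> T ` ?M" by blast
      qed
      moreover have "T ` ?M \<subseteq> H" using TM_H by blast
      ultimately obtain t where t: "\<And>n. t n \<in> T ` ?M"
        and cau: "\<And>e. e > 0 \<Longrightarrow> \<exists>N. \<forall>m\<ge>N. \<forall>n\<ge>N. ip_norm ipH (\<lambda>x. t m x - t n x) < e"
        and conv: "\<And>v. v \<in> T ` ?M \<Longrightarrow> (\<lambda>n. ipH (t n) v) \<longlonglongrightarrow> ipH h v"
        using H.near_projection[OF _ _ h] by blast
      have "\<forall>n. \<exists>s. s \<in> ?M \<and> t n = T s" using t by blast
      then obtain s where s: "\<And>n. s n \<in> ?M" and ts: "\<And>n. t n = T (s n)"
        unfolding choice_iff by blast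
      have sX: "s n \<in> X" for n using s MX by blast
      have scau: "\<exists>N. \<forall>m\<ge>N. \<forall>n\<ge>N. ip_norm ipX (\<lambda>x. s m x - s n x) < e" if "e > 0" for e
        using cau[OF that] unfolding ts norm_diff[OF s s] .
      obtain f where f: "f \<in> X" "(\<lambda>n. ip_norm ipX (\<lambda>x. s n x - f x)) \<longlonglongrightarrow> 0"
        using ip_completeD[OF complete, of s, OF sX scau] by blast
      have kM: "?k z \<in> T ` ?M" if "z \<in> D" for z
        unfolding Tu[OF that, symmetric] by (intro imageI lin_span_generator that)
      have "T f = h"
      proof (rule limit_T[OF s f(1) h])
        show "(\<lambda>n. ipX (s n) (u z)) \<longlonglongrightarrow> ipX f (u z)" if "z \<in> D" for z
          by (intro X.ip_tendsto_left sX f u that)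
        show "(\<lambda>n. ipH (T (s n)) (?k z)) \<longlonglongrightarrow> ipH h (?k z)" if "z \<in> D" for z
          using conv[OF kM[OF that]] unfolding ts .
      qed
      then show "h \<in> T ` X" using f by blast
    qed
  qed
  show ker: "kernel_on X T = ortho_complement X ipX (u ` D)"
    by (auto simp: kernel_on_def ortho_complement_def T restrict0_def fun_eq_iff split: if_splits)
  show "partial_isometry_on X ipX H ipH T"
    unfolding partial_isometry_on_def
  proof (intro conjI ballI allI)
    show "T ` X \<subseteq> H" using TXH by simp
  next
    fix f assume f': "f \<in> ortho_complement X ipX (kernel_on X T)"
    then have f: "f \<in> X" and orth: "\<And>g. g \<in> kernel_on X T \<Longrightarrow> ipX f g = 0"
      by (auto simp: ortho_complement_def)
    obtain s where s: "\<And>n. s n \<in> ?M"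
      and cau: "\<And>e. e > 0 \<Longrightarrow> \<exists>N. \<forall>m\<ge>N. \<forall>n\<ge>N. ip_norm ipX (\<lambda>x. s m x - s n x) < e"
      and Tf: "(\<lambda>n. ip_norm ipH (\<lambda>x. T (s n) x - T f x)) \<longlonglongrightarrow> 0"
      using approx[OF f] by blast
    have sX: "s n \<in> X" for n using s MX by blast
    obtain g where g: "g \<in> X" "(\<lambda>n. ip_norm ipX (\<lambda>x. s n x - g x)) \<longlonglongrightarrow> 0"
      using ip_completeD[OF complete, of s, OF sX cau] by blast
    have TfH: "T f \<in> H" using TX f by blast
    have Tg: "T g = T f"
    proof (rule limit_T[OF s g(1) TfH])
      show "(\<lambda>n. ipX (s n) (u z)) \<longlonglongrightarrow> ipX g (u z)" if "z \<in> D" for z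
        by (intro X.ip_tendsto_left sX g u that)
      show "(\<lambda>n. ipH (T (s n)) (?k z)) \<longlonglongrightarrow> ipH (T f) (?k z)" if "z \<in> D" for z
        by (intro H.ip_tendsto_left TM_H s TfH Tf kH that)
    qed
    let ?r = "\<lambda>x. f x - g x"
    have rX: "?r \<in> X" using X.diff_mem f g by blast
    have rker: "?r \<in> kernel_on X T" using rX Tdiff[OF f g(1)] Tg by (simp add: kernel_on_def)
    have M_orth: "ipX t ?r = 0" if "t \<in> ?M" for t
      using that
    proof induction
      case zero
      show ?case using X.ip_scale_left[OF X.zero_mem rX, of 0] by simp
    next
      case (step t v c)
      have vX: "v \<in> X" "t \<in> X" using step u MX by auto
      have "ipX ?r v = 0" using rker step unfolding ker ortho_complement_def by blast
      then have "ipX v ?r = 0" using X.ip_swap[OF rX vX(1)] by simp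
      then show ?case using step vX rX by (simp add: X.ip_add_left X.ip_scale_left X.scale_mem)
    qed
    have "(\<lambda>n. ipX (s n) ?r) \<longlonglongrightarrow> ipX g ?r" by (intro X.ip_tendsto_left sX g rX)
    then have "ipX g ?r = 0" using M_orth[OF s] by (simp add: LIMSEQ_const_iff)
    then have "ip_norm ipX ?r = 0"
      using orth[OF rker] by (simp add: X.ip_diff_left f g rX ip_norm_def)
    then have "ip_norm ipX f = ip_norm ipX g"
      using X.ip_norm_tendsto[of "\<lambda>n. f" g] f g by (simp add: LIMSEQ_const_iff)
    also have "\<dots> = ip_norm ipH (T f)"
    proof (rule LIMSEQ_unique)
      show "(\<lambda>n. ip_norm ipX (s n)) \<longlonglongrightarrow> ip_norm ipX g" by (intro X.ip_norm_tendsto sX g)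
      show "(\<lambda>n. ip_norm ipX (s n)) \<longlonglongrightarrow> ip_norm ipH (T f)"
        using H.ip_norm_tendsto[OF TM_H[OF s] TfH Tf] by (simp add: normM s)
    qed
    finally show "ip_norm ipH (T f) = ip_norm ipX f" by simp
  qed (auto simp: Tadd Tscale)
qed

section \<open>The space of square-integrable functions of a finite measure\<close>

lemma borel_measurable_cnj [measurable (raw)]:
  "f \<in> borel_measurable M \<Longrightarrow> (\<lambda>x. cnj (f x)) \<in> borel_measurable M"
  by (rule measurable_compose[OF _ borel_measurable_continuous_onI[of cnj]])
    (auto intro: continuous_intros)

lemma L2_integrable_product:
  assumes "f \<in> L2_space M" "g \<in> L2_space M"
  shows "integrable M (\<lambda>x. f x * cnj (g x))"
proof (rule Bochner_Integration.integrable_bound)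
  show "integrable M (\<lambda>x. (cmod (f x))\<^sup>2 + (cmod (g x))\<^sup>2)"
    using assms by (simp add: L2_space_def)
  have [measurable]: "f \<in> borel_measurable M" "g \<in> borel_measurable M"
    using assms by (auto simp: L2_space_def)
  show "(\<lambda>x. f x * cnj (g x)) \<in> borel_measurable M" by measurable
  have "cmod (f x) * cmod (g x) \<le> (cmod (f x))\<^sup>2 + (cmod (g x))\<^sup>2" for x
    using sum_squares_bound[of "cmod (f x)" "cmod (g x)"] 
      mult_nonneg_nonneg[OF norm_ge_zero norm_ge_zero, of "f x" "g x"] by linarith
  then show "AE x in M. norm (f x * cnj (g x)) \<le> norm ((cmod (f x))\<^sup>2 + (cmod (g x))\<^sup>2)"
    by (simp add: norm_mult)
qed

lemma L2_add:
  assumes "f \<in> L2_space M" "g \<in> L2_space M"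
  shows "(\<lambda>x. f x + g x) \<in> L2_space M"
proof -
  have "integrable M (\<lambda>x. (cmod (f x + g x))\<^sup>2)"
  proof (rule Bochner_Integration.integrable_bound)
    show "integrable M (\<lambda>x. 2 * (cmod (f x))\<^sup>2 + 2 * (cmod (g x))\<^sup>2)"
      using assms by (simp add: L2_space_def)
    show "(\<lambda>x. (cmod (f x + g x))\<^sup>2) \<in> borel_measurable M"
      using assms by (auto simp: L2_space_def)
    have "(cmod (f x + g x))\<^sup>2 \<le> 2 * (cmod (f x))\<^sup>2 + 2 * (cmod (g x))\<^sup>2" for x
    proof -
      have "(cmod (f x + g x))\<^sup>2 \<le> (cmod (f x) + cmod (g x))\<^sup>2"
        by (intro power_mono norm_triangle_ineq) auto
      then show ?thesis using sum_squares_bound[of "cmod (f x)" "cmod (g x)"]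
        by (simp add: power2_sum)
    qed
    then show "AE x in M. norm ((cmod (f x + g x))\<^sup>2) \<le> norm (2 * (cmod (f x))\<^sup>2 + 2 * (cmod (g x))\<^sup>2)"
      by simp
  qed
  then show ?thesis using assms by (auto simp: L2_space_def)
qed

lemma L2_semi_inner_space: "semi_inner_space (L2_space M) (L2_ip M)"
proof unfold_locales
  have "(\<lambda>x. c * f x) \<in> L2_space M" if "f \<in> L2_space M" for c f
    using that by (auto simp: L2_space_def norm_mult power_mult_distrib)
  then show "function_subspace (L2_space M)"
    unfolding function_subspace_def by (auto simp: L2_add) (simp add: L2_space_def)
next
  fix f g h assume "f \<in> L2_space M" "g \<in> L2_space M" "h \<in> L2_space M"
  then show "L2_ip M (\<lambda>x. f x + g x) h = L2_ip M f h + L2_ip M g h"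
    by (simp add: L2_ip_def distrib_right L2_integrable_product)
next
  fix f g c
  show "L2_ip M (\<lambda>x. c * f x) g = c * L2_ip M f g"
    by (simp add: L2_ip_def mult.assoc)
next
  fix f g
  show "L2_ip M g f = cnj (L2_ip M f g)"
    unfolding L2_ip_def Bochner_Integration.integral_cnj[symmetric] by (simp add: mult.commute)
next
  fix f :: "'a \<Rightarrow> complex"
  have "(\<lambda>x. f x * cnj (f x)) = (\<lambda>x. of_real ((cmod (f x))\<^sup>2))"
    by (simp add: fun_eq_iff flip: complex_norm_square)
  then show "0 \<le> Re (L2_ip M f f)"
    by (simp add: L2_ip_def del: of_real_power)
qed

lemma L2_norm_eq: "ip_norm (L2_ip M) f = sqrt (\<integral>x. (cmod (f x))\<^sup>2 \<partial>M)"
proof -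
  have "(\<lambda>x. f x * cnj (f x)) = (\<lambda>x. of_real ((cmod (f x))\<^sup>2))"
    by (simp add: fun_eq_iff flip: complex_norm_square)
  then show ?thesis by (simp add: L2_ip_def ip_norm_def del: of_real_power)
qed

lemma L2_const:
  assumes "finite_measure M"
  shows "(\<lambda>x. c) \<in> L2_space M"
proof -
  interpret finite_measure M by fact
  show ?thesis by (simp add: L2_space_def)
qed

lemma L2_integrable:
  assumes "finite_measure M" "f \<in> L2_space M"
  shows "integrable M f"
  using L2_integrable_product[OF assms(2) L2_const[OF assms(1), of 1]] by simp

lemma L1_le_L2:
  assumes "finite_measure M" "f \<in> L2_space M"
  shows "(\<integral>x. cmod (f x) \<partial>M) \<le> ip_norm (L2_ip M) f * ip_norm (L2_ip M) (\<lambda>x. 1)"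
proof -
  let ?a = "\<lambda>x. complex_of_real (cmod (f x))"
  interpret semi_inner_space "L2_space M" "L2_ip M" by (rule L2_semi_inner_space)
  have a: "?a \<in> L2_space M" using assms(2) by (auto simp: L2_space_def)
  have "(\<integral>x. cmod (f x) \<partial>M) = Re (L2_ip M ?a (\<lambda>x. 1))"
    by (simp add: L2_ip_def)
  also have "\<dots> \<le> cmod (L2_ip M ?a (\<lambda>x. 1))" by (rule complex_Re_le_cmod)
  also have "\<dots> \<le> ip_norm (L2_ip M) ?a * ip_norm (L2_ip M) (\<lambda>x. 1)"
    using a L2_const[OF assms(1)] by (rule Cauchy_Schwarz)
  also have "ip_norm (L2_ip M) ?a = ip_norm (L2_ip M) f" by (simp add: L2_norm_eq)
  finally show ?thesis .
qed

text \<open>Riesz and Fischer: on a finite measure an \<open>L\<^sup>2\<close> Cauchy sequence is an \<open>L\<^sup>1\<close> Cauchy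
  sequence, so a subsequence converges almost everywhere; Fatou's lemma turns the pointwise limit
  into an \<open>L\<^sup>2\<close> limit.\<close>

lemma L2_complete:
  assumes fin: "finite_measure M"
  shows "ip_complete (L2_space M) (L2_ip M)"
  unfolding ip_complete_def
proof (intro allI impI, elim conjE)
  interpret semi_inner_space "L2_space M" "L2_ip M" by (rule L2_semi_inner_space)
  fix F :: "nat \<Rightarrow> 'a \<Rightarrow> complex"
  assume "range F \<subseteq> L2_space M"
  then have F: "F n \<in> L2_space M" for n by blast
  assume cau: "\<forall>e>0. \<exists>N. \<forall>m\<ge>N. \<forall>n\<ge>N. ip_norm (L2_ip M) (\<lambda>x. F m x - F n x) < e"
  have [measurable]: "F n \<in> borel_measurable M" for n using F by (simp add: L2_space_def)
  let ?one = "ip_norm (L2_ip M) (\<lambda>x. 1)"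
  have one: "0 \<le> ?one" by (simp add: L2_norm_eq)
  have L1: "\<exists>N. \<forall>i\<ge>N. \<forall>j\<ge>N. (\<integral>x. norm (F i x - F j x) \<partial>M) < e" if e: "e > 0" for e
  proof -
    obtain N where N: "\<And>m n. \<lbrakk>m \<ge> N; n \<ge> N\<rbrakk> \<Longrightarrow>
        ip_norm (L2_ip M) (\<lambda>x. F m x - F n x) < e / (?one + 1)"
      using cau[rule_format, of "e / (?one + 1)"] e one by auto
    have "(\<integral>x. norm (F i x - F j x) \<partial>M) < e" if "i \<ge> N" "j \<ge> N" for i j
    proof -
      have "(\<integral>x. norm (F i x - F j x) \<partial>M) \<le> ip_norm (L2_ip M) (\<lambda>x. F i x - F j x) * ?one"
        by (rule L1_le_L2[OF fin diff_mem[OF F F]])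
      also have "\<dots> \<le> (e / (?one + 1)) * ?one"
        using N[OF that] one by (intro mult_right_mono) auto
      also have "\<dots> < e" using e one by (simp add: field_simps)
      finally show ?thesis .
    qed
    then show ?thesis by blast
  qed
  obtain r where r: "strict_mono r" "AE x in M. Cauchy (\<lambda>i. F (r i) x)"
    using cauchy_L1_AE_cauchy_subseq[OF L2_integrable[OF fin F] L1] by blast
  define f where "f x = lim (\<lambda>i. F (r i) x)" for x
  have [measurable]: "f \<in> borel_measurable M"
    unfolding f_def[abs_def] by (rule borel_measurable_lim_metric) simp
  have lim: "AE x in M. (\<lambda>i. F (r i) x) \<longlonglongrightarrow> f x"
    using r(2) by eventually_elim (simp add: f_def Cauchy_convergent_iff convergent_LIMSEQ_iff)
  have est: "(\<lambda>x. F m x - f x) \<in> L2_space M \<and> ip_norm (L2_ip M) (\<lambda>x. F m x - f x) \<le> e"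
    if e: "e > 0" and m: "m \<ge> N"
      and N: "\<And>m n. \<lbrakk>m \<ge> N; n \<ge> N\<rbrakk> \<Longrightarrow> ip_norm (L2_ip M) (\<lambda>x. F m x - F n x) < e" for e m N
  proof -
    have "(\<integral>\<^sup>+x. ennreal ((cmod (F m x - f x))\<^sup>2) \<partial>M)
        = (\<integral>\<^sup>+x. liminf (\<lambda>i. ennreal ((cmod (F m x - F (r i) x))\<^sup>2)) \<partial>M)"
    proof (rule nn_integral_cong_AE, use lim in eventually_elim)
      fix x assume "(\<lambda>i. F (r i) x) \<longlonglongrightarrow> f x"
      then have "(\<lambda>i. ennreal ((cmod (F m x - F (r i) x))\<^sup>2)) \<longlonglongrightarrow> ennreal ((cmod (F m x - f x))\<^sup>2)"
        by (intro tendsto_intros)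
      then show "ennreal ((cmod (F m x - f x))\<^sup>2)
          = liminf (\<lambda>i. ennreal ((cmod (F m x - F (r i) x))\<^sup>2))"
        by (intro lim_imp_Liminf[symmetric]) simp_all
    qed
    also have "\<dots> \<le> liminf (\<lambda>i. \<integral>\<^sup>+x. ennreal ((cmod (F m x - F (r i) x))\<^sup>2) \<partial>M)"
      by (rule nn_integral_liminf) simp
    also have "\<dots> \<le> ennreal (e\<^sup>2)"
    proof (rule Liminf_le)
      show "\<forall>\<^sub>F i in sequentially. (\<integral>\<^sup>+x. ennreal ((cmod (F m x - F (r i) x))\<^sup>2) \<partial>M) \<le> ennreal (e\<^sup>2)"
        using eventually_ge_at_top[of N]
      proof eventually_elim
        fix i assume "i \<ge> N"
        then have "r i \<ge> N" using seq_suble[OF r(1), of i] by simp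
        then have "ip_norm (L2_ip M) (\<lambda>x. F m x - F (r i) x) \<le> e" using N[OF m] by (simp add: less_imp_le)
        then have "(\<integral>x. (cmod (F m x - F (r i) x))\<^sup>2 \<partial>M) \<le> e\<^sup>2"
          unfolding L2_norm_eq by (simp add: sqrt_le_D)
        moreover have "integrable M (\<lambda>x. (cmod (F m x - F (r i) x))\<^sup>2)"
          using diff_mem[OF F F] by (simp add: L2_space_def)
        ultimately show "(\<integral>\<^sup>+x. ennreal ((cmod (F m x - F (r i) x))\<^sup>2) \<partial>M) \<le> ennreal (e\<^sup>2)"
          by (simp add: nn_integral_eq_integral)
      qed
    qed simp
    finally have le: "(\<integral>\<^sup>+x. ennreal ((cmod (F m x - f x))\<^sup>2) \<partial>M) \<le> ennreal (e\<^sup>2)" .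
    then have int: "integrable M (\<lambda>x. (cmod (F m x - f x))\<^sup>2)"
      by (intro integrableI_bounded) (auto intro: le_less_trans)
    then have "(\<integral>x. (cmod (F m x - f x))\<^sup>2 \<partial>M) \<le> e\<^sup>2"
      using le by (simp add: nn_integral_eq_integral)
    then have "ip_norm (L2_ip M) (\<lambda>x. F m x - f x) \<le> e"
      using e by (simp add: L2_norm_eq real_le_lsqrt)
    then show ?thesis using int by (simp add: L2_space_def)
  qed
  have "(\<lambda>x. F m x - (F m x - f x)) \<in> L2_space M" if "(\<lambda>x. F m x - f x) \<in> L2_space M" for m
    using diff_mem[OF F that] .
  then have fL2: "f \<in> L2_space M" using est[of 1] cau[rule_format, of 1] by fastforce
  have "(\<lambda>n. ip_norm (L2_ip M) (\<lambda>x. F n x - f x)) \<longlonglongrightarrow> 0"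
  proof (rule LIMSEQ_I)
    fix e :: real assume e: "e > 0"
    obtain N where N: "\<And>m n. \<lbrakk>m \<ge> N; n \<ge> N\<rbrakk> \<Longrightarrow> ip_norm (L2_ip M) (\<lambda>x. F m x - F n x) < e / 2"
      using cau[rule_format, of "e / 2"] e by auto
    have "norm (ip_norm (L2_ip M) (\<lambda>x. F n x - f x) - 0) < e" if "n \<ge> N" for n
      using est[OF _ that N] e ip_norm_nonneg[OF diff_mem[OF F fL2]] by fastforce
    then show "\<exists>N. \<forall>n\<ge>N. norm (ip_norm (L2_ip M) (\<lambda>x. F n x - f x) - 0) < e" by blast
  qed
  then show "\<exists>f\<in>L2_space M. (\<lambda>n. ip_norm (L2_ip M) (\<lambda>x. F n x - f x)) \<longlonglongrightarrow> 0"
    using fL2 by blast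
qed

section \<open>Holomorphic parameter integrals\<close>

text \<open>This sequence shows that the derivative of a measurable family of functions is measurable in
  the parameter.\<close>

lemma linear_limit_of_difference_quotients:
  fixes f :: "'a::real_normed_vector \<Rightarrow> complex"
  assumes "(f has_derivative L) (at z)"
  shows "(\<lambda>n. of_nat (Suc n) * (f (z + h /\<^sub>R real (Suc n)) - f z)) \<longlonglongrightarrow> L h"
proof (cases "h = 0")
  case True
  then show ?thesis using assms by (simp add: has_derivative_bounded_linear linear_simps(3))
next
  case False
  have L: "bounded_linear L" and lim: "(\<lambda>h. norm (f (z + h) - f z - L h) / norm h) \<midarrow>0\<rightarrow> 0"
    using assms by (auto simp: has_derivative_at)
  let ?x = "\<lambda>n. h /\<^sub>R real (Suc n)"
  have x0: "?x \<longlonglongrightarrow> 0"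
    using tendsto_scaleR[OF LIMSEQ_inverse_real_of_nat tendsto_const[of h]] by simp
  have "(\<lambda>n. norm (f (z + ?x n) - f z - L (?x n)) / norm (?x n)) \<longlonglongrightarrow> 0"
  proof -
    have "\<And>X. \<lbrakk>\<And>n. X n \<noteq> 0; X \<longlonglongrightarrow> 0\<rbrakk> \<Longrightarrow> (\<lambda>n. norm (f (z + X n) - f z - L (X n)) / norm (X n)) \<longlonglongrightarrow> 0"
      using lim unfolding tendsto_at_iff_sequentially comp_def by auto
    from this[of ?x] show ?thesis using x0 False by simp
  qed
  then have "(\<lambda>n. norm h * (norm (f (z + ?x n) - f z - L (?x n)) / norm (?x n))) \<longlonglongrightarrow> 0"
    by (rule tendsto_mult_right_zero)
  moreover have "norm h * (norm (f (z + ?x n) - f z - L (?x n)) / norm (?x n)) =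
      norm (of_nat (Suc n) * (f (z + ?x n) - f z) - L h)" for n
  proof -
    have Lx: "L (?x n) = L h /\<^sub>R real (Suc n)"
      using L by (simp add: linear_simps(5))
    have "norm h * (norm (f (z + ?x n) - f z - L (?x n)) / norm (?x n)) =
        real (Suc n) * norm (f (z + ?x n) - f z - L (?x n))"
      using False by (simp add: field_simps)
    also have "\<dots> = norm (of_nat (Suc n) * (f (z + ?x n) - f z - L (?x n)))"
      by (simp add: norm_mult del: of_nat_Suc)
    also have "of_nat (Suc n) * (f (z + ?x n) - f z - L (?x n)) =
        of_nat (Suc n) * (f (z + ?x n) - f z) - L h"
      unfolding Lx by (simp add: scaleR_conv_of_real right_diff_distrib del: of_nat_Suc)
    finally show ?thesis .
  qed
  ultimately have "(\<lambda>n. of_nat (Suc n) * (f (z + ?x n) - f z) - L h) \<longlonglongrightarrow> 0"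
    by (simp add: tendsto_norm_zero_iff del: of_nat_Suc)
  then show ?thesis using LIM_zero_iff by blast
qed

text \<open>Differentiation under the integral sign: the bound on the derivative makes the difference
  quotients uniformly bounded, so dominated convergence applies.\<close>

lemma has_derivative_integral:
  fixes k :: "'a::real_normed_vector \<Rightarrow> 'b \<Rightarrow> complex"
  assumes fin: "finite_measure M" and r: "r > 0" and B0: "B \<ge> 0"
    and meas: "\<And>x. x \<in> ball z r \<Longrightarrow> k x \<in> borel_measurable M"
    and int: "\<And>x. x \<in> ball z r \<Longrightarrow> integrable M (k x)"
    and der: "\<And>x t. \<lbrakk>x \<in> ball z r; t \<in> space M\<rbrakk> \<Longrightarrow> ((\<lambda>x. k x t) has_derivative L x t) (at x)"
    and bound: "\<And>x t h. \<lbrakk>x \<in> ball z r; t \<in> space M\<rbrakk> \<Longrightarrow> norm (L x t h) \<le> B * norm h"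
  shows "((\<lambda>x. \<integral>t. k x t \<partial>M) has_derivative (\<lambda>h. \<integral>t. L z t h \<partial>M)) (at z)"
proof -
  interpret finite_measure M by fact
  have z: "z \<in> ball z r" using r by simp
  have lin: "bounded_linear (L z t)" if "t \<in> space M" for t
    using der[OF z that] by (rule has_derivative_bounded_linear)
  \<comment> \<open>For \<open>norm h < r\<close> the difference quotients stay inside the ball; homogeneity covers the other \<open>h\<close>.\<close>
  have Lmeas_small: "(\<lambda>t. L z t h) \<in> borel_measurable M" if h: "norm h < r" for h
  proof (rule borel_measurable_LIMSEQ_metric)
    fix n
    have "norm h / real (Suc n) \<le> norm h" by (simp add: field_simps)
    then have "z + h /\<^sub>R real (Suc n) \<in> ball z r"
      using h by (simp add: dist_norm divide_inverse_commute)
    from meas[OF this] meas[OF z]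
    show "(\<lambda>t. of_nat (Suc n) * (k (z + h /\<^sub>R real (Suc n)) t - k z t)) \<in> borel_measurable M"
      by measurable
  next
    fix t assume "t \<in> space M"
    then show "(\<lambda>n. of_nat (Suc n) * (k (z + h /\<^sub>R real (Suc n)) t - k z t)) \<longlonglongrightarrow> L z t h"
      by (intro linear_limit_of_difference_quotients der z)
  qed
  have Lmeas: "(\<lambda>t. L z t h) \<in> borel_measurable M" for h
  proof -
    define c where "c = (norm h + 1) / r"
    have c: "c > 0" using r by (simp add: c_def add_nonneg_pos)
    have "norm h < r * c" using r by (simp add: c_def)
    then have "norm (h /\<^sub>R c) < r" using c by (simp add: field_simps)
    then have "(\<lambda>t. of_real c * L z t (h /\<^sub>R c)) \<in> borel_measurable M"
      using Lmeas_small by measurable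
    moreover have "of_real c * L z t (h /\<^sub>R c) = L z t h" if "t \<in> space M" for t
      using linear_simps(5)[OF lin[OF that]] c by (simp add: scaleR_conv_of_real)
    ultimately show ?thesis by (simp cong: measurable_cong)
  qed
  have Lint: "integrable M (\<lambda>t. L z t h)" for h
    using Lmeas bound[OF z] by (intro integrable_const_bound[of _ "B * norm h"]) auto
  have lip: "norm (k x t - k z t) \<le> B * norm (x - z)" if x: "x \<in> ball z r" and t: "t \<in> space M" for x t
  proof (rule differentiable_bound[of "ball z r" _ "\<lambda>x. L x t"])
    show "((\<lambda>x. k x t) has_derivative L x t) (at x within ball z r)" if "x \<in> ball z r" for x
      using der[OF that t] by (rule has_derivative_at_withinI)
    show "onorm (L x t) \<le> B" if "x \<in> ball z r" for x
      using B0 bound[OF that t] by (rule onorm_bound)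
  qed (use x z in auto)
  show ?thesis
    unfolding has_derivative_at
  proof (intro conjI)
    show "bounded_linear (\<lambda>h. \<integral>t. L z t h \<partial>M)"
    proof (rule bounded_linear_intro)
      fix x y
      have "(\<integral>t. L z t (x + y) \<partial>M) = (\<integral>t. L z t x + L z t y \<partial>M)"
        by (intro Bochner_Integration.integral_cong) (auto simp: linear_simps(1) lin)
      then show "(\<integral>t. L z t (x + y) \<partial>M) = (\<integral>t. L z t x \<partial>M) + (\<integral>t. L z t y \<partial>M)"
        using Lint by simp
    next
      fix c :: real and x
      have "(\<integral>t. L z t (c *\<^sub>R x) \<partial>M) = (\<integral>t. c *\<^sub>R L z t x \<partial>M)"
        by (intro Bochner_Integration.integral_cong) (auto simp: linear_simps(5) lin)
      then show "(\<integral>t. L z t (c *\<^sub>R x) \<partial>M) = c *\<^sub>R (\<integral>t. L z t x \<partial>M)" by simp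
    next
      fix x
      have "norm (\<integral>t. L z t x \<partial>M) \<le> (\<integral>t. norm (L z t x) \<partial>M)"
        by (rule integral_norm_bound)
      also have "\<dots> \<le> (\<integral>t. B * norm x \<partial>M)"
        using Lint bound[OF z] by (intro integral_mono) auto
      finally show "norm (\<integral>t. L z t x \<partial>M) \<le> norm x * (B * measure M (space M))"
        by (simp add: ac_simps)
    qed
    show "(\<lambda>h. norm ((\<integral>t. k (z + h) t \<partial>M) - (\<integral>t. k z t \<partial>M) - (\<integral>t. L z t h \<partial>M)) / norm h) \<midarrow>0\<rightarrow> 0"
      unfolding tendsto_at_iff_sequentially comp_def
    proof (intro allI impI)
      fix X :: "nat \<Rightarrow> 'a" assume "\<forall>i. X i \<in> UNIV - {0}" and X: "X \<longlonglongrightarrow> 0"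
      then have X0: "\<And>i. X i \<noteq> 0" by simp
      have "\<forall>\<^sub>F n in sequentially. X n \<in> ball 0 r"
        using X r by (intro topological_tendstoD) auto
      then obtain N where N: "\<And>n. n \<ge> N \<Longrightarrow> X n \<in> ball 0 r"
        unfolding eventually_sequentially by blast
      define Y where "Y n = X (n + N)" for n
      have Y0: "Y n \<noteq> 0" and Yr: "z + Y n \<in> ball z r" for n
        using X0 N[of "n + N"] by (auto simp: Y_def dist_norm)
      have Y: "Y \<longlonglongrightarrow> 0" unfolding Y_def using X by (rule LIMSEQ_ignore_initial_segment)
      define q where "q n t = (k (z + Y n) t - k z t - L z t (Y n)) /\<^sub>R norm (Y n)" for n t
      have "(\<lambda>n. \<integral>t. q n t \<partial>M) \<longlonglongrightarrow> (\<integral>t. 0 \<partial>M)"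
      proof (rule integral_dominated_convergence[where w = "\<lambda>_. 2 * B"])
        show "q n \<in> borel_measurable M" for n
          unfolding q_def using meas[OF Yr] meas[OF z] Lmeas by measurable
        show "AE t in M. (\<lambda>n. q n t) \<longlonglongrightarrow> 0"
        proof (rule AE_I2)
          fix t assume t: "t \<in> space M"
          have "(\<lambda>h. norm (k (z + h) t - k z t - L z t h) / norm h) \<midarrow>0\<rightarrow> 0"
            using der[OF z t] by (simp add: has_derivative_at)
          then have "(\<lambda>n. norm (k (z + Y n) t - k z t - L z t (Y n)) / norm (Y n)) \<longlonglongrightarrow> 0"
            using Y Y0 unfolding tendsto_at_iff_sequentially comp_def by simp
          then have "(\<lambda>n. norm (q n t)) \<longlonglongrightarrow> 0" by (simp add: q_def divide_inverse_commute)
          then show "(\<lambda>n. q n t) \<longlonglongrightarrow> 0" by (simp add: tendsto_norm_zero_iff)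
        qed
        show "AE t in M. norm (q n t) \<le> 2 * B" for n
        proof (rule AE_I2)
          fix t assume t: "t \<in> space M"
          have "norm (k (z + Y n) t - k z t - L z t (Y n)) \<le> 2 * B * norm (Y n)"
            using norm_triangle_ineq4[of "k (z + Y n) t - k z t" "L z t (Y n)"]
              lip[OF Yr[of n] t] bound[OF z t, of "Y n"] by simp
          then show "norm (q n t) \<le> 2 * B"
            using Y0[of n] by (simp add: q_def divide_inverse_commute[symmetric] pos_divide_le_eq)
        qed
      qed simp_all
      then have "(\<lambda>n. norm (\<integral>t. q n t \<partial>M)) \<longlonglongrightarrow> 0" by (simp add: tendsto_norm_zero_iff)
      moreover have "norm (\<integral>t. q n t \<partial>M) = norm ((\<integral>t. k (z + Y n) t \<partial>M) - (\<integral>t. k z t \<partial>M) -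
          (\<integral>t. L z t (Y n) \<partial>M)) / norm (Y n)" for n
        unfolding q_def using int[OF Yr] int[OF z] Lint by (simp add: divide_inverse_commute)
      ultimately show "(\<lambda>n. norm ((\<integral>t. k (z + X n) t \<partial>M) - (\<integral>t. k z t \<partial>M) - (\<integral>t. L z t (X n) \<partial>M)) / norm (X n)) \<longlonglongrightarrow> 0"
        using LIMSEQ_offset[of "\<lambda>n. norm ((\<integral>t. k (z + X n) t \<partial>M) - (\<integral>t. k z t \<partial>M) - (\<integral>t. L z t (X n) \<partial>M)) / norm (X n)" N]
        by (simp add: Y_def)
    qed
  qed
qed

lemma bounded_on_compact_product:
  fixes k :: "'a::metric_space \<Rightarrow> 'b::metric_space \<Rightarrow> complex"
  assumes "compact A" "compact T" "continuous_on (A \<times> T) (\<lambda>(z, t). k z t)"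
  obtains K where "K \<ge> 0" "\<And>z t. \<lbrakk>z \<in> A; t \<in> T\<rbrakk> \<Longrightarrow> cmod (k z t) \<le> K"
proof -
  have "bounded ((\<lambda>(z, t). k z t) ` (A \<times> T))"
    using assms by (intro compact_imp_bounded compact_continuous_image compact_Times)
  then obtain K where K: "\<forall>x\<in>(\<lambda>(z, t). k z t) ` (A \<times> T). norm x \<le> K"
    unfolding bounded_iff by blast
  show ?thesis
  proof (rule that[of "max K 0"])
    fix z t assume "z \<in> A" "t \<in> T"
    then have "(\<lambda>(z, t). k z t) (z, t) \<in> (\<lambda>(z, t). k z t) ` (A \<times> T)" by (intro imageI) simp
    then have "cmod (k z t) \<le> K" using K by fastforce
    then show "cmod (k z t) \<le> max K 0" by simp
  qed simp
qed

lemma continuous_on_integral: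
  fixes k :: "'a::metric_space \<Rightarrow> 'b::metric_space \<Rightarrow> complex"
  assumes "finite_measure M" "space M \<subseteq> T" "compact A" "compact T"
    and cont: "continuous_on (A \<times> T) (\<lambda>(z, t). k z t)"
    and meas: "\<And>z. z \<in> A \<Longrightarrow> k z \<in> borel_measurable M"
  shows "continuous_on A (\<lambda>z. \<integral>t. k z t \<partial>M)"
proof -
  interpret finite_measure M by fact
  obtain K where "K \<ge> 0" and K: "\<And>z t. \<lbrakk>z \<in> A; t \<in> T\<rbrakk> \<Longrightarrow> cmod (k z t) \<le> K"
    by (rule bounded_on_compact_product[OF assms(3,4) cont]) (rule that)
  show ?thesis unfolding continuous_on_sequentially comp_def
  proof (intro ballI allI impI, elim conjE)
    fix X a assume a: "a \<in> A" and X: "\<forall>n. X n \<in> A" "X \<longlonglongrightarrow> a"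
    show "(\<lambda>n. \<integral>t. k (X n) t \<partial>M) \<longlonglongrightarrow> (\<integral>t. k a t \<partial>M)"
    proof (rule integral_dominated_convergence[where w = "\<lambda>_. K"])
      show "AE t in M. (\<lambda>n. k (X n) t) \<longlonglongrightarrow> k a t"
      proof (rule AE_I2)
        fix t assume "t \<in> space M"
        then have "t \<in> T" using assms(2) by blast
        then have "continuous_on A (\<lambda>z. (\<lambda>(z, t). k z t) (z, t))"
          by (intro continuous_on_compose2[OF cont] continuous_intros) auto
        then have "continuous_on A (\<lambda>z. k z t)" by simp
        from continuous_on_tendsto_compose[OF this X(2) a] X(1)
        show "(\<lambda>n. k (X n) t) \<longlonglongrightarrow> k a t" by simp
      qed
      show "AE t in M. norm (k (X n) t) \<le> K" for n
        using K X(1) assms(2) by (intro AE_I2) blast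
    qed (use meas a X in auto)
  qed
qed

text \<open>Cauchy's estimate is applied on the circle of radius \<open>r / 2\<close>, on which \<open>f\<close> is continuous; this
  gives the factor \<open>2\<close>.\<close>

lemma cmod_deriv_le:
  assumes "f holomorphic_on ball z r" "r > 0" "\<And>w. w \<in> ball z r \<Longrightarrow> cmod (f w) \<le> K"
  shows "cmod (deriv f z) \<le> 2 * K / r"
proof -
  have "cmod ((deriv ^^ 1) f z) \<le> fact 1 * K / (r / 2) ^ 1"
  proof (rule Cauchy_inequality)
    show "f holomorphic_on ball z (r / 2)"
      using assms(1) by (rule holomorphic_on_subset) (use assms(2) in auto)
    have "cball z (r / 2) \<subseteq> ball z r" using assms(2) by auto
    then show "continuous_on (cball z (r / 2)) f"
      using holomorphic_on_imp_continuous_on[OF assms(1)] continuous_on_subset by blast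
    show "cmod (f x) \<le> K" if "cmod (z - x) = r / 2" for x
      using that assms(2) by (intro assms(3)) (simp add: dist_norm)
  qed (use assms in auto)
  then show ?thesis by (simp add: mult.commute)
qed

text \<open>Cauchy's estimate turns a bound of \<open>k\<close> on a compact neighbourhood of \<open>z\<close> into the bound of its
  derivative that differentiation under the integral sign asks for.\<close>

lemma holomorphic_on_integral:
  fixes k :: "complex \<Rightarrow> 'b::metric_space \<Rightarrow> complex"
  assumes "finite_measure M" "space M \<subseteq> T" "compact T" "open U"
    and hol: "\<And>t. t \<in> T \<Longrightarrow> (\<lambda>z. k z t) holomorphic_on U"
    and cont: "continuous_on (U \<times> T) (\<lambda>(z, t). k z t)"
    and meas: "\<And>z. z \<in> U \<Longrightarrow> k z \<in> borel_measurable M"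
  shows "(\<lambda>z. \<integral>t. k z t \<partial>M) holomorphic_on U"
proof -
  interpret finite_measure M by fact
  have "(\<lambda>z. \<integral>t. k z t \<partial>M) field_differentiable (at z)" if z: "z \<in> U" for z
  proof -
    obtain r0 where r0: "r0 > 0" "cball z r0 \<subseteq> U" using \<open>open U\<close> z open_contains_cball by blast
    define r where "r = r0 / 2"
    have r: "r > 0" using r0 by (simp add: r_def)
    have sub: "ball x r \<subseteq> cball z r0" if "x \<in> ball z r" for x
    proof
      fix y assume "y \<in> ball x r"
      then show "y \<in> cball z r0"
        using that dist_triangle[of z y x] by (simp add: r_def)
    qed
    obtain K where K: "K \<ge> 0" "\<And>x t. \<lbrakk>x \<in> cball z r0; t \<in> T\<rbrakk> \<Longrightarrow> cmod (k x t) \<le> K"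
      by (rule bounded_on_compact_product[OF compact_cball \<open>compact T\<close>
          continuous_on_subset[OF cont Sigma_mono[OF r0(2) order_refl]]]) (rule that)
    have inU: "x \<in> U" "x \<in> cball z r0" if "x \<in> ball z r" for x
      using subsetD[OF sub[OF that], of x] r r0 by auto
    have "((\<lambda>x. \<integral>t. k x t \<partial>M) has_derivative (\<lambda>h. \<integral>t. deriv (\<lambda>x. k x t) z * h \<partial>M)) (at z)"
    proof (rule has_derivative_integral[OF assms(1) r,
          where B = "2 * K / r" and L = "\<lambda>x t h. deriv (\<lambda>x. k x t) x * h"])
      show "integrable M (k x)" if "x \<in> ball z r" for x
        using K(2)[OF inU(2)[OF that]] meas[OF inU(1)[OF that]] assms(2)
        by (intro integrable_const_bound[of _ K]) (auto intro!: AE_I2)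
      fix x t assume x: "x \<in> ball z r" and t: "t \<in> space M"
      then have tT: "t \<in> T" using assms(2) by blast
      show "((\<lambda>x. k x t) has_derivative (\<lambda>h. deriv (\<lambda>x. k x t) x * h)) (at x)"
        using holomorphic_derivI[OF hol[OF tT] \<open>open U\<close> inU(1)[OF x]]
        by (simp add: has_field_derivative_def)
      have "(\<lambda>x. k x t) holomorphic_on ball x r"
        using hol[OF tT] by (rule holomorphic_on_subset) (use sub[OF x] r0 in blast)
      then have "cmod (deriv (\<lambda>x. k x t) x) \<le> 2 * K / r"
        using r sub[OF x] K(2)[OF _ tT] by (intro cmod_deriv_le) auto
      then show "cmod (deriv (\<lambda>x. k x t) x * h) \<le> 2 * K / r * norm h" for h
        by (simp only: norm_mult) (intro mult_right_mono norm_ge_zero)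
    qed (use K r inU meas in auto)
    moreover have "(\<lambda>h. \<integral>t. deriv (\<lambda>x. k x t) z * h \<partial>M) = (\<lambda>h. (\<integral>t. deriv (\<lambda>x. k x t) z \<partial>M) * h)"
      by simp
    ultimately show ?thesis
      unfolding field_differentiable_def has_field_derivative_def by metis
  qed
  then show ?thesis by (auto simp: holomorphic_on_def intro: field_differentiable_at_within)
qed

section \<open>Holomorphic functions of several variables\<close>

lemma norm_vector_smult: "norm (c *s v) = cmod c * norm (v :: complex^'n)"
  unfolding norm_vec_def by (simp add: norm_mult L2_set_right_distrib)

lemma bounded_bilinear_vector_smult: "bounded_bilinear ((*s) :: complex \<Rightarrow> complex^'n \<Rightarrow> complex^'n)"
proof
  show "\<exists>K. \<forall>a b. norm (a *s b :: complex^'n) \<le> norm a * norm b * K"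
    by (intro exI[of _ 1]) (simp add: norm_vector_smult)
qed (simp_all add: vec_eq_iff algebra_simps)

lemmas continuous_on_vector_smult [continuous_intros] =
  bounded_bilinear.continuous_on[OF bounded_bilinear_vector_smult]

lemma scaleR_eq_smult: "r *\<^sub>R v = complex_of_real r *s (v :: complex^'n)"
  unfolding vec_eq_iff vector_scaleR_component vector_smult_component
  by (simp add: scaleR_conv_of_real[where 'a = complex])

lemma has_derivative_smult_left:
  "((\<lambda>c. a + c *s v) has_derivative (\<lambda>h. h *s v)) (at (c :: complex))"
  for v :: "complex^'n"
  using has_derivative_add[OF has_derivative_const[of a] bounded_linear_imp_has_derivative[OF
        bounded_bilinear.bounded_linear_left[OF bounded_bilinear_vector_smult, of v]]]
  by simp

lemma has_derivative_smult_right: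
  "((\<lambda>z. a + c *s z) has_derivative (\<lambda>h. c *s h)) (at (z :: complex^'n))"
  using has_derivative_add[OF has_derivative_const[of a] bounded_linear_imp_has_derivative[OF
        bounded_bilinear.bounded_linear_right[OF bounded_bilinear_vector_smult, of c]]]
  by simp

lemma has_field_derivative_slice:
  fixes f :: "complex^'n \<Rightarrow> complex"
  assumes "(f has_derivative L) (at (a + c *s v))" and "\<And>c v. L (c *s v) = c * L v"
  shows "((\<lambda>c. f (a + c *s v)) has_field_derivative L v) (at c)"
  using has_derivative_compose[OF has_derivative_smult_left assms(1)]
  by (simp add: has_field_derivative_def assms(2) mult.commute[of _ "L v"])

lemma holomorphic_on_slice:
  fixes f :: "complex^'n \<Rightarrow> complex"
  assumes "hol_on f U" "\<And>c. c \<in> A \<Longrightarrow> a + c *s v \<in> U"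
  shows "(\<lambda>c. f (a + c *s v)) holomorphic_on A"
  unfolding holomorphic_on_def
proof
  fix c assume "c \<in> A"
  then obtain L where "(f has_derivative L) (at (a + c *s v))" "\<And>c v. L (c *s v) = c * L v"
    using assms unfolding hol_on_def by blast
  from has_field_derivative_slice[OF this]
  show "(\<lambda>c. f (a + c *s v)) field_differentiable at c within A"
    using field_differentiable_def field_differentiable_at_within by blast
qed

lemma hol_on_imp_continuous_on: "hol_on f U \<Longrightarrow> continuous_on U f"
  unfolding hol_on_def
  by (meson continuous_at_imp_continuous_on has_derivative_continuous)

lemma hol_on_subset: "\<lbrakk>hol_on f U; V \<subseteq> U\<rbrakk> \<Longrightarrow> hol_on f V"
  by (auto simp: hol_on_def)

lemma hol_on_const: "hol_on (\<lambda>z. c) U"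
  unfolding hol_on_def by (intro ballI exI[of _ "\<lambda>_. 0"]) auto

lemma hol_on_coordinate: "hol_on (\<lambda>z. z $ i) U"
  unfolding hol_on_def
  by (intro ballI exI[of _ "\<lambda>z. z $ i"])
    (simp add: bounded_linear_vec_nth bounded_linear_imp_has_derivative)

lemma hol_on_add:
  assumes "hol_on f U" "hol_on g U"
  shows "hol_on (\<lambda>z. f z + g z) U"
  unfolding hol_on_def
proof
  fix z assume z: "z \<in> U"
  obtain L M where "(f has_derivative L) (at z)" "\<forall>c v. L (c *s v) = c * L v"
    "(g has_derivative M) (at z)" "\<forall>c v. M (c *s v) = c * M v"
    using assms z unfolding hol_on_def by blast
  then show "\<exists>L. ((\<lambda>z. f z + g z) has_derivative L) (at z) \<and> (\<forall>c v. L (c *s v) = c * L v)"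
    by (intro exI[of _ "\<lambda>v. L v + M v"]) (simp add: has_derivative_add algebra_simps)
qed

lemma hol_on_mult:
  assumes "hol_on f U" "hol_on g U"
  shows "hol_on (\<lambda>z. f z * g z) U"
  unfolding hol_on_def
proof
  fix z assume z: "z \<in> U"
  obtain L M where "(f has_derivative L) (at z)" "\<forall>c v. L (c *s v) = c * L v"
    "(g has_derivative M) (at z)" "\<forall>c v. M (c *s v) = c * M v"
    using assms z unfolding hol_on_def by blast
  then show "\<exists>L. ((\<lambda>z. f z * g z) has_derivative L) (at z) \<and> (\<forall>c v. L (c *s v) = c * L v)"
    by (intro exI[of _ "\<lambda>v. f z * M v + L v * g z"]) (auto intro!: derivative_eq_intros simp: algebra_simps)
qed

lemma hol_on_prod:
  assumes "finite I" "\<And>i. i \<in> I \<Longrightarrow> hol_on (f i) U"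
  shows "hol_on (\<lambda>z. \<Prod>i\<in>I. f i z) U"
  using assms by (induction I) (auto intro: hol_on_const hol_on_mult)

lemma hol_on_sum:
  assumes "finite I" "\<And>i. i \<in> I \<Longrightarrow> hol_on (f i) U"
  shows "hol_on (\<lambda>z. \<Sum>i\<in>I. f i z) U"
  using assms by (induction I) (auto intro: hol_on_const hol_on_add)

lemma hol_on_power: "hol_on f U \<Longrightarrow> hol_on (\<lambda>z. f z ^ n) U"
  by (induction n) (auto intro: hol_on_const hol_on_mult)

lemma hol_on_affine:
  assumes "hol_on f U" "\<And>z. z \<in> V \<Longrightarrow> a + c *s z \<in> U"
  shows "hol_on (\<lambda>z. f (a + c *s z)) V"
  unfolding hol_on_def
proof
  fix z assume "z \<in> V"
  then obtain L where "(f has_derivative L) (at (a + c *s z))" and L: "\<forall>c v. L (c *s v) = c * L v"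
    using assms unfolding hol_on_def by blast
  from has_derivative_compose[OF has_derivative_smult_right this(1)] L
  show "\<exists>L. ((\<lambda>z. f (a + c *s z)) has_derivative L) (at z) \<and> (\<forall>c v. L (c *s v) = c * L v)"
    by (intro exI[of _ "\<lambda>v. L (c *s v)"]) (simp add: mult.left_commute)
qed

text \<open>Used for the partial derivatives, which are given by a different integral formula near
  each point.\<close>

lemma hol_on_local:
  assumes "\<And>z. z \<in> U \<Longrightarrow> \<exists>V g. open V \<and> z \<in> V \<and> hol_on g V \<and> (\<forall>w\<in>V. f w = g w)"
  shows "hol_on f U"
  unfolding hol_on_def
proof
  fix z assume "z \<in> U"
  then obtain V g where V: "open V" "z \<in> V" "hol_on g V" "\<And>w. w \<in> V \<Longrightarrow> g w = f w"
    using assms by metis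
  then obtain L where L: "(g has_derivative L) (at z)" "\<forall>c v. L (c *s v) = c * L v"
    unfolding hol_on_def by blast
  have "(f has_derivative L) (at z)"
    by (rule has_derivative_transform_within_open[OF L(1) V(1,2,4)])
  then show "\<exists>L. (f has_derivative L) (at z) \<and> (\<forall>c v. L (c *s v) = c * L v)" using L by blast
qed

lemma hol_on_derivative_bound:
  fixes f :: "complex^'n \<Rightarrow> complex"
  assumes "hol_on f (ball z r)" "r > 0" "\<And>w. w \<in> ball z r \<Longrightarrow> cmod (f w) \<le> K"
    and L: "(f has_derivative L) (at z)" "\<And>c v. L (c *s v) = c * L v"
  shows "cmod (L v) \<le> 2 * K / r * norm v"
proof (cases "v = 0")
  case True
  then show ?thesis using L(2)[of 0 0] by simp
next
  case False
  define u where "u = complex_of_real (inverse (norm v)) *s v"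
  have u: "norm u = 1" using False by (simp add: u_def norm_vector_smult del: of_real_inverse)
  have vu: "v = complex_of_real (norm v) *s u" using False by (simp add: u_def vector_smult_assoc)
  have in_ball: "z + c *s u \<in> ball z r" if "c \<in> ball 0 r" for c
    using that u by (simp add: dist_norm norm_vector_smult)
  have "deriv (\<lambda>c. f (z + c *s u)) 0 = L u"
    using has_field_derivative_slice[of f L z 0 u] L by (intro DERIV_imp_deriv) simp
  moreover have "cmod (deriv (\<lambda>c. f (z + c *s u)) 0) \<le> 2 * K / r"
    using assms(3) in_ball by (intro cmod_deriv_le holomorphic_on_slice[OF assms(1)] assms(2)) auto
  ultimately have "norm v * cmod (L u) \<le> norm v * (2 * K / r)"
    by (intro mult_left_mono) auto
  moreover have "cmod (L v) = norm v * cmod (L u)"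
    by (subst vu) (simp add: L(2) norm_mult)
  ultimately show ?thesis by (simp add: mult.commute)
qed

lemma hol_on_integral:
  fixes k :: "complex^'n \<Rightarrow> 'b::metric_space \<Rightarrow> complex"
  assumes "finite_measure M" "space M \<subseteq> T" "compact T" "open U"
    and hol: "\<And>t. t \<in> T \<Longrightarrow> hol_on (\<lambda>z. k z t) U"
    and cont: "continuous_on (U \<times> T) (\<lambda>(z, t). k z t)"
    and meas: "\<And>z. z \<in> U \<Longrightarrow> k z \<in> borel_measurable M"
  shows "hol_on (\<lambda>z. \<integral>t. k z t \<partial>M) U"
  unfolding hol_on_def
proof
  interpret finite_measure M by fact
  fix z assume z: "z \<in> U"
  obtain r0 where r0: "r0 > 0" "cball z r0 \<subseteq> U" using \<open>open U\<close> z open_contains_cball by blast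
  define r where "r = r0 / 2"
  have r: "r > 0" using r0 by (simp add: r_def)
  have sub: "ball x r \<subseteq> cball z r0" if "x \<in> ball z r" for x
  proof
    fix y assume "y \<in> ball x r"
    then show "y \<in> cball z r0"
      using that dist_triangle[of z y x] by (simp add: r_def)
  qed
  have inU: "x \<in> U" "x \<in> cball z r0" if "x \<in> ball z r" for x
    using subsetD[OF sub[OF that], of x] r r0 by auto
  obtain K where K: "K \<ge> 0" "\<And>x t. \<lbrakk>x \<in> cball z r0; t \<in> T\<rbrakk> \<Longrightarrow> cmod (k x t) \<le> K"
    by (rule bounded_on_compact_product[OF compact_cball \<open>compact T\<close>
        continuous_on_subset[OF cont Sigma_mono[OF r0(2) order_refl]]]) (rule that)
  have "\<forall>x\<in>U. \<forall>t\<in>T. \<exists>L. ((\<lambda>x. k x t) has_derivative L) (at x) \<and> (\<forall>c v. L (c *s v) = c * L v)"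
    using hol unfolding hol_on_def by blast
  then obtain L where L: "\<And>x t. \<lbrakk>x \<in> U; t \<in> T\<rbrakk> \<Longrightarrow> ((\<lambda>x. k x t) has_derivative L x t) (at x)"
    and Lc: "\<And>x t c v. \<lbrakk>x \<in> U; t \<in> T\<rbrakk> \<Longrightarrow> L x t (c *s v) = c * L x t v"
    by metis
  have "((\<lambda>x. \<integral>t. k x t \<partial>M) has_derivative (\<lambda>h. \<integral>t. L z t h \<partial>M)) (at z)"
  proof (rule has_derivative_integral[OF assms(1) r, where B = "2 * K / r" and L = L])
    show "integrable M (k x)" if "x \<in> ball z r" for x
      using K(2)[OF inU(2)[OF that]] meas[OF inU(1)[OF that]] assms(2)
      by (intro integrable_const_bound[of _ K]) (auto intro!: AE_I2)
    fix x t assume x: "x \<in> ball z r" and t: "t \<in> space M"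
    then have tT: "t \<in> T" using assms(2) by blast
    show "((\<lambda>x. k x t) has_derivative L x t) (at x)" by (rule L[OF inU(1)[OF x] tT])
    show "cmod (L x t h) \<le> 2 * K / r * norm h" for h
    proof (rule hol_on_derivative_bound[OF _ r _ L[OF inU(1)[OF x] tT] Lc[OF inU(1)[OF x] tT]])
      show "hol_on (\<lambda>x. k x t) (ball x r)"
        using hol[OF tT] by (rule hol_on_subset) (use sub[OF x] r0 in blast)
      show "cmod (k w t) \<le> K" if "w \<in> ball x r" for w
        using sub[OF x] that by (intro K(2) tT) blast
    qed
  qed (use K r inU meas in auto)
  moreover have "(\<integral>t. L z t (c *s v) \<partial>M) = c * (\<integral>t. L z t v \<partial>M)" for c v
  proof -
    have "(\<integral>t. L z t (c *s v) \<partial>M) = (\<integral>t. c * L z t v \<partial>M)"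
      using Lc[OF z] assms(2) by (intro Bochner_Integration.integral_cong) auto
    then show ?thesis by simp
  qed
  ultimately show "\<exists>L. ((\<lambda>z. \<integral>t. k z t \<partial>M) has_derivative L) (at z) \<and> (\<forall>c v. L (c *s v) = c * L v)"
    by blast
qed

definition partial_deriv :: "'n \<Rightarrow> (complex^'n \<Rightarrow> complex) \<Rightarrow> complex^'n \<Rightarrow> complex" where
  "partial_deriv i f z = deriv (\<lambda>c. f (z + c *s axis i 1)) 0"

lemma hol_on_slice_deriv:
  fixes f :: "complex^'n \<Rightarrow> complex"
  assumes "hol_on f U" "c *s v \<in> U"
  shows "deriv (\<lambda>c. f (c *s v)) c = (\<Sum>i\<in>UNIV. v $ i * partial_deriv i f (c *s v))"
proof -
  obtain L where L: "(f has_derivative L) (at (c *s v))" and Lc: "\<And>c v. L (c *s v) = c * L v"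
    using assms unfolding hol_on_def by blast
  have lin: "linear L" using L by (simp add: has_derivative_bounded_linear bounded_linear.linear)
  have part: "partial_deriv i f (c *s v) = L (axis i 1)" for i
    unfolding partial_deriv_def
    using has_field_derivative_slice[of f L "c *s v" 0 "axis i 1"] L Lc
    by (intro DERIV_imp_deriv) simp
  have "deriv (\<lambda>c. f (c *s v)) c = L v"
    using has_field_derivative_slice[of f L 0 c v] L Lc by (intro DERIV_imp_deriv) simp
  also have "L v = L (\<Sum>i\<in>UNIV. v $ i *s axis i 1)" by (simp add: basis_expansion)
  also have "\<dots> = (\<Sum>i\<in>UNIV. L (v $ i *s axis i 1))" by (rule linear_sum[OF lin])
  finally show ?thesis by (simp add: Lc part)
qed

text \<open>Cauchy's formula on a small circle in the direction of the \<open>i\<close>-th axis expresses the partial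
  derivative as an average of translates of \<open>f\<close>.\<close>

lemma hol_on_partial_deriv:
  fixes f :: "complex^'n \<Rightarrow> complex"
  assumes "open U" and hol: "hol_on f U"
  shows "hol_on (partial_deriv i f) U"
proof (rule hol_on_local)
  fix z0 assume "z0 \<in> U"
  then obtain r0 where r0: "r0 > 0" "cball z0 r0 \<subseteq> U" using \<open>open U\<close> open_contains_cball by blast
  define r where "r = r0 / 2"
  have r: "r > 0" using r0 by (simp add: r_def)
  define M where "M = lebesgue_on {0..1::real}"
  define \<gamma> where "\<gamma> = circlepath 0 r"
  define \<gamma>' where "\<gamma>' t = vector_derivative \<gamma> (at t)" for t
  define k where "k z t = f (z + \<gamma> t *s axis i 1) / (\<gamma> t)\<^sup>2 * \<gamma>' t" for z t
  have \<gamma>_eq: "\<gamma> t = r * exp (2 * of_real pi * \<i> * of_real t)" for t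
    by (simp add: \<gamma>_def circlepath)
  have \<gamma>'_eq: "\<gamma>' t = 2 * pi * \<i> * r * exp (2 * of_real pi * \<i> * of_real t)" for t
    by (simp add: \<gamma>'_def \<gamma>_def vector_derivative_circlepath)
  have norm_\<gamma>: "cmod (\<gamma> t) = r" for t using r by (simp add: \<gamma>_eq norm_mult)
  have \<gamma>0: "\<gamma> t \<noteq> 0" for t using norm_\<gamma>[of t] r by auto
  have in_U: "z + c *s axis i 1 \<in> U" if "z \<in> ball z0 r" "cmod c \<le> r" for z c
  proof -
    have "norm (c *s axis i 1 :: complex^'n) \<le> r" using that by (simp add: norm_vector_smult)
    moreover have "dist z (z + c *s axis i 1) = norm (c *s axis i 1 :: complex^'n)"
      by (simp add: dist_norm)
    ultimately have "dist z0 (z + c *s axis i 1) \<le> r0"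
      using that dist_triangle[of z0 "z + c *s axis i 1" z] by (simp add: r_def)
    then show ?thesis using r0 by auto
  qed
  have cont_\<gamma>: "continuous_on A \<gamma>" "continuous_on A \<gamma>'" for A
    unfolding \<gamma>_eq[abs_def] \<gamma>'_eq[abs_def] by (intro continuous_intros)+
  have cont_k: "continuous_on (ball z0 r \<times> {0..1}) (\<lambda>(z, t). k z t)"
    unfolding k_def split_beta
    using in_U norm_\<gamma> \<gamma>0
    by (intro continuous_intros continuous_on_compose2[OF hol_on_imp_continuous_on[OF hol]]
        continuous_on_compose2[OF cont_\<gamma>(1)[of UNIV]] continuous_on_compose2[OF cont_\<gamma>(2)[of UNIV]]) auto
  have cont_k1: "continuous_on {0..1} (k z)" if "z \<in> ball z0 r" for z
  proof -
    have "continuous_on {0..1} (\<lambda>t. (\<lambda>(z, t). k z t) (z, t))"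
      using that by (intro continuous_on_compose2[OF cont_k] continuous_intros) auto
    then show ?thesis by simp
  qed
  have fin: "finite_measure M" unfolding M_def by (intro finite_measure_lebesgue_on) simp
  have meas: "k z \<in> borel_measurable M" if "z \<in> ball z0 r" for z
    unfolding M_def using cont_k1[OF that] by (intro continuous_imp_measurable_on_sets_lebesgue) auto
  have "hol_on (\<lambda>z. \<integral>t. k z t \<partial>M) (ball z0 r)"
  proof (rule hol_on_integral[OF fin, of "{0..1}"])
    show "hol_on (\<lambda>z. k z t) (ball z0 r)" for t
    proof -
      have "hol_on (\<lambda>z. f (\<gamma> t *s axis i 1 + 1 *s z)) (ball z0 r)"
        using in_U norm_\<gamma> by (intro hol_on_affine[OF hol]) (simp add: add.commute)
      then have "hol_on (\<lambda>z. f (z + \<gamma> t *s axis i 1) * (\<gamma>' t / (\<gamma> t)\<^sup>2)) (ball z0 r)"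
        by (intro hol_on_mult hol_on_const) (simp add: add.commute)
      then show ?thesis by (simp add: k_def)
    qed
  qed (use cont_k meas in \<open>auto simp: M_def\<close>)
  then have hol_int: "hol_on (\<lambda>z. (1 / (2 * pi * \<i>)) * (\<integral>t. k z t \<partial>M)) (ball z0 r)"
    by (intro hol_on_mult hol_on_const)
  have "partial_deriv i f z = (1 / (2 * pi * \<i>)) * (\<integral>t. k z t \<partial>M)" if z: "z \<in> ball z0 r" for z
  proof -
    let ?f = "\<lambda>c. f (z + c *s axis i 1)"
    have "?f holomorphic_on cball 0 r"
      using in_U[OF z] by (intro holomorphic_on_slice[OF hol]) auto
    then have "((\<lambda>u. ?f u / (u - 0) ^ (Suc 1)) has_contour_integral
        ((2 * pi * \<i>) / (fact 1) * (deriv ^^ 1) ?f 0)) (circlepath 0 r)"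
      using r by (intro Cauchy_has_contour_integral_higher_derivative_circlepath)
        (auto intro: holomorphic_on_imp_continuous_on holomorphic_on_subset)
    then have "(k z has_integral (2 * pi * \<i>) * partial_deriv i f z) {0..1}"
      by (simp add: has_contour_integral k_def[abs_def] \<gamma>_def[symmetric] \<gamma>'_def partial_deriv_def
          power2_eq_square)
    moreover have "integrable M (k z)"
    proof -
      interpret finite_measure M by (fact fin)
      have "bounded (k z ` {0..1})"
        using cont_k1[OF z] by (intro compact_imp_bounded compact_continuous_image) auto
      then obtain B where "\<forall>t\<in>{0..1}. norm (k z t) \<le> B" by (auto simp: bounded_iff)
      then show ?thesis
        using meas[OF z] by (intro integrable_const_bound[of _ B] AE_I2) (auto simp: M_def)
    qed
    ultimately have "(\<integral>t. k z t \<partial>M) = (2 * pi * \<i>) * partial_deriv i f z"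
      unfolding M_def by (simp add: lebesgue_integral_eq_integral integral_unique)
    then show ?thesis by simp
  qed
  then show "\<exists>V g. open V \<and> z0 \<in> V \<and> hol_on g V \<and> (\<forall>w\<in>V. partial_deriv i f w = g w)"
    using hol_int r by (intro exI[of _ "ball z0 r"] exI[of _ "\<lambda>z. (1 / (2 * pi * \<i>)) * (\<integral>t. k z t \<partial>M)"]) auto
qed

section \<open>Polynomial approximation\<close>

lemma hol_polynomial_add:
  assumes "hol_polynomial p" "hol_polynomial q"
  shows "hol_polynomial (\<lambda>z. p z + q z)"
proof -
  obtain A c where A: "finite A" "p = (\<lambda>z. \<Sum>a\<in>A. c a * (\<Prod>i\<in>UNIV. (z $ i) ^ a i))"
    using assms(1) unfolding hol_polynomial_def by blast
  obtain B d where B: "finite B" "q = (\<lambda>z. \<Sum>a\<in>B. d a * (\<Prod>i\<in>UNIV. (z $ i) ^ a i))"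
    using assms(2) unfolding hol_polynomial_def by blast
  let ?e = "\<lambda>a. (if a \<in> A then c a else 0) + (if a \<in> B then d a else 0)"
  have pA: "p z = (\<Sum>a\<in>A \<union> B. (if a \<in> A then c a else 0) * (\<Prod>i\<in>UNIV. (z $ i) ^ a i))" for z
    unfolding A(2) using A B by (intro sum.mono_neutral_cong_left) auto
  have qB: "q z = (\<Sum>a\<in>A \<union> B. (if a \<in> B then d a else 0) * (\<Prod>i\<in>UNIV. (z $ i) ^ a i))" for z
    unfolding B(2) using A B by (intro sum.mono_neutral_cong_left) auto
  have "(\<lambda>z. p z + q z) = (\<lambda>z. \<Sum>a\<in>A \<union> B. ?e a * (\<Prod>i\<in>UNIV. (z $ i) ^ a i))"
    by (simp only: pA qB sum.distrib distrib_right)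
  then show ?thesis unfolding hol_polynomial_def
    by (intro exI[of _ "A \<union> B"] exI[of _ ?e] conjI) (simp_all add: A B)
qed

lemma hol_polynomial_const: "hol_polynomial (\<lambda>z. c)"
  unfolding hol_polynomial_def
  by (intro exI[of _ "{\<lambda>_. 0}"] exI[of _ "\<lambda>_. c"]) simp

lemma hol_polynomial_sum:
  assumes "finite I" "\<And>i. i \<in> I \<Longrightarrow> hol_polynomial (p i)"
  shows "hol_polynomial (\<lambda>z. \<Sum>i\<in>I. p i z)"
  using assms by (induction I) (auto intro: hol_polynomial_const hol_polynomial_add)

lemma hol_polynomial_monomial: "hol_polynomial (\<lambda>z. c * (\<Prod>i\<in>UNIV. (z $ i) ^ a i))"
  unfolding hol_polynomial_def
  by (intro exI[of _ "{a}"] exI[of _ "\<lambda>_. c"]) simp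

lemma hol_polynomial_scale:
  assumes "hol_polynomial p"
  shows "hol_polynomial (\<lambda>z. c * p z)"
proof -
  obtain A d where A: "finite A" "p = (\<lambda>z. \<Sum>a\<in>A. d a * (\<Prod>i\<in>UNIV. (z $ i) ^ a i))"
    using assms unfolding hol_polynomial_def by blast
  have "hol_polynomial (\<lambda>z. \<Sum>a\<in>A. (c * d a) * (\<Prod>i\<in>UNIV. (z $ i) ^ a i))"
    by (intro hol_polynomial_sum A hol_polynomial_monomial)
  then show ?thesis by (simp add: A sum_distrib_left mult.assoc)
qed

lemma hol_polynomial_coordinate_mult:
  assumes "hol_polynomial p"
  shows "hol_polynomial (\<lambda>z. z $ j * p z)"
proof -
  obtain A d where A: "finite A" "p = (\<lambda>z. \<Sum>a\<in>A. d a * (\<Prod>i\<in>UNIV. (z $ i) ^ a i))"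
    using assms unfolding hol_polynomial_def by blast
  have shift: "(\<Prod>i\<in>UNIV. (z $ i) ^ (a(j := Suc (a j))) i) = z $ j * (\<Prod>i\<in>UNIV. (z $ i) ^ a i)" for a z
    by (simp add: prod.remove[of UNIV j] mult.assoc)
  have shift': "z $ j * (d a * (\<Prod>i\<in>UNIV. (z $ i) ^ a i))
      = d a * (\<Prod>i\<in>UNIV. (z $ i) ^ (a(j := Suc (a j))) i)" for a z
    by (simp only: shift mult.left_commute)
  have "(\<lambda>z. z $ j * p z) = (\<lambda>z. \<Sum>a\<in>A. d a * (\<Prod>i\<in>UNIV. (z $ i) ^ (a(j := Suc (a j))) i))"
    by (simp only: A(2) sum_distrib_left shift')
  moreover have "hol_polynomial (\<lambda>z. \<Sum>a\<in>A. d a * (\<Prod>i\<in>UNIV. (z $ i) ^ (a(j := Suc (a j))) i))"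
    by (intro hol_polynomial_sum A hol_polynomial_monomial)
  ultimately show ?thesis by simp
qed

lemma hol_on_hol_polynomial:
  assumes "hol_polynomial p"
  shows "hol_on p U"
proof -
  obtain A d where "finite A" "p = (\<lambda>z. \<Sum>a\<in>A. d a * (\<Prod>i\<in>UNIV. (z $ i) ^ a i))"
    using assms unfolding hol_polynomial_def by blast
  then show ?thesis
    by (auto intro!: hol_on_sum hol_on_mult hol_on_const hol_on_prod hol_on_power hol_on_coordinate)
qed

lemma higher_deriv_linear_combination:
  assumes "finite I" "\<And>i. i \<in> I \<Longrightarrow> g i holomorphic_on A" "open A" "z \<in> A"
  shows "(deriv ^^ n) (\<lambda>w. \<Sum>i\<in>I. c i * g i w) z = (\<Sum>i\<in>I. c i * (deriv ^^ n) (g i) z)"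
  using assms(1,2)
proof (induction I)
  case empty
  have "(deriv ^^ n) (\<lambda>w::complex. 0::complex) = (\<lambda>w. 0)" by (induction n) auto
  then show ?case by (simp del: higher_deriv_const)
next
  case (insert i I)
  have "(deriv ^^ n) (\<lambda>w. c i * g i w + (\<Sum>i\<in>I. c i * g i w)) z =
      (deriv ^^ n) (\<lambda>w. c i * g i w) z + (deriv ^^ n) (\<lambda>w. \<Sum>i\<in>I. c i * g i w) z"
    using insert.prems by (intro higher_deriv_add[of _ A] holomorphic_on_sum holomorphic_on_mult
        holomorphic_on_const assms(3,4)) auto
  also have "(deriv ^^ n) (\<lambda>w. c i * g i w) z = c i * (deriv ^^ n) (g i) z"
    using insert.prems assms by (intro higher_deriv_cmult) auto
  finally show ?case using insert by simp
qed

text \<open>By the chain rule the \<open>n + 1\<close>-st derivative along the line through \<open>v\<close> is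
  \<open>\<Sum>\<^sub>i v\<^sub>i\<close> times the \<open>n\<close>-th derivative of the \<open>i\<close>-th partial derivative.\<close>

lemma radial_derivative_polynomial:
  fixes f :: "complex^'n \<Rightarrow> complex"
  assumes "open U" "0 \<in> U" "hol_on f U"
  shows "\<exists>p. hol_polynomial p \<and> (\<forall>v. (deriv ^^ n) (\<lambda>c. f (c *s v)) 0 = p v)"
  using assms(3)
proof (induction n arbitrary: f)
  case 0
  then show ?case by (intro exI[of _ "\<lambda>_. f 0"]) (simp add: hol_polynomial_const)
next
  case (Suc n)
  have "\<forall>i. \<exists>p. hol_polynomial p \<and> (\<forall>v. (deriv ^^ n) (\<lambda>c. partial_deriv i f (c *s v)) 0 = p v)"
    using Suc.IH hol_on_partial_deriv[OF assms(1) Suc.prems] by blast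
  then obtain p where p: "\<And>i. hol_polynomial (p i)"
    "\<And>i v. (deriv ^^ n) (\<lambda>c. partial_deriv i f (c *s v)) 0 = p i v" by metis
  have "(deriv ^^ Suc n) (\<lambda>c. f (c *s v)) 0 = (\<Sum>i\<in>UNIV. v $ i * p i v)" for v
  proof -
    let ?A = "(\<lambda>c. c *s v) -` U"
    have A: "open ?A" "0 \<in> ?A"
      using assms(1,2) by (auto intro!: open_vimage continuous_intros)
    have "(deriv ^^ Suc n) (\<lambda>c. f (c *s v)) 0 = (deriv ^^ n) (deriv (\<lambda>c. f (c *s v))) 0"
      by (simp only: funpow_Suc_right comp_def)
    also have "\<dots> = (deriv ^^ n) (\<lambda>c. \<Sum>i\<in>UNIV. v $ i * partial_deriv i f (c *s v)) 0"
    proof (rule higher_deriv_cong_ev[OF _ refl])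
      show "\<forall>\<^sub>F c in nhds 0. deriv (\<lambda>c. f (c *s v)) c = (\<Sum>i\<in>UNIV. v $ i * partial_deriv i f (c *s v))"
        using eventually_nhds_in_open[OF A]
        by eventually_elim (simp add: hol_on_slice_deriv[OF Suc.prems])
    qed
    also have "\<dots> = (\<Sum>i\<in>UNIV. v $ i * (deriv ^^ n) (\<lambda>c. partial_deriv i f (c *s v)) 0)"
      using holomorphic_on_slice[OF hol_on_partial_deriv[OF assms(1) Suc.prems], of ?A 0 v]
      by (intro higher_deriv_linear_combination[of _ _ ?A] A) auto
    finally show ?thesis by (simp add: p)
  qed
  moreover have "hol_polynomial (\<lambda>v. \<Sum>i\<in>UNIV. v $ i * p i v)"
    by (intro hol_polynomial_sum hol_polynomial_coordinate_mult p) simp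
  ultimately show ?case by blast
qed

text \<open>The Taylor polynomials of \<open>c \<mapsto> f (c v)\<close> at \<open>0\<close> are polynomials in \<open>v\<close>, and by Cauchy's estimate
  they converge at \<open>c = r < 1\<close> at a geometric rate that is uniform in \<open>v\<close>.\<close>

lemma dilation_polynomial_approximation:
  fixes f :: "complex^'n \<Rightarrow> complex"
  assumes "open U" "0 \<in> U" "hol_on f U" and bound: "\<And>z. z \<in> U \<Longrightarrow> cmod (f z) \<le> B"
    and star: "\<And>c v. \<lbrakk>v \<in> K; cmod c < 1\<rbrakk> \<Longrightarrow> c *s v \<in> U"
    and r: "0 \<le> r" "r < 1" and e: "e > 0"
  shows "\<exists>p. hol_polynomial p \<and> (\<forall>v\<in>K. cmod (f (of_real r *s v) - p v) < e)"
proof -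
  obtain q where q: "\<And>n. hol_polynomial (q n)"
    "\<And>n v. (deriv ^^ n) (\<lambda>c. f (c *s v)) 0 = q n v"
    using radial_derivative_polynomial[OF assms(1-3)] by metis
  \<comment> \<open>Any radius between \<open>r\<close> and \<open>1\<close> makes the ratio \<open>r / \<rho>\<close> of the dominating series less than \<open>1\<close>.\<close>
  define \<rho> where "\<rho> = (1 + r) / 2"
  have \<rho>: "0 < \<rho>" "\<rho> < 1" "r < \<rho>" using r by (auto simp: \<rho>_def)
  define x where "x = r / \<rho>"
  have x: "0 \<le> x" "x < 1" using \<rho> r by (auto simp: x_def)
  have B0: "B \<ge> 0" using bound[OF assms(2)] norm_ge_zero order_trans by blast
  have "(\<lambda>n. B * x ^ n / (1 - x)) \<longlonglongrightarrow> B * 0 / (1 - x)"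
    using x by (intro tendsto_intros LIMSEQ_realpow_zero) auto
  then have "(\<lambda>n. B * x ^ n / (1 - x)) \<longlonglongrightarrow> 0" by simp
  from order_tendstoD(2)[OF this e] obtain N where N: "B * x ^ N / (1 - x) < e"
    unfolding eventually_sequentially by blast
  define p where "p v = (\<Sum>n<N. of_real (r ^ n) / fact n * q n v)" for v
  have "hol_polynomial p" unfolding p_def[abs_def]
    by (intro hol_polynomial_sum hol_polynomial_scale q) simp
  moreover have "cmod (f (of_real r *s v) - p v) < e" if v: "v \<in> K" for v
  proof -
    let ?h = "\<lambda>c. f (c *s v)" and ?t = "\<lambda>n. q n v / fact n * of_real r ^ n"
    have hol: "?h holomorphic_on ball 0 1"
      using holomorphic_on_slice[OF assms(3), of "ball 0 1" 0 v] star[OF v] by simp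
    have sums: "?t sums ?h (of_real r)"
      using holomorphic_power_series[OF hol, of "of_real r"] r by (simp add: q)
    have tn: "cmod (?t n) \<le> B * x ^ n" for n
    proof -
      have "cmod ((deriv ^^ n) ?h 0) \<le> fact n * B / \<rho> ^ n"
      proof (rule Cauchy_inequality)
        show "?h holomorphic_on ball 0 \<rho>"
          using hol by (rule holomorphic_on_subset) (use \<rho> in auto)
        show "continuous_on (cball 0 \<rho>) ?h"
          using holomorphic_on_imp_continuous_on[OF hol] by (rule continuous_on_subset) (use \<rho> in auto)
        show "cmod (f (c *s v)) \<le> B" if "cmod (0 - c) = \<rho>" for c
          using that \<rho> by (intro bound star v) simp
      qed (use \<rho> in auto)
      then have "cmod (q n v) / fact n * r ^ n \<le> (fact n * B / \<rho> ^ n) / fact n * r ^ n"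
        using r unfolding q by (intro mult_right_mono divide_right_mono) auto
      then show ?thesis
        using r by (simp add: norm_mult norm_divide norm_power x_def power_divide)
    qed
    have summ: "summable (\<lambda>n. B * x ^ (n + N))"
      using x by (intro summable_mult summable_ignore_initial_segment summable_geometric) simp
    have "f (of_real r *s v) - p v = (\<Sum>n. ?t (n + N))"
      using suminf_split_initial_segment[OF sums_summable[OF sums], of N] sums_unique[OF sums]
      by (simp add: p_def ac_simps)
    also have "cmod \<dots> \<le> (\<Sum>n. B * x ^ (n + N))"
      using tn by (intro norm_suminf_le summ)
    also have "\<dots> = (\<Sum>n. B * x ^ N * x ^ n)"
      by (simp add: power_add mult.commute mult.left_commute)
    also have "\<dots> = B * x ^ N * (\<Sum>n. x ^ n)"
      using x by (intro suminf_mult summable_geometric) simp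
    also have "\<dots> = B * x ^ N / (1 - x)" using x by (simp add: suminf_geometric)
    finally show ?thesis using N by simp
  qed
  ultimately show ?thesis by blast
qed

section \<open>Circular convex domains and their Silov boundary\<close>

locale circular_convex_domain =
  fixes D :: "(complex^'n) set"
  assumes nonempty: "D \<noteq> {}" and open_D: "open D" and bounded_D: "bounded D"
    and convex_D: "convex D" and circular_D: "circular D"
begin

lemma rotate_mem: "\<lbrakk>cmod a = 1; z \<in> D\<rbrakk> \<Longrightarrow> a *s z \<in> D"
  using circular_D by (simp add: circular_def)

lemma zero_mem: "0 \<in> D"
proof -
  obtain z where z: "z \<in> D" using nonempty by blast
  have "(1/2) *\<^sub>R z + (1/2) *\<^sub>R ((-1) *s z) \<in> D"
    by (rule convexD[OF convex_D z rotate_mem]) (use z in auto)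
  moreover have "(1/2) *\<^sub>R z + (1/2) *\<^sub>R ((-1) *s z) = 0" by (simp add: vec_eq_iff)
  ultimately show ?thesis by metis
qed

lemma compact_closure_D: "compact (closure D)"
  using bounded_D by (simp add: compact_closure)

lemma subset_closure: "z \<in> D \<Longrightarrow> z \<in> closure D"
  using closure_subset by blast

lemma rotate_closure: assumes "cmod a = 1" "z \<in> closure D" shows "a *s z \<in> closure D"
proof -
  have "(\<lambda>z. a *s z) ` closure D \<subseteq> closure D"
    by (rule image_closure_subset)
      (use assms closure_subset in \<open>auto intro!: continuous_intros rotate_mem intro: subsetD[OF closure_subset]\<close>)
  then show ?thesis using assms by blast
qed

lemma contract_mem: assumes "cmod c < 1" "z \<in> closure D" shows "c *s z \<in> D"
proof (cases "c = 0")
  case True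
  then show ?thesis by (simp add: zero_mem)
next
  case False
  define a where "a = c / cmod c"
  have a: "cmod a = 1" using False by (simp add: a_def norm_divide)
  have z': "a *s z \<in> closure D" using a assms(2) by (rule rotate_closure)
  have "c *s z = cmod c *\<^sub>R (a *s z)"
    using False by (simp add: scaleR_eq_smult vector_smult_assoc a_def)
  moreover have "cmod c *\<^sub>R (a *s z) \<in> interior D"
  proof (cases "a *s z = 0")
    case True
    show ?thesis unfolding True using zero_mem open_D by (simp add: interior_open)
  next
    case nz: False
    have "cmod c *\<^sub>R (a *s z) \<in> open_segment 0 (a *s z)"
      using nz False assms(1) by (auto simp: in_segment)
    then show ?thesis
      using in_interior_closure_convex_segment[OF convex_D _ z'] zero_mem open_D
      by (auto simp: interior_open)
  qed
  ultimately show ?thesis using interior_subset by auto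
qed

lemma contract_closure: "\<lbrakk>cmod c \<le> 1; z \<in> closure D\<rbrakk> \<Longrightarrow> c *s z \<in> closure D"
  using rotate_closure contract_mem subset_closure by (cases "cmod c = 1") auto

lemma rotate_frontier:
  assumes "cmod a = 1" "z \<in> frontier D"
  shows "a *s z \<in> frontier D"
proof -
  have z: "z \<in> closure D" "z \<notin> D" using assms(2) open_D by (auto simp: frontier_def interior_open)
  have a: "a \<noteq> 0" using assms(1) by auto
  have "a *s z \<notin> D"
  proof
    assume "a *s z \<in> D"
    then have "inverse a *s (a *s z) \<in> D"
      using assms(1) by (intro rotate_mem[of "inverse a"]) (simp_all add: norm_inverse)
    then show False using z(2) a by (simp add: vector_smult_assoc)
  qed
  then show ?thesis
    using rotate_closure[OF assms(1) z(1)] open_D by (simp add: frontier_def interior_open)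
qed

text \<open>A function that is holomorphic on \<open>D\<close> and continuous on the closure keeps these properties, and
  its supremum, when it is rotated.  Together with minimality, this makes the Silov boundary rotation
  invariant.\<close>

lemma rotate_norming_boundary:
  assumes S: "norming_boundary D S" and a: "cmod a = 1"
  shows "norming_boundary D ((\<lambda>z. a *s z) ` S)"
  unfolding norming_boundary_def
proof (intro conjI allI impI)
  have SF: "S \<subseteq> frontier D" and clS: "closed S" using S by (auto simp: norming_boundary_def)
  have "bounded S"
    using SF bounded_D by (intro bounded_subset[OF bounded_closure[OF bounded_D]]) (auto simp: frontier_def)
  then have "compact S" using clS by (simp add: compact_eq_bounded_closed)
  then show "closed ((\<lambda>z. a *s z) ` S)"
    by (intro compact_imp_closed compact_continuous_image continuous_intros)
  show "(\<lambda>z. a *s z) ` S \<subseteq> frontier D" using SF rotate_frontier[OF a] by blast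
  fix f assume f: "continuous_on (closure D) f \<and> hol_on f D"
  let ?g = "\<lambda>z. f (a *s z)"
  have "continuous_on (closure D) ?g"
    using f rotate_closure[OF a] by (auto intro!: continuous_on_compose2[of "closure D" f] continuous_intros)
  moreover have "hol_on ?g D"
    using hol_on_affine[of f D D 0 a] f rotate_mem[OF a] by simp
  ultimately obtain x where x: "x \<in> S" "\<forall>y\<in>S. cmod (?g y) \<le> cmod (?g x)"
    "cmod (?g x) = (SUP z\<in>D. cmod (?g z))"
    using S unfolding norming_boundary_def by meson
  have "(\<lambda>z. a *s z) ` D = D"
  proof
    show "D \<subseteq> (\<lambda>z. a *s z) ` D"
    proof
      fix z assume "z \<in> D"
      then have "inverse a *s z \<in> D" using a by (intro rotate_mem) (simp add: norm_inverse)
      moreover have "a \<noteq> 0" using a by auto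
      then have "z = a *s (inverse a *s z)" by (simp add: vector_smult_assoc)
      ultimately show "z \<in> (\<lambda>z. a *s z) ` D" by blast
    qed
  qed (use rotate_mem[OF a] in blast)
  then have "(\<lambda>z. cmod (?g z)) ` D = (\<lambda>z. cmod (f z)) ` D"
    by (metis (no_types, lifting) image_cong image_image)
  then show "\<exists>x\<in>(\<lambda>z. a *s z) ` S. (\<forall>y\<in>(\<lambda>z. a *s z) ` S. cmod (f y) \<le> cmod (f x)) \<and>
      cmod (f x) = (SUP z\<in>D. cmod (f z))"
    using x by (intro bexI[of _ "a *s x"]) auto
qed

end

lemma continuous_on_imp_measurable_radon:
  assumes "radon_measure_on S M" "continuous_on S f"
  shows "f \<in> borel_measurable M"
  using borel_measurable_continuous_on_restrict[OF assms(2)] assms(1)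
  by (auto simp: radon_measure_on_def cong: measurable_cong_sets)

lemma space_radon_measure: "radon_measure_on S M \<Longrightarrow> space M = S"
  using sets_eq_imp_space_eq[of M "restrict_space borel S"]
  by (simp add: radon_measure_on_def space_restrict_space)

lemma integrable_radon:
  assumes "radon_measure_on S M" "compact S" "continuous_on S f"
  shows "integrable M (f :: _ \<Rightarrow> complex)"
proof -
  interpret finite_measure M using assms(1) by (simp add: radon_measure_on_def)
  have "bounded (f ` S)" using assms by (intro compact_imp_bounded compact_continuous_image)
  then obtain B where "\<forall>x\<in>S. norm (f x) \<le> B" by (auto simp: bounded_iff)
  then show ?thesis
    using continuous_on_imp_measurable_radon[OF assms(1,3)] space_radon_measure[OF assms(1)]
    by (intro integrable_const_bound[of _ B]) (auto intro!: AE_I2)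
qed

lemma continuous_on_L2_radon:
  assumes "radon_measure_on S M" "compact S" "continuous_on S f"
  shows "f \<in> L2_space M"
proof -
  have "integrable M (\<lambda>x. f x * cnj (f x))"
    using assms by (intro integrable_radon continuous_intros)
  then have "integrable M (\<lambda>x. Re (f x * cnj (f x)))" by (rule integrable_Re)
  then show ?thesis
    using continuous_on_imp_measurable_radon[OF assms(1,3)]
    by (simp add: L2_space_def cmod_power2 flip: power2_eq_square)
qed

locale hardy_setting = circular_convex_domain D for D :: "(complex^'n) set" +
  fixes S :: "(complex^'n) set" and \<beta> :: "(complex^'n) measure"
    and C :: "complex^'n \<Rightarrow> complex^'n \<Rightarrow> complex"
  assumes silov: "silov_boundary D S" and invariant: "invariant_prob D S \<beta>"
    and kernel: "hardy_kernel D \<beta> C"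
begin

lemma S_norming: "norming_boundary D S" using silov by (simp add: silov_boundary_def)

lemma S_subset: "z \<in> S \<Longrightarrow> z \<in> closure D"
  using S_norming frontier_def by (fastforce simp: norming_boundary_def)

lemma compact_S: "compact S"
  using S_norming compact_closure_D S_subset
  by (metis compact_Int_closed inf.absorb_iff2 norming_boundary_def subsetI)

lemma rotate_S: assumes "cmod a = 1" "z \<in> S" shows "a *s z \<in> S"
proof -
  have "cmod (inverse a) = 1" using assms(1) by (simp add: norm_inverse)
  then have "S \<subseteq> (\<lambda>z. inverse a *s z) ` S"
    using silov rotate_norming_boundary[OF S_norming] unfolding silov_boundary_def by blast
  then obtain w where "w \<in> S" "z = inverse a *s w" using assms(2) by blast
  moreover have "a \<noteq> 0" using assms(1) by auto
  ultimately show ?thesis by (simp add: vector_smult_assoc)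
qed

lemma \<beta>_radon: "radon_measure_on S \<beta>" and \<beta>_prob: "prob_space \<beta>"
  using invariant by (auto simp: invariant_prob_def)

lemma space_\<beta>: "space \<beta> = S" using space_radon_measure[OF \<beta>_radon] .

lemma integral_rotate:
  assumes a: "cmod a = 1" and f: "continuous_on S f"
  shows "(\<integral>x. f (a *s x) \<partial>\<beta>) = (\<integral>x. (f x :: complex) \<partial>\<beta>)"
proof -
  have a0: "a \<noteq> 0" using a by auto
  let ?A = "mat a :: complex^'n^'n"
  have mult: "?A *v x = a *s x" for x
    by (simp add: vec_eq_iff matrix_vector_mult_def mat_def if_distrib[of "\<lambda>c. c * _"] cong: if_cong)
  have "?A ** mat (inverse a) = mat 1" "mat (inverse a) ** ?A = mat 1"
    using a0 by (simp_all add: vec_eq_iff matrix_matrix_mult_def mat_def if_distrib[of "\<lambda>c. c * _"] cong: if_cong)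
  then have "invertible ?A" unfolding invertible_def by blast
  moreover have "(*v) ?A ` D = D"
  proof
    show "D \<subseteq> (*v) ?A ` D"
    proof
      fix z assume "z \<in> D"
      then have "inverse a *s z \<in> D" using a by (intro rotate_mem) (simp add: norm_inverse)
      moreover have "z = ?A *v (inverse a *s z)" using a0 by (simp add: mult vector_smult_assoc)
      ultimately show "z \<in> (*v) ?A ` D" by blast
    qed
  qed (use rotate_mem[OF a] mult in auto)
  ultimately have distr: "distr \<beta> \<beta> ((*v) ?A) = \<beta>"
    using invariant by (auto simp: invariant_prob_def linear_automorphisms_def)
  have sets: "sets \<beta> = sets (restrict_space borel S)" using \<beta>_radon by (simp add: radon_measure_on_def)
  have "continuous_on S ((*v) ?A)" unfolding mult[abs_def] by (intro continuous_intros)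
  then have "(*v) ?A \<in> measurable \<beta> \<beta>"
    unfolding measurable_cong_sets[OF sets sets]
    by (intro measurable_restrict_space2 borel_measurable_continuous_on_restrict)
      (auto simp: mult space_restrict_space intro: rotate_S[OF a])
  then have "(\<integral>x. f x \<partial>distr \<beta> \<beta> ((*v) ?A)) = (\<integral>x. f (a *s x) \<partial>\<beta>)"
    using continuous_on_imp_measurable_radon[OF \<beta>_radon f] by (subst integral_distr) (auto simp: mult)
  then show ?thesis by (simp add: distr)
qed

end

section \<open>Symmetries of the Hardy kernel\<close>

context hardy_setting
begin

lemma kernel_cont:
  assumes "continuous_on A f" "continuous_on A g"
    and "\<And>x. x \<in> A \<Longrightarrow> f x \<in> D \<and> g x \<in> closure D \<or> f x \<in> closure D \<and> g x \<in> D"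
  shows "continuous_on A (\<lambda>x. C (f x) (g x))"
proof -
  obtain W where W: "D \<times> closure D \<subseteq> W" "closure D \<times> D \<subseteq> W" "sesqui_hol_on C W"
    using kernel unfolding hardy_kernel_def by blast
  have "continuous_on W (\<lambda>(z, w). C z w)"
    using W(3) unfolding sesqui_hol_on_def
    by (meson continuous_at_imp_continuous_on has_derivative_continuous)
  then have "continuous_on A (\<lambda>x. (\<lambda>(z, w). C z w) (f x, g x))"
    by (rule continuous_on_compose2) (use assms W in \<open>auto intro!: continuous_on_Pair\<close>)
  then show ?thesis by simp
qed

lemma kernel_hol_left:
  assumes "w \<in> closure D"
  shows "hol_on (\<lambda>z. C z w) D"
  unfolding hol_on_def
proof
  obtain W where W: "D \<times> closure D \<subseteq> W" "sesqui_hol_on C W"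
    using kernel unfolding hardy_kernel_def by blast
  fix z assume "z \<in> D"
  then have "(z, w) \<in> W" using W assms by blast
  then obtain L M where L: "((\<lambda>(z, w). C z w) has_derivative (\<lambda>(u, v). L u + M v)) (at (z, w))"
    "\<forall>c u. L (c *s u) = c * L u" "\<forall>c v. M (c *s v) = cnj c * M v"
    using W(2) unfolding sesqui_hol_on_def by blast
  have "((\<lambda>z. (z, w)) has_derivative (\<lambda>h. (h, 0))) (at z)"
    by (intro has_derivative_Pair has_derivative_ident has_derivative_const)
  from has_derivative_compose[OF this L(1)]
  have "((\<lambda>z. C z w) has_derivative (\<lambda>h. L h + M 0)) (at z)" by simp
  moreover have "M 0 = 0" using L(3)[rule_format, of 0 0] by simp
  ultimately show "\<exists>L. ((\<lambda>z. C z w) has_derivative L) (at z) \<and> (\<forall>c v. L (c *s v) = c * L v)"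
    using L(2) by auto
qed

text \<open>The second slot runs with \<open>cnj c\<close>, which cancels the antiholomorphy of the kernel there.\<close>

lemma kernel_holomorphic_slice:
  assumes "\<And>c. c \<in> A \<Longrightarrow> a + c *s v \<in> D \<and> b + cnj c *s u \<in> closure D \<or>
      a + c *s v \<in> closure D \<and> b + cnj c *s u \<in> D"
  shows "(\<lambda>c. C (a + c *s v) (b + cnj c *s u)) holomorphic_on A"
  unfolding holomorphic_on_def
proof
  obtain W where W: "D \<times> closure D \<subseteq> W" "closure D \<times> D \<subseteq> W" "sesqui_hol_on C W"
    using kernel unfolding hardy_kernel_def by blast
  fix c assume "c \<in> A"
  then have "(a + c *s v, b + cnj c *s u) \<in> W" using W assms by blast
  then obtain L M where
    L: "((\<lambda>(z, w). C z w) has_derivative (\<lambda>(u, v). L u + M v)) (at (a + c *s v, b + cnj c *s u))"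
    "\<forall>c u. L (c *s u) = c * L u" "\<forall>c v. M (c *s v) = cnj c * M v"
    using W(3) unfolding sesqui_hol_on_def by blast
  have "((\<lambda>c. b + cnj c *s u) has_derivative (\<lambda>h. cnj h *s u)) (at c)"
    by (rule has_derivative_compose[OF bounded_linear_imp_has_derivative[OF bounded_linear_cnj]
          has_derivative_smult_left])
  then have "((\<lambda>c. (a + c *s v, b + cnj c *s u)) has_derivative (\<lambda>h. (h *s v, cnj h *s u))) (at c)"
    by (intro has_derivative_Pair has_derivative_smult_left)
  from has_derivative_compose[OF this L(1)]
  have "((\<lambda>c. C (a + c *s v) (b + cnj c *s u)) has_derivative (\<lambda>h. (L v + M u) * h)) (at c)"
    using L(2,3) by (simp add: algebra_simps)
  then show "(\<lambda>c. C (a + c *s v) (b + cnj c *s u)) field_differentiable at c within A"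
    unfolding field_differentiable_def has_field_derivative_def
    using has_derivative_at_withinI by blast
qed

lemma kernel_hermitian:
  "\<lbrakk>z \<in> D; w \<in> closure D\<rbrakk> \<Longrightarrow> C w z = cnj (C z w)"
  "\<lbrakk>z \<in> D; w \<in> closure D\<rbrakk> \<Longrightarrow> C z w = cnj (C w z)"
  using kernel unfolding hardy_kernel_def by simp_all

text \<open>The analogue of the disc algebra.  These functions have boundary values on \<open>S\<close>, so that their
  Hardy norms and inner products are plain integrals over \<open>S\<close>.\<close>

definition disc_algebra :: "(complex^'n \<Rightarrow> complex) \<Rightarrow> bool" where
  "disc_algebra f \<longleftrightarrow> continuous_on (closure D) f \<and> hol_on f D"

lemma disc_algebra_kernel: "w \<in> D \<Longrightarrow> disc_algebra (\<lambda>z. C z w)"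
  using subset_closure
  by (auto simp: disc_algebra_def intro!: kernel_hol_left kernel_cont continuous_intros)

lemma disc_algebra_rotate:
  assumes "disc_algebra f" "cmod a = 1"
  shows "disc_algebra (\<lambda>z. f (a *s z))"
  unfolding disc_algebra_def
proof
  show "continuous_on (closure D) (\<lambda>z. f (a *s z))"
    using assms rotate_closure[OF assms(2)]
    by (auto intro!: continuous_on_compose2[of "closure D" f] continuous_intros simp: disc_algebra_def)
  show "hol_on (\<lambda>z. f (a *s z)) D"
    using hol_on_affine[of f D D 0 a] assms rotate_mem[OF assms(2)] by (simp add: disc_algebra_def)
qed

lemma disc_algebra_lincomb:
  assumes "disc_algebra f" "disc_algebra g"
  shows "disc_algebra (\<lambda>z. f z + c * g z)"
  using assms by (auto simp: disc_algebra_def intro!: continuous_intros hol_on_add hol_on_mult hol_on_const)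

lemma disc_algebra_continuous_S: "disc_algebra f \<Longrightarrow> continuous_on S f"
  using S_subset by (auto simp: disc_algebra_def intro: continuous_on_subset)

text \<open>Write \<open>M(\<rho>)\<close> for the mean of \<open>\<bar>f\<bar>\<^sup>2\<close> at radius \<open>\<rho>\<close>.  The integral \<open>B(c)\<close> of
  \<open>f (c x) cnj (f (\<rho> x))\<close> is holomorphic in \<open>c\<close>, and \<open>B(\<rho>) = M(\<rho>)\<close>.  For \<open>\<bar>c\<bar> = 1\<close> rotation
  invariance of \<open>\<beta>\<close> and the inequality between arithmetic and geometric means give
  \<open>\<bar>B(c)\<bar> \<le> (M(1) + M(\<rho>)) / 2\<close>.  By the maximum principle \<open>M(\<rho>)\<close> obeys the same bound, that is,
  \<open>M(\<rho>) \<le> M(1)\<close>.\<close>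

lemma hardy_mean_le:
  assumes f: "disc_algebra f" and \<rho>: "0 \<le> \<rho>" "\<rho> < 1"
  shows "hardy_mean \<beta> f \<rho> \<le> (\<integral>x. (cmod (f x))\<^sup>2 \<partial>\<beta>)"
proof -
  interpret prob_space \<beta> by (rule \<beta>_prob)
  define B where "B c = (\<integral>x. f (c *s x) * cnj (f (\<rho> *s x)) \<partial>\<beta>)" for c :: complex
  have cf: "continuous_on (closure D) f" and hf: "hol_on f D" using f by (auto simp: disc_algebra_def)
  have \<rho>': "cmod (of_real \<rho>) < 1" using \<rho> by simp
  have in_cl: "c *s x \<in> closure D" if "cmod c \<le> 1" "x \<in> S" for c x
    using that contract_closure S_subset by blast
  have cont: "continuous_on (cball 0 1 \<times> S) (\<lambda>(c, x). f (c *s x) * cnj (f (\<rho> *s x)))"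
    unfolding split_beta using in_cl \<rho>'
    by (intro continuous_intros continuous_on_compose2[OF cf]) (auto intro!: continuous_intros)
  have cont1: "continuous_on S (\<lambda>x. f (c *s x))" if "cmod c \<le> 1" for c
    using in_cl that by (intro continuous_on_compose2[OF cf] continuous_intros) auto
  have contB: "continuous_on S (\<lambda>x. f (c *s x) * cnj (f (\<rho> *s x)))" if "cmod c \<le> 1" for c
    using that \<rho>' by (intro continuous_intros cont1) auto
  have int: "integrable \<beta> (\<lambda>x. (cmod (f (c *s x)))\<^sup>2)" if "cmod c \<le> 1" for c
    using continuous_on_L2_radon[OF \<beta>_radon compact_S cont1[OF that]] by (simp add: L2_space_def)
  have sq: "of_real (\<integral>x. (cmod (f (c *s x)))\<^sup>2 \<partial>\<beta>) = (\<integral>x. f (c *s x) * cnj (f (c *s x)) \<partial>\<beta>)" for c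
    by (simp add: complex_norm_square del: of_real_power flip: integral_complex_of_real)
  have rot: "(\<integral>x. (cmod (f (c *s x)))\<^sup>2 \<partial>\<beta>) = (\<integral>x. (cmod (f x))\<^sup>2 \<partial>\<beta>)" if "cmod c = 1" for c
  proof -
    have "continuous_on S (\<lambda>x. complex_of_real ((cmod (f x))\<^sup>2))"
      using cont1[of 1] by (intro continuous_intros) simp
    from integral_rotate[OF that this] show ?thesis by (simp del: of_real_power)
  qed
  have mean: "hardy_mean \<beta> f \<rho> = (\<integral>x. (cmod (f (\<rho> *s x)))\<^sup>2 \<partial>\<beta>)"
    by (simp add: hardy_mean_def scaleR_eq_smult)
  have contBc: "continuous_on (cball 0 1) B"
    unfolding B_def
    by (rule continuous_on_integral[OF finite_measure_axioms _ compact_cball compact_S cont])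
      (auto simp: space_\<beta> intro: continuous_on_imp_measurable_radon[OF \<beta>_radon contB])
  have holB: "B holomorphic_on ball 0 1"
    unfolding B_def
  proof (rule holomorphic_on_integral[OF finite_measure_axioms _ compact_S open_ball])
    show "(\<lambda>c. f (c *s x) * cnj (f (\<rho> *s x))) holomorphic_on ball 0 1" if "x \<in> S" for x
      using holomorphic_on_slice[OF hf, of "ball 0 1" 0 x] contract_mem S_subset that
      by (auto intro!: holomorphic_intros)
    show "continuous_on (ball 0 1 \<times> S) (\<lambda>(c, x). f (c *s x) * cnj (f (\<rho> *s x)))"
      using cont by (rule continuous_on_subset) auto
  qed (auto simp: space_\<beta> intro: continuous_on_imp_measurable_radon[OF \<beta>_radon contB])
  have "cmod (B (of_real \<rho>)) \<le> ((\<integral>x. (cmod (f x))\<^sup>2 \<partial>\<beta>) + hardy_mean \<beta> f \<rho>) / 2"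
  proof (rule maximum_modulus_frontier[of B "cball 0 1"])
    fix c :: complex assume "c \<in> frontier (cball 0 1)"
    then have c: "cmod c = 1" by simp
    have "cmod (B c) \<le> (\<integral>x. cmod (f (c *s x) * cnj (f (\<rho> *s x))) \<partial>\<beta>)"
      unfolding B_def by (rule integral_norm_bound)
    also have "\<dots> \<le> (\<integral>x. ((cmod (f (c *s x)))\<^sup>2 + (cmod (f (\<rho> *s x)))\<^sup>2) / 2 \<partial>\<beta>)"
    proof (rule integral_mono)
      show "integrable \<beta> (\<lambda>x. cmod (f (c *s x) * cnj (f (\<rho> *s x))))"
        using integrable_radon[OF \<beta>_radon compact_S contB] c by simp
      show "integrable \<beta> (\<lambda>x. ((cmod (f (c *s x)))\<^sup>2 + (cmod (f (\<rho> *s x)))\<^sup>2) / 2)"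
        using int[of c] int[of "of_real \<rho>"] c \<rho>' by simp
      show "cmod (f (c *s x) * cnj (f (\<rho> *s x))) \<le> ((cmod (f (c *s x)))\<^sup>2 + (cmod (f (\<rho> *s x)))\<^sup>2) / 2" for x
        using sum_squares_bound[of "cmod (f (c *s x))" "cmod (f (\<rho> *s x))"] by (simp add: norm_mult)
    qed
    also have "\<dots> = ((\<integral>x. (cmod (f x))\<^sup>2 \<partial>\<beta>) + hardy_mean \<beta> f \<rho>) / 2"
      using int[of c] int[of "of_real \<rho>"] c \<rho>' rot[OF c] by (simp add: mean)
    finally show "norm (B c) \<le> ((\<integral>x. (cmod (f x))\<^sup>2 \<partial>\<beta>) + hardy_mean \<beta> f \<rho>) / 2" .
  qed (use contBc holB \<rho> in auto)
  also have "B (of_real \<rho>) = of_real (hardy_mean \<beta> f \<rho>)"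
    unfolding mean sq B_def ..
  finally show ?thesis by simp
qed

lemma hardy_mean_tendsto:
  assumes f: "disc_algebra f"
  shows "((\<lambda>\<rho>. hardy_mean \<beta> f \<rho>) \<longlongrightarrow> (\<integral>x. (cmod (f x))\<^sup>2 \<partial>\<beta>)) (at_left 1)"
proof -
  interpret prob_space \<beta> by (rule \<beta>_prob)
  let ?k = "\<lambda>\<rho> x. complex_of_real ((cmod (f (\<rho> *\<^sub>R x)))\<^sup>2)"
  have cf: "continuous_on (closure D) f" using f by (auto simp: disc_algebra_def)
  have in_cl: "\<rho> *\<^sub>R x \<in> closure D" if "0 \<le> \<rho>" "\<rho> \<le> 1" "x \<in> S" for \<rho> x
    using that contract_closure[of "of_real \<rho>"] S_subset by (simp add: scaleR_eq_smult)
  have "continuous_on {0..1} (\<lambda>\<rho>. \<integral>x. ?k \<rho> x \<partial>\<beta>)"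
  proof (rule continuous_on_integral[OF finite_measure_axioms _ compact_Icc compact_S])
    show "continuous_on ({0..1} \<times> S) (\<lambda>(\<rho>, x). ?k \<rho> x)"
      unfolding split_beta using in_cl
      by (intro continuous_intros continuous_on_compose2[OF cf]) (auto intro!: continuous_intros)
    show "?k \<rho> \<in> borel_measurable \<beta>" if "\<rho> \<in> {0..1}" for \<rho>
      using in_cl that
      by (intro continuous_on_imp_measurable_radon[OF \<beta>_radon] continuous_intros
          continuous_on_compose2[OF cf]) auto
  qed (simp add: space_\<beta>)
  then have "continuous_on {0..1} (\<lambda>\<rho>. Re (\<integral>x. ?k \<rho> x \<partial>\<beta>))" by (intro continuous_intros)
  then have "continuous_on {0..1} (\<lambda>\<rho>. hardy_mean \<beta> f \<rho>)"
    by (simp add: hardy_mean_def del: of_real_power)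
  then have "((\<lambda>\<rho>. hardy_mean \<beta> f \<rho>) \<longlongrightarrow> hardy_mean \<beta> f 1) (at 1 within {0..1})"
    by (simp add: continuous_on_def)
  moreover have "at 1 within {0..1} = at_left (1::real)"
    by (rule at_within_Icc_at_left) simp
  ultimately show ?thesis by (simp add: hardy_mean_def)
qed

lemma hardy_mean_restrict0:
  assumes "0 \<le> \<rho>" "\<rho> < 1"
  shows "hardy_mean \<beta> (restrict0 D f) \<rho> = hardy_mean \<beta> f \<rho>"
  unfolding hardy_mean_def
proof (rule Bochner_Integration.integral_cong[OF refl])
  fix x assume "x \<in> space \<beta>"
  then have "\<rho> *\<^sub>R x \<in> D"
    using contract_mem[of "of_real \<rho>" x] S_subset assms by (simp add: scaleR_eq_smult space_\<beta>)
  then show "(cmod (restrict0 D f (\<rho> *\<^sub>R x)))\<^sup>2 = (cmod (f (\<rho> *\<^sub>R x)))\<^sup>2" by (simp add: restrict0_def)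
qed

lemma hardy_norm_sq_eq:
  assumes f: "disc_algebra f"
  shows "hardy_norm_sq \<beta> (restrict0 D f) = (\<integral>x. (cmod (f x))\<^sup>2 \<partial>\<beta>)"
proof -
  let ?m = "\<integral>x. (cmod (f x))\<^sup>2 \<partial>\<beta>"
  have "(SUP \<rho>\<in>{0..<1}. hardy_mean \<beta> f \<rho>) = ?m"
  proof (rule cSup_eq_non_empty)
    show "hardy_mean \<beta> f ` {0..<1} \<noteq> {}" by simp
    show "x \<le> ?m" if "x \<in> hardy_mean \<beta> f ` {0..<1}" for x
      using that hardy_mean_le[OF f] by auto
    fix y assume y: "\<And>x. x \<in> hardy_mean \<beta> f ` {0..<1} \<Longrightarrow> x \<le> y"
    show "?m \<le> y"
    proof (rule tendsto_upperbound[OF hardy_mean_tendsto[OF f]])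
      have "\<forall>\<^sub>F \<rho> in at_left (1::real). \<rho> \<in> {0<..<1}"
        by (rule eventually_at_leftI[of 0]) auto
      then show "\<forall>\<^sub>F \<rho> in at_left 1. hardy_mean \<beta> f \<rho> \<le> y"
        by eventually_elim (use y in auto)
    qed simp
  qed
  moreover have "hardy_norm_sq \<beta> (restrict0 D f) = (SUP \<rho>\<in>{0..<1}. hardy_mean \<beta> f \<rho>)"
    unfolding hardy_norm_sq_def by (intro arg_cong[of _ _ Sup] image_cong) (auto simp: hardy_mean_restrict0)
  ultimately show ?thesis by simp
qed

lemma restrict0_mem_hardy_space:
  assumes f: "disc_algebra f"
  shows "restrict0 D f \<in> hardy_space D \<beta>"
  unfolding hardy_space_def
proof (intro CollectI conjI)
  have "hol_on f D" using f by (simp add: disc_algebra_def)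
  then show "hol_on (restrict0 D f) D"
    by (intro hol_on_local exI[of _ D] exI[of _ f]) (auto simp: open_D restrict0_def)
  show "restrict0 D (restrict0 D f) = restrict0 D f" by (simp add: restrict0_def fun_eq_iff)
  show "bdd_above (hardy_mean \<beta> (restrict0 D f) ` {0..<1})"
    using hardy_mean_le[OF f] by (intro bdd_aboveI2[of _ _ "\<integral>x. (cmod (f x))\<^sup>2 \<partial>\<beta>"])
      (simp add: hardy_mean_restrict0)
qed

lemma polarization: "(\<Sum>k<4. \<i> ^ k * of_real ((cmod (a + \<i> ^ k * b))\<^sup>2)) / 4 = a * cnj b"
proof -
  have "(\<Sum>k<4. t k) = t 0 + t 1 + t 2 + t 3" for t :: "nat \<Rightarrow> complex"
    by (simp add: eval_nat_numeral)
  moreover have "\<i> ^ 3 = - \<i>" by (simp add: power3_eq_cube)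
  ultimately show ?thesis
    by (simp add: complex_norm_square algebra_simps del: of_real_power)
qed

lemma hardy_ip_eq:
  assumes "disc_algebra f" "disc_algebra g"
  shows "hardy_ip \<beta> (restrict0 D f) (restrict0 D g) = (\<integral>x. f x * cnj (g x) \<partial>\<beta>)"
proof -
  let ?h = "\<lambda>k x. f x + \<i> ^ k * g x"
  have h: "disc_algebra (?h k)" for k using assms by (rule disc_algebra_lincomb)
  have int: "integrable \<beta> (\<lambda>x. (cmod (?h k x))\<^sup>2)" for k
    using continuous_on_L2_radon[OF \<beta>_radon compact_S disc_algebra_continuous_S[OF h]]
    by (simp add: L2_space_def)
  have "(\<lambda>z. restrict0 D f z + \<i> ^ k * restrict0 D g z) = restrict0 D (?h k)" for k
    by (simp add: restrict0_def fun_eq_iff)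
  then have "hardy_ip \<beta> (restrict0 D f) (restrict0 D g) =
      (\<Sum>k<4. \<i> ^ k * of_real (\<integral>x. (cmod (?h k x))\<^sup>2 \<partial>\<beta>)) / 4"
    unfolding hardy_ip_def by (simp only: hardy_norm_sq_eq[OF h])
  also have "\<dots> = (\<Sum>k<4. (\<integral>x. \<i> ^ k * of_real ((cmod (?h k x))\<^sup>2) \<partial>\<beta>)) / 4"
    by (simp del: of_real_power)
  also have "\<dots> = (\<integral>x. (\<Sum>k<4. \<i> ^ k * of_real ((cmod (?h k x))\<^sup>2)) \<partial>\<beta>) / 4"
    using int by (subst Bochner_Integration.integral_sum) (auto simp del: of_real_power)
  also have "\<dots> = (\<integral>x. (\<Sum>k<4. \<i> ^ k * of_real ((cmod (?h k x))\<^sup>2)) / 4 \<partial>\<beta>)" by simp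
  finally show ?thesis by (simp only: polarization)
qed

text \<open>The defining property of the kernel of the Hardy space, with the inner product computed as an
  integral over \<open>S\<close>.\<close>

lemma kernel_reproduces:
  assumes f: "disc_algebra f" and z: "z \<in> D"
  shows "f z = (\<integral>x. f x * C z x \<partial>\<beta>)"
proof -
  have "restrict0 D f z = hardy_ip \<beta> (restrict0 D f) (restrict0 D (\<lambda>y. C y z))"
    using kernel restrict0_mem_hardy_space[OF f] z
    unfolding hardy_kernel_def reproducing_kernel_hilbert_space_def by blast
  then have "f z = hardy_ip \<beta> (restrict0 D f) (restrict0 D (\<lambda>y. C y z))"
    unfolding restrict0_def[of D f] using z by (simp only: if_True)
  also have "\<dots> = (\<integral>x. f x * cnj (C x z) \<partial>\<beta>)"
    by (rule hardy_ip_eq[OF f disc_algebra_kernel[OF z]])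
  also have "\<dots> = (\<integral>x. f x * C z x \<partial>\<beta>)"
    using kernel_hermitian(2)[OF z S_subset] by (intro Bochner_Integration.integral_cong) (auto simp: space_\<beta>)
  finally show ?thesis .
qed

text \<open>Reproduce \<open>C (a \<cdot>) (a w)\<close> at \<open>z\<close> and rotate the variable of integration, which preserves \<open>\<beta>\<close>: up
  to conjugation this is the formula that reproduces \<open>C \<cdot> z\<close> at \<open>w\<close>.\<close>

lemma kernel_rotate:
  assumes a: "cmod a = 1" and z: "z \<in> D" and w: "w \<in> D"
  shows "C (a *s z) (a *s w) = C z w"
proof -
  have a0: "a \<noteq> 0" "cmod (inverse a) = 1" using a by (auto simp: norm_inverse)
  have az: "a *s w \<in> D" using a w by (rule rotate_mem)
  have "C (a *s z) (a *s w) = (\<integral>x. C (a *s x) (a *s w) * C z x \<partial>\<beta>)"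
    by (rule kernel_reproduces[OF disc_algebra_rotate[OF disc_algebra_kernel[OF az] a] z])
  also have "\<dots> = (\<integral>x. cnj (C x z * C (a *s w) (a *s x)) \<partial>\<beta>)"
    using kernel_hermitian(2)[OF z S_subset] kernel_hermitian(1)[OF az] S_subset rotate_S[OF a]
    by (intro Bochner_Integration.integral_cong) (auto simp: space_\<beta>)
  also have "\<dots> = cnj (\<integral>x. C x z * C (a *s w) (a *s x) \<partial>\<beta>)"
    by (rule Bochner_Integration.integral_cnj)
  also have "(\<integral>x. C x z * C (a *s w) (a *s x) \<partial>\<beta>)
      = (\<integral>x. (\<lambda>y. C (inverse a *s y) z * C (a *s w) y) (a *s x) \<partial>\<beta>)"
    using a0 by (simp add: vector_smult_assoc)
  also have "\<dots> = (\<integral>y. C (inverse a *s y) z * C (a *s w) y \<partial>\<beta>)"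
    using az z S_subset rotate_S[OF a0(2)]
    by (intro integral_rotate[OF a] continuous_intros kernel_cont) auto
  also have "\<dots> = C (inverse a *s (a *s w)) z"
    by (rule kernel_reproduces[OF disc_algebra_rotate[OF disc_algebra_kernel[OF z] a0(2)] az, symmetric])
  also have "\<dots> = C w z" using a0 by (simp add: vector_smult_assoc)
  finally show ?thesis using kernel_hermitian(2)[OF z subset_closure[OF w]] by simp
qed

text \<open>For \<open>z\<close> and \<open>w\<close> in \<open>D\<close> the function \<open>C (c z) w - C z (cnj c w)\<close> of \<open>c\<close> is holomorphic on the disc and,
  by rotation invariance, vanishes on the circle.\<close>

lemma kernel_dilate_interior:
  assumes z: "z \<in> D" and w: "w \<in> D" and c: "cmod c \<le> 1"
  shows "C (c *s z) w = C z (cnj c *s w)"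
proof -
  let ?h = "\<lambda>c. C (c *s z) w - C z (cnj c *s w)"
  have mem: "c *s z \<in> D" "cnj c *s w \<in> D" if "cmod c \<le> 1" for c
    using that z w rotate_mem contract_mem subset_closure by (cases "cmod c = 1"; force)+
  have h1: "(\<lambda>c. C (c *s z) w) holomorphic_on cball 0 1"
    using kernel_holomorphic_slice[of "cball 0 1" 0 z w 0] mem w subset_closure by auto
  have h2: "(\<lambda>c. C z (cnj c *s w)) holomorphic_on cball 0 1"
    using kernel_holomorphic_slice[of "cball 0 1" z 0 0 w] mem z subset_closure by auto
  have hol: "?h holomorphic_on cball 0 1" using h1 h2 by (rule holomorphic_on_diff)
  have "norm (?h c) \<le> 0"
  proof (rule maximum_modulus_frontier[of ?h "cball 0 1"])
    show "?h holomorphic_on interior (cball 0 1)" using hol by (rule holomorphic_on_subset) auto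
    show "continuous_on (closure (cball 0 1)) ?h" using holomorphic_on_imp_continuous_on[OF hol] by simp
    fix b :: complex assume "b \<in> frontier (cball 0 1)"
    then have b: "cmod b = 1" by simp
    have "b * cnj b = 1" using b by (simp flip: complex_norm_square)
    then have "b *s (cnj b *s w) = w" by (simp add: vector_smult_assoc)
    then have "C (b *s z) w = C (b *s z) (b *s (cnj b *s w))" by simp
    also have "\<dots> = C z (cnj b *s w)" using b mem z by (intro kernel_rotate) auto
    finally show "norm (?h b) \<le> 0" by simp
  qed (use c in auto)
  then show ?thesis by simp
qed

text \<open>Multiplying both points by \<open>t < 1\<close> moves them into \<open>D\<close>, where the previous lemma
  applies; then \<open>t\<close> tends to \<open>1\<close>.\<close>

lemma kernel_dilate:
  fixes r :: real
  assumes z: "z \<in> closure D" and w: "w \<in> closure D" and r: "0 \<le> r" "r < 1"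
  shows "C (r *s z) w = C z (r *s w)"
proof -
  have r': "cmod (of_real r) < 1" using r by simp
  have rz: "of_real r *s z \<in> D" "of_real r *s w \<in> D" using contract_mem[OF r'] z w by auto
  have scaled: "of_real t *s v \<in> closure D" if "t \<in> {0..1}" "v \<in> closure D" for t v
    using that contract_closure[of "of_real t"] by simp
  have scaledD: "of_real t *s v \<in> D" if "t \<in> {0..1}" "v \<in> D" for t v
    using that rotate_mem contract_mem[of "of_real t" v] subset_closure by (cases "t = 1") auto
  let ?f = "\<lambda>t. C (of_real t *s (of_real r *s z)) (of_real t *s w) -
    C (of_real t *s z) (of_real t *s (of_real r *s w))"
  have cont: "continuous_on {0..1::real} ?f"
    using rz z w scaled scaledD by (intro continuous_intros kernel_cont) blast+
  have "?f t = 0" if "t \<in> {0..<1}" for t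
  proof -
    have t: "cmod (of_real t) < 1" using that by simp
    have "C (of_real r *s (of_real t *s z)) (of_real t *s w) =
        C (of_real t *s z) (cnj (of_real r) *s (of_real t *s w))"
      using r' by (intro kernel_dilate_interior contract_mem[OF t] z w) simp
    then show ?thesis by (simp add: vector_smult_assoc mult.commute)
  qed
  then have "?f 1 = 0"
    using continuous_constant_on_closure[of "{0..<1}" ?f 0 1] cont by simp
  then show ?thesis by simp
qed

end

section \<open>Cauchy integrals and orthogonality to polynomials\<close>

context hardy_setting
begin

lemma dilation_uniformly_close:
  assumes f: "disc_algebra f" and e: "e > 0"
  obtains r :: real where "0 \<le> r" "r < 1" "\<And>x. x \<in> closure D \<Longrightarrow> cmod (f x - f (r *s x)) < e"
proof -
  have "uniformly_continuous_on (closure D) f"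
    using f by (intro compact_uniformly_continuous compact_closure_D) (simp add: disc_algebra_def)
  then obtain d where d: "d > 0"
    "\<And>x y. \<lbrakk>x \<in> closure D; y \<in> closure D; dist y x < d\<rbrakk> \<Longrightarrow> dist (f y) (f x) < e"
    using e unfolding uniformly_continuous_on_def by meson
  obtain B where B: "B > 0" "\<And>x. x \<in> closure D \<Longrightarrow> norm x \<le> B"
    using compact_imp_bounded[OF compact_closure_D] unfolding bounded_pos by blast
  define r where "r = 1 - min 1 (d / (2 * B))"
  have r: "0 \<le> r" "r < 1" using d B by (auto simp: r_def)
  have "cmod (f x - f (of_real r *s x)) < e" if x: "x \<in> closure D" for x
  proof -
    have "x - of_real r *s x = of_real (1 - r) *s x"
      by (simp add: vec_eq_iff algebra_simps)
    then have "dist x (of_real r *s x) = (1 - r) * norm x"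
      using r by (simp only: dist_norm norm_vector_smult norm_of_real abs_of_nonneg)
    also have "\<dots> \<le> (d / (2 * B)) * B"
      using d B B(2)[OF x] by (intro mult_mono) (auto simp: r_def)
    also have "\<dots> < d" using d B by simp
    finally have "dist (f x) (f (of_real r *s x)) < e"
      using r by (intro d(2) x contract_closure) auto
    then show ?thesis by (simp add: dist_norm)
  qed
  then show ?thesis using that r by blast
qed

lemma disc_algebra_polynomial_approximation:
  assumes f: "disc_algebra f" and e: "e > 0"
  obtains p where "hol_polynomial p" "\<And>x. x \<in> closure D \<Longrightarrow> cmod (f x - p x) < e"
proof -
  obtain r :: real where r: "0 \<le> r" "r < 1" "\<And>x. x \<in> closure D \<Longrightarrow> cmod (f x - f (r *s x)) < e / 2"
    using dilation_uniformly_close[OF f, of "e / 2"] e by auto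
  have "bounded (f ` closure D)"
    using f compact_closure_D by (intro compact_imp_bounded compact_continuous_image) (simp add: disc_algebra_def)
  then obtain B where B: "\<forall>x\<in>f ` closure D. norm x \<le> B" unfolding bounded_iff by blast
  have "\<exists>p. hol_polynomial p \<and> (\<forall>v\<in>closure D. cmod (f (of_real r *s v) - p v) < e / 2)"
  proof (rule dilation_polynomial_approximation[OF open_D zero_mem _ _ _ r(1,2)])
    show "hol_on f D" using f by (simp add: disc_algebra_def)
    show "cmod (f z) \<le> B" if "z \<in> D" for z using B subset_closure[OF that] by blast
  qed (use contract_mem e in auto)
  then obtain p where p: "hol_polynomial p" "\<And>v. v \<in> closure D \<Longrightarrow> cmod (f (of_real r *s v) - p v) < e / 2"
    by blast
  have "cmod (f x - p x) < e" if "x \<in> closure D" for x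
    using norm_triangle_ineq[of "f x - f (of_real r *s x)" "f (of_real r *s x) - p x"]
      r(3)[OF that] p(2)[OF that] by simp
  then show ?thesis using that p by blast
qed

lemma disc_algebra_polynomial: "hol_polynomial p \<Longrightarrow> disc_algebra p"
  using hol_on_hol_polynomial[of p] hol_on_imp_continuous_on hol_on_subset
  by (auto simp: disc_algebra_def)

lemma disc_algebra_dilate:
  assumes "disc_algebra f" "cmod c \<le> 1"
  shows "continuous_on S (\<lambda>x. f (c *s x))"
  using assms contract_closure S_subset
  by (auto simp: disc_algebra_def intro!: continuous_on_compose2[of "closure D" f] continuous_intros)

context
  fixes M
  assumes M: "radon_measure_on S M"
begin

lemma finite_M: "finite_measure M" using M by (simp add: radon_measure_on_def)

lemma space_M: "space M = S" using space_radon_measure[OF M] .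

lemma L2_ip_uniform_approximation:
  assumes f: "f \<in> L2_space M" and g: "continuous_on S g" and q: "continuous_on S q"
    and close: "\<And>x. x \<in> S \<Longrightarrow> cmod (g x - q x) \<le> e" and orth: "L2_ip M f q = 0"
  shows "cmod (L2_ip M f g) \<le> e * (\<integral>x. cmod (f x) \<partial>M)"
proof -
  interpret L: semi_inner_space "L2_space M" "L2_ip M" by (rule L2_semi_inner_space)
  have gq: "g \<in> L2_space M" "q \<in> L2_space M"
    using continuous_on_L2_radon[OF M compact_S] g q by auto
  have "L2_ip M f g = (\<integral>x. f x * cnj (g x - q x) \<partial>M)"
    using L.ip_diff_right[OF f gq] orth by (simp add: L2_ip_def)
  also have "cmod \<dots> \<le> (\<integral>x. cmod (f x * cnj (g x - q x)) \<partial>M)" by (rule integral_norm_bound)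
  also have "\<dots> \<le> (\<integral>x. e * cmod (f x) \<partial>M)"
  proof (rule integral_mono)
    show "integrable M (\<lambda>x. cmod (f x * cnj (g x - q x)))"
      by (intro integrable_norm L2_integrable_product f L.diff_mem gq)
    show "integrable M (\<lambda>x. e * cmod (f x))"
      using L2_integrable[OF finite_M f] by simp
    show "cmod (f x * cnj (g x - q x)) \<le> e * cmod (f x)" if "x \<in> space M" for x
      using close[of x] that unfolding norm_mult complex_mod_cnj space_M
      by (subst mult.commute) (intro mult_right_mono, auto)
  qed
  finally show ?thesis by simp
qed

lemma L2_ip_zero_by_approximation:
  assumes f: "f \<in> L2_space M" and g: "continuous_on S g"
    and approx: "\<And>e. e > 0 \<Longrightarrow> \<exists>q. continuous_on S q \<and> (\<forall>x\<in>S. cmod (g x - q x) \<le> e) \<and> L2_ip M f q = 0"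
  shows "L2_ip M f g = 0"
proof -
  let ?I = "\<integral>x. cmod (f x) \<partial>M"
  have I: "?I \<ge> 0" by simp
  have "cmod (L2_ip M f g) \<le> 0 + e" if e: "e > 0" for e
  proof -
    obtain q where "continuous_on S q" "\<forall>x\<in>S. cmod (g x - q x) \<le> e / (?I + 1)" "L2_ip M f q = 0"
      using approx[of "e / (?I + 1)"] e I by auto
    then have "cmod (L2_ip M f g) \<le> e / (?I + 1) * ?I"
      using L2_ip_uniform_approximation[OF f g] by blast
    also have "e / (a + 1) * a \<le> e" if "a \<ge> 0" for a using that e by (simp add: field_simps)
    note this[OF I]
    finally show ?thesis by simp
  qed
  then have "cmod (L2_ip M f g) \<le> 0" by (rule field_le_epsilon)
  then show ?thesis by simp
qed

lemma cauchy_integral_eq_L2_ip: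
  assumes "z \<in> D"
  shows "cauchy_integral C M f z = L2_ip M f (\<lambda>x. C x z)"
  unfolding cauchy_integral_def L2_ip_def
  using kernel_hermitian(2)[OF assms S_subset]
  by (intro Bochner_Integration.integral_cong) (auto simp: space_M)

text \<open>The function is continuous on the compact set \<open>S \<times> S\<close>, which carries the product measure;
  extended by zero it is a Borel function on the whole product space.\<close>

lemma kernel_measurable_product:
  fixes r :: real
  assumes r: "0 \<le> r" "r < 1"
  shows "(\<lambda>(x, y). C (r *s y) x) \<in> borel_measurable (M \<Otimes>\<^sub>M \<beta>)"
proof -
  let ?G = "\<lambda>p. indicator (S \<times> S) p *\<^sub>R C (of_real r *s snd p) (fst p)"
  have "?G \<in> borel_measurable borel"
  proof (rule borel_measurable_continuous_on_indicator)
    show "S \<times> S \<in> sets borel" using compact_S by (intro borel_closed closed_Times compact_imp_closed)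
    show "continuous_on (S \<times> S) (\<lambda>p. C (of_real r *s snd p) (fst p))"
      using r S_subset by (intro kernel_cont continuous_intros) (auto intro: contract_mem)
  qed
  moreover have "(\<lambda>p. p) \<in> measurable (M \<Otimes>\<^sub>M \<beta>) borel"
  proof -
    have "(\<lambda>x. x) \<in> borel_measurable M" "(\<lambda>x. x) \<in> borel_measurable \<beta>"
      by (auto intro!: continuous_on_imp_measurable_radon[OF M] continuous_on_imp_measurable_radon[OF \<beta>_radon]
          continuous_intros)
    then have "(\<lambda>p. (fst p, snd p)) \<in> measurable (M \<Otimes>\<^sub>M \<beta>) (borel \<Otimes>\<^sub>M borel)"
      by (intro measurable_Pair measurable_compose[OF measurable_fst] measurable_compose[OF measurable_snd])
    then show ?thesis by (simp add: borel_prod)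
  qed
  ultimately have "(\<lambda>p. ?G p) \<in> borel_measurable (M \<Otimes>\<^sub>M \<beta>)" by (rule measurable_compose[rotated])
  moreover have "?G p = (\<lambda>(x, y). C (r *s y) x) p" if "p \<in> space (M \<Otimes>\<^sub>M \<beta>)" for p
    using that by (auto simp: space_pair_measure space_M space_\<beta>)
  ultimately show ?thesis by (simp cong: measurable_cong)
qed

text \<open>The reproducing formula \<open>p (r x) = \<integral> p(y) C (x, r y) d\<beta>(y)\<close> writes a dilated polynomial as a
  superposition of kernel functions, and Fubini's theorem moves the vanishing Cauchy integral inside.\<close>

lemma orthogonal_dilated:
  fixes r :: real
  assumes f: "f \<in> L2_space M" and zero: "\<And>z. z \<in> D \<Longrightarrow> cauchy_integral C M f z = 0"
    and p: "disc_algebra p" and r: "0 \<le> r" "r < 1"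
  shows "L2_ip M f (\<lambda>x. p (r *s x)) = 0"
proof -
  interpret M: finite_measure M by (rule finite_M)
  interpret \<beta>: prob_space \<beta> by (rule \<beta>_prob)
  interpret pair_sigma_finite M \<beta> by unfold_locales
  have rx: "of_real r *s x \<in> D" if "x \<in> S" for x using r S_subset[OF that] by (intro contract_mem) auto
  define h where "h x y = f x * (cnj (p y) * C (of_real r *s y) x)" for x y
  have cont: "continuous_on (S \<times> S) (\<lambda>(x, y). cnj (p y) * C (of_real r *s y) x)"
    unfolding split_beta using rx S_subset
    by (intro continuous_intros kernel_cont continuous_on_compose2[OF disc_algebra_continuous_S[OF p]]) auto
  obtain K where K: "K \<ge> 0" "\<And>x y. \<lbrakk>x \<in> S; y \<in> S\<rbrakk> \<Longrightarrow> cmod (cnj (p y) * C (of_real r *s y) x) \<le> K"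
    by (rule bounded_on_compact_product[OF compact_S compact_S cont]) (rule that)
  have hK: "cmod (h x y) \<le> K * cmod (f x)" if "x \<in> S" "y \<in> S" for x y
    using K(2)[OF that] unfolding h_def norm_mult[of "f x"] by (subst mult.commute) (intro mult_right_mono, auto)
  have [measurable]: "f \<in> borel_measurable M" using f by (simp add: L2_space_def)
  have [measurable]: "p \<in> borel_measurable \<beta>"
    by (rule continuous_on_imp_measurable_radon[OF \<beta>_radon disc_algebra_continuous_S[OF p]])
  have meas: "case_prod h \<in> borel_measurable (M \<Otimes>\<^sub>M \<beta>)"
    using kernel_measurable_product[OF r] unfolding h_def[abs_def] split_beta by measurable
  have int_f: "integrable M (\<lambda>x. cmod (f x))" using L2_integrable[OF finite_M f] by simp
  have "integrable (M \<Otimes>\<^sub>M \<beta>) (case_prod h)"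
  proof (rule Fubini_integrable[OF meas])
    have sec: "integrable \<beta> (h x)" if "x \<in> S" for x
    proof (rule \<beta>.integrable_const_bound[of _ "K * cmod (f x)"])
      show "h x \<in> borel_measurable \<beta>"
        using measurable_Pair2[OF meas, of x] that by (simp add: space_M)
    qed (use hK that in \<open>auto simp: space_\<beta>\<close>)
    then show "AE x in M. integrable \<beta> (\<lambda>y. case_prod h (x, y))"
      by (auto simp: space_M)
    show "integrable M (\<lambda>x. \<integral>y. norm (case_prod h (x, y)) \<partial>\<beta>)"
    proof (rule Bochner_Integration.integrable_bound)
      show "integrable M (\<lambda>x. K * cmod (f x))" using int_f by simp
      show "(\<lambda>x. \<integral>y. norm (case_prod h (x, y)) \<partial>\<beta>) \<in> borel_measurable M"
        using meas by (intro \<beta>.borel_measurable_lebesgue_integral) simp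
      have "(\<integral>y. norm (h x y) \<partial>\<beta>) \<le> K * cmod (f x)" if "x \<in> S" for x
      proof -
        have "(\<integral>y. norm (h x y) \<partial>\<beta>) \<le> (\<integral>y. K * cmod (f x) \<partial>\<beta>)"
          using sec[OF that] hK[OF that] by (intro integral_mono) (auto simp: space_\<beta>)
        then show ?thesis by (simp add: \<beta>.prob_space)
      qed
      then show "AE x in M. norm (\<integral>y. norm (case_prod h (x, y)) \<partial>\<beta>) \<le> norm (K * cmod (f x))"
        using K(1) by (auto simp: space_M abs_mult)
    qed
  qed
  from Fubini_integral[OF this]
  have fub: "(\<integral>y. (\<integral>x. h x y \<partial>M) \<partial>\<beta>) = (\<integral>x. (\<integral>y. h x y \<partial>\<beta>) \<partial>M)" by simp
  have "cnj (p (of_real r *s x)) = (\<integral>y. cnj (p y) * C (of_real r *s y) x \<partial>\<beta>)" if x: "x \<in> S" for x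
  proof -
    have "p (of_real r *s x) = (\<integral>y. p y * C (of_real r *s x) y \<partial>\<beta>)"
      by (rule kernel_reproduces[OF p rx[OF x]])
    also have "\<dots> = (\<integral>y. cnj (cnj (p y) * C (of_real r *s y) x) \<partial>\<beta>)"
      using kernel_dilate[OF S_subset[OF x] S_subset r] kernel_hermitian(1)[OF rx S_subset[OF x]]
      by (intro Bochner_Integration.integral_cong) (auto simp: space_\<beta>)
    also have "\<dots> = cnj (\<integral>y. cnj (p y) * C (of_real r *s y) x \<partial>\<beta>)"
      by (rule Bochner_Integration.integral_cnj)
    finally show ?thesis by simp
  qed
  then have "L2_ip M f (\<lambda>x. p (of_real r *s x)) = (\<integral>x. (\<integral>y. h x y \<partial>\<beta>) \<partial>M)"
    unfolding L2_ip_def h_def by (intro Bochner_Integration.integral_cong) (auto simp: space_M)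
  also have "\<dots> = (\<integral>y. (\<integral>x. h x y \<partial>M) \<partial>\<beta>)" by (rule fub[symmetric])
  also have "\<dots> = (\<integral>y. 0 \<partial>\<beta>)"
  proof (rule Bochner_Integration.integral_cong[OF refl])
    fix y assume "y \<in> space \<beta>"
    then have y: "y \<in> S" by (simp add: space_\<beta>)
    have "(\<integral>x. h x y \<partial>M) = (\<integral>x. cnj (p y) * (C (of_real r *s y) x * f x) \<partial>M)"
      by (simp add: h_def ac_simps)
    also have "\<dots> = cnj (p y) * cauchy_integral C M f (of_real r *s y)"
      unfolding cauchy_integral_def by (rule Bochner_Integration.integral_mult_right_zero)
    finally show "(\<integral>x. h x y \<partial>M) = 0" using zero[OF rx[OF y]] by simp
  qed
  finally show ?thesis by simp
qed

text \<open>The polynomials and the kernel functions \<open>C \<cdot> z\<close> have the same closed span.  Kernel functions are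
  uniform limits of polynomials; that polynomials are orthogonal to whatever annihilates the kernel
  functions is the previous lemma.\<close>

lemma cauchy_integral_zero_iff_orthogonal:
  assumes f: "f \<in> L2_space M"
  shows "(\<forall>z\<in>D. cauchy_integral C M f z = 0) \<longleftrightarrow> (\<forall>g\<in>H2_measure M. L2_ip M f g = 0)"
proof
  interpret L: semi_inner_space "L2_space M" "L2_ip M" by (rule L2_semi_inner_space)
  assume zero: "\<forall>z\<in>D. cauchy_integral C M f z = 0"
  have poly: "L2_ip M f p = 0" if "hol_polynomial p" for p
  proof (rule L2_ip_zero_by_approximation[OF f])
    have p: "disc_algebra p" using that by (rule disc_algebra_polynomial)
    then show "continuous_on S p" by (rule disc_algebra_continuous_S)
    fix e :: real assume "e > 0"
    then obtain r :: real where r: "0 \<le> r" "r < 1" "\<And>x. x \<in> closure D \<Longrightarrow> cmod (p x - p (r *s x)) < e"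
      using dilation_uniformly_close[OF p] by blast
    have "continuous_on S (\<lambda>x. p (of_real r *s x))"
      using r by (intro disc_algebra_dilate[OF p]) simp
    moreover have "L2_ip M f (\<lambda>x. p (of_real r *s x)) = 0"
      using zero by (intro orthogonal_dilated f p r(1,2)) blast
    moreover have "\<forall>x\<in>S. cmod (p x - p (of_real r *s x)) \<le> e"
      using r(3) S_subset by (auto intro: less_imp_le)
    ultimately show "\<exists>q. continuous_on S q \<and> (\<forall>x\<in>S. cmod (p x - q x) \<le> e) \<and> L2_ip M f q = 0"
      by blast
  qed
  show "\<forall>g\<in>H2_measure M. L2_ip M f g = 0"
  proof
    fix g assume "g \<in> H2_measure M"
    then have g: "g \<in> L2_space M"
      and approx: "\<And>e. e > 0 \<Longrightarrow> \<exists>p. hol_polynomial p \<and> ip_norm (L2_ip M) (\<lambda>x. g x - p x) < e"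
      by (auto simp: H2_measure_def)
    let ?F = "ip_norm (L2_ip M) f"
    have F: "?F \<ge> 0" using f by (rule L.ip_norm_nonneg)
    have "cmod (L2_ip M f g) \<le> 0 + e" if e: "e > 0" for e
    proof -
      obtain p where p: "hol_polynomial p" "ip_norm (L2_ip M) (\<lambda>x. g x - p x) < e / (?F + 1)"
        using approx[of "e / (?F + 1)"] e F by auto
      have pL: "p \<in> L2_space M"
        by (rule continuous_on_L2_radon[OF M compact_S disc_algebra_continuous_S[OF disc_algebra_polynomial[OF p(1)]]])
      have "L2_ip M f g = L2_ip M f (\<lambda>x. g x - p x)"
        using poly[OF p(1)] by (simp add: L.ip_diff_right f g pL)
      also have "cmod \<dots> \<le> ?F * ip_norm (L2_ip M) (\<lambda>x. g x - p x)"
        by (intro L.Cauchy_Schwarz f L.diff_mem g pL)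
      also have "\<dots> \<le> ?F * (e / (?F + 1))" using p F by (intro mult_left_mono) auto
      also have "\<dots> \<le> e" using e F by (simp add: field_simps)
      finally show ?thesis by simp
    qed
    then have "cmod (L2_ip M f g) \<le> 0" by (rule field_le_epsilon)
    then show "L2_ip M f g = 0" by simp
  qed
next
  assume orth: "\<forall>g\<in>H2_measure M. L2_ip M f g = 0"
  have poly: "L2_ip M f p = 0" if "hol_polynomial p" for p
  proof -
    have "p \<in> L2_space M"
      by (rule continuous_on_L2_radon[OF M compact_S disc_algebra_continuous_S[OF disc_algebra_polynomial[OF that]]])
    moreover have "ip_norm (L2_ip M) (\<lambda>x. p x - p x) < e" if "e > 0" for e
      using that by (simp add: L2_norm_eq)
    ultimately have "p \<in> H2_measure M" using that unfolding H2_measure_def by blast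
    then show ?thesis using orth by blast
  qed
  show "\<forall>z\<in>D. cauchy_integral C M f z = 0"
  proof
    fix z assume z: "z \<in> D"
    have g: "disc_algebra (\<lambda>x. C x z)" using z by (rule disc_algebra_kernel)
    have "L2_ip M f (\<lambda>x. C x z) = 0"
    proof (rule L2_ip_zero_by_approximation[OF f disc_algebra_continuous_S[OF g]])
      fix e :: real assume "e > 0"
      then obtain p where p: "hol_polynomial p" "\<And>x. x \<in> closure D \<Longrightarrow> cmod (C x z - p x) < e"
        using disc_algebra_polynomial_approximation[OF g] by blast
      have "\<forall>x\<in>S. cmod (C x z - p x) \<le> e" using p(2) S_subset by (auto intro: less_imp_le)
      then show "\<exists>q. continuous_on S q \<and> (\<forall>x\<in>S. cmod (C x z - q x) \<le> e) \<and> L2_ip M f q = 0"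
        using poly[OF p(1)] disc_algebra_continuous_S[OF disc_algebra_polynomial[OF p(1)]] by blast
    qed
    then show "cauchy_integral C M f z = 0" using z by (simp add: cauchy_integral_eq_L2_ip)
  qed
qed

end

end

section \<open>Clark measures and the Clark operator\<close>

lemma convex_slice:
  fixes D :: "(complex^'n) set"
  assumes "convex D"
  shows "convex {c. a + c *s v \<in> D}" and "convex {c. a + cnj c *s v \<in> D}"
proof -
  have "a + (u *\<^sub>R c + t *\<^sub>R d) *s v = u *\<^sub>R (a + c *s v) + t *\<^sub>R (a + d *s v)" if "u + t = 1" for u t c d
  proof -
    have "a = u *\<^sub>R a + t *\<^sub>R a" by (simp add: that flip: scaleR_left_distrib)
    then have "a + (u *\<^sub>R c + t *\<^sub>R d) *s v = u *\<^sub>R a + t *\<^sub>R a + (u *\<^sub>R c + t *\<^sub>R d) *s v"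
      by simp
    also have "\<dots> = u *\<^sub>R (a + c *s v) + t *\<^sub>R (a + d *s v)"
      by (simp add: vec_eq_iff algebra_simps)
    finally show ?thesis .
  qed
  note * = this
  show "convex {c. a + c *s v \<in> D}"
  proof (rule convexI)
    fix c d and u t :: real
    assume "c \<in> {c. a + c *s v \<in> D}" "d \<in> {c. a + c *s v \<in> D}" "0 \<le> u" "0 \<le> t" "u + t = 1"
    then show "u *\<^sub>R c + t *\<^sub>R d \<in> {c. a + c *s v \<in> D}"
      using convexD[OF assms, of "a + c *s v" "a + d *s v" u t] by (simp only: mem_Collect_eq *)
  qed
  have "convex (cnj -` {c. a + c *s v \<in> D})"
    using \<open>convex {c. a + c *s v \<in> D}\<close>
    by (intro convex_linear_vimage bounded_linear.linear bounded_linear_cnj)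
  then show "convex {c. a + cnj c *s v \<in> D}" by (simp add: vimage_def)
qed

locale clark_setting = hardy_setting D S \<beta> C
  for D S :: "(complex^'n) set" and \<beta> :: "(complex^'n) measure"
    and C :: "complex^'n \<Rightarrow> complex^'n \<Rightarrow> complex" +
  fixes \<phi> :: "complex^'n \<Rightarrow> complex" and \<alpha> :: complex and M :: "(complex^'n) measure"
  assumes hol_\<phi>: "hol_on \<phi> D" and \<phi>_bound: "z \<in> D \<Longrightarrow> cmod (\<phi> z) < 1"
    and \<alpha>: "cmod \<alpha> = 1" and clark: "clark_measure D S C \<phi> \<alpha> M"
begin

lemma M: "radon_measure_on S M" using clark by (simp add: clark_measure_def)

lemma \<alpha>_cnj: "\<alpha> * cnj \<alpha> = 1" using \<alpha> by (simp flip: complex_norm_square)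

lemma denominator_nonzero:
  assumes "z \<in> D"
  shows "1 - cnj \<alpha> * \<phi> z \<noteq> 0" and "1 - \<alpha> * cnj (\<phi> z) \<noteq> 0"
proof -
  have "cmod (cnj \<alpha> * \<phi> z) < 1" "cmod (\<alpha> * cnj (\<phi> z)) < 1"
    using \<phi>_bound[OF assms] \<alpha> by (auto simp: norm_mult)
  then have "cnj \<alpha> * \<phi> z \<noteq> 1" "\<alpha> * cnj (\<phi> z) \<noteq> 1" by (metis less_irrefl norm_one)+
  then show "1 - cnj \<alpha> * \<phi> z \<noteq> 0" and "1 - \<alpha> * cnj (\<phi> z) \<noteq> 0" by simp_all
qed

lemma kernel_pair_continuous: "\<lbrakk>z \<in> D; w \<in> D\<rbrakk> \<Longrightarrow> continuous_on S (\<lambda>x. C z x * C x w)"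
  using S_subset by (intro continuous_intros kernel_cont) auto

text \<open>This is the Poisson integral identity that defines the Clark measure, cleared of denominators.
  Its right-hand side is positive, so the denominator \<open>C z z\<close> cannot vanish.\<close>

lemma clark_gram_diagonal:
  assumes z: "z \<in> D"
  shows "(\<integral>x. C z x * C x z \<partial>M) * ((1 - cnj \<alpha> * \<phi> z) * (1 - \<alpha> * cnj (\<phi> z))) = phi_kernel C \<phi> z z"
proof -
  let ?N = "(cmod (\<alpha> - \<phi> z))\<^sup>2" and ?I = "\<integral>x. (cmod (C z x))\<^sup>2 \<partial>M"
  have nz: "\<alpha> - \<phi> z \<noteq> 0" using \<phi>_bound[OF z] \<alpha> by auto
  have diag: "C z z = of_real (Re (C z z))"
    using kernel_hermitian(1)[OF z subset_closure[OF z]] by (simp add: complex_eq_iff)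
  have "(\<alpha> + \<phi> z) / (\<alpha> - \<phi> z) = (\<alpha> + \<phi> z) * cnj (\<alpha> - \<phi> z) / of_real ?N"
    using nz by (simp add: complex_norm_square del: of_real_power)
  then have "Re ((\<alpha> + \<phi> z) / (\<alpha> - \<phi> z)) = Re ((\<alpha> + \<phi> z) * cnj (\<alpha> - \<phi> z)) / ?N"
    by (simp only: Re_divide_of_real)
  also have "Re ((\<alpha> + \<phi> z) * cnj (\<alpha> - \<phi> z)) = 1 - (cmod (\<phi> z))\<^sup>2"
  proof -
    have "Re ((\<alpha> + \<phi> z) * cnj (\<alpha> - \<phi> z)) = ((Re \<alpha>)\<^sup>2 + (Im \<alpha>)\<^sup>2) - ((Re (\<phi> z))\<^sup>2 + (Im (\<phi> z))\<^sup>2)"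
      by (simp add: power2_eq_square algebra_simps)
    then show ?thesis by (simp only: flip: cmod_power2) (simp add: \<alpha>)
  qed
  finally have P: "?I / Re (C z z) = (1 - (cmod (\<phi> z))\<^sup>2) / ?N"
    using clark z by (simp add: clark_measure_def poisson_integral_def poisson_kernel_def)
  have "(cmod (\<phi> z))\<^sup>2 < 1" using \<phi>_bound[OF z] by (simp only: abs_square_less_1 abs_norm_cancel)
  then have "(1 - (cmod (\<phi> z))\<^sup>2) / ?N \<noteq> 0" using nz by simp
  then have "Re (C z z) \<noteq> 0" using P by auto
  then have I: "?I * ?N = (1 - (cmod (\<phi> z))\<^sup>2) * Re (C z z)"
    using P nz by (simp add: field_simps)
  have "(\<integral>x. C z x * C x z \<partial>M) = (\<integral>x. of_real ((cmod (C z x))\<^sup>2) \<partial>M)"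
    using kernel_hermitian(1)[OF z S_subset] space_M[OF M]
    by (intro Bochner_Integration.integral_cong) (auto simp: complex_norm_square simp del: of_real_power)
  also have "\<dots> = of_real ?I" by (simp del: of_real_power)
  finally have "(\<integral>x. C z x * C x z \<partial>M) = of_real ?I" .
  moreover have "(1 - cnj \<alpha> * \<phi> z) * (1 - \<alpha> * cnj (\<phi> z)) = of_real ?N"
  proof -
    have "(1 - cnj \<alpha> * \<phi> z) * (1 - \<alpha> * cnj (\<phi> z)) =
        1 - \<alpha> * cnj (\<phi> z) - cnj \<alpha> * \<phi> z + (\<alpha> * cnj \<alpha>) * (\<phi> z * cnj (\<phi> z))"
      by (simp add: algebra_simps)
    also have "\<dots> = (\<alpha> * cnj \<alpha>) - \<alpha> * cnj (\<phi> z) - cnj \<alpha> * \<phi> z + \<phi> z * cnj (\<phi> z)"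
      by (simp add: \<alpha>_cnj)
    also have "\<dots> = (\<alpha> - \<phi> z) * cnj (\<alpha> - \<phi> z)" by (simp add: algebra_simps)
    finally show ?thesis by (simp only: complex_norm_square)
  qed
  ultimately have "(\<integral>x. C z x * C x z \<partial>M) * ((1 - cnj \<alpha> * \<phi> z) * (1 - \<alpha> * cnj (\<phi> z)))
      = of_real (?I * ?N)" by simp
  also have "\<dots> = (1 - \<phi> z * cnj (\<phi> z)) * of_real (Re (C z z))"
    unfolding I by (simp add: complex_norm_square del: of_real_power)
  finally show ?thesis unfolding phi_kernel_def diag[symmetric] .
qed

text \<open>Polarization.  Both sides are holomorphic in \<open>z\<close> and antiholomorphic in \<open>w\<close>, and they agree on
  the diagonal.  With \<open>m = (z + w) / 2\<close> and \<open>d = (z - w) / 2\<close> the points \<open>(m + c d, m - cnj c d)\<close>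
  form a one-parameter family in which the difference of both sides is holomorphic in \<open>c\<close>; it
  contains \<open>(z, w)\<close> at \<open>c = 1\<close> and meets the diagonal along the imaginary axis.  Convexity of
  \<open>D\<close> makes the set of admissible \<open>c\<close> connected.\<close>

lemma clark_gram:
  assumes z: "z \<in> D" and w: "w \<in> D"
  shows "(\<integral>x. C z x * C x w \<partial>M) * ((1 - cnj \<alpha> * \<phi> z) * (1 - \<alpha> * cnj (\<phi> w))) = phi_kernel C \<phi> z w"
proof -
  interpret fin: finite_measure M using M by (rule finite_M)
  define m where "m = (1/2) *s (z + w)"
  define d where "d = (1/2) *s (z - w)"
  define A where "A = {c. m + c *s d \<in> D} \<inter> {c. m + cnj c *s (- d) \<in> D}"
  let ?z = "\<lambda>c. m + c *s d" and ?w = "\<lambda>c. m + cnj c *s (- d)"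
  define h where "h c = (\<integral>x. C (?z c) x * C x (?w c) \<partial>M) *
      ((1 - cnj \<alpha> * \<phi> (?z c)) * (1 - \<alpha> * cnj (\<phi> (?w c)))) -
      (1 - \<phi> (?z c) * cnj (\<phi> (?w c))) * C (?z c) (?w c)" for c
  have md: "m + d = z" "m - d = w" by (auto simp: m_def d_def vec_eq_iff field_simps)
  have zA: "?z c \<in> D" and wA: "?w c \<in> D" if "c \<in> A" for c using that by (auto simp: A_def)
  have "m = (1/2) *\<^sub>R z + (1/2) *\<^sub>R w"
    by (simp add: m_def scaleR_eq_smult vector_add_ldistrib)
  then have m: "m \<in> D" using convexD[OF convex_D z w, of "1/2" "1/2"] by simp
  have A0: "0 \<in> A" and A1: "1 \<in> A"
    using m z w md by (auto simp: A_def)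
  have openA: "open A"
  proof -
    have "open (?z -` D)" "open (?w -` D)"
      using open_D by (auto intro!: open_vimage continuous_intros)
    then show ?thesis unfolding A_def vimage_def by (rule open_Int)
  qed
  have "convex A" unfolding A_def using convex_D by (intro convex_Int convex_slice)
  then have connA: "connected A" by (rule convex_connected)
  have hol_int: "(\<lambda>c. \<integral>x. C (?z c) x * C x (?w c) \<partial>M) holomorphic_on A"
  proof (rule holomorphic_on_integral[OF fin.finite_measure_axioms _ compact_S openA])
    fix x assume x: "x \<in> S"
    show "(\<lambda>c. C (?z c) x * C x (?w c)) holomorphic_on A"
      using kernel_holomorphic_slice[of A m d x 0] kernel_holomorphic_slice[of A x 0 m "- d"]
        zA wA S_subset[OF x] by (intro holomorphic_on_mult) simp_all
  next
    show "continuous_on (A \<times> S) (\<lambda>(c, x). C (?z c) x * C x (?w c))"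
      unfolding split_beta using zA wA S_subset
      by (intro continuous_intros kernel_cont) auto
    fix c assume "c \<in> A"
    then show "(\<lambda>x. C (?z c) x * C x (?w c)) \<in> borel_measurable M"
      by (intro continuous_on_imp_measurable_radon[OF M] kernel_pair_continuous zA wA)
  qed (simp add: space_M[OF M])
  have hol1: "(\<lambda>c. \<phi> (?z c)) holomorphic_on A"
    using zA by (rule holomorphic_on_slice[OF hol_\<phi>])
  have hol2: "(\<lambda>c. cnj (\<phi> (?w c))) holomorphic_on A"
  proof -
    have "(\<lambda>c. \<phi> (m + c *s (- d))) holomorphic_on cnj ` A"
      using wA by (intro holomorphic_on_slice[OF hol_\<phi>]) auto
    from holomorphic_on_compose_cnj_cnj[OF this openA] show ?thesis by (simp add: o_def)
  qed
  have hol3: "(\<lambda>c. C (?z c) (?w c)) holomorphic_on A"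
    using zA wA subset_closure by (intro kernel_holomorphic_slice) blast
  have "h holomorphic_on A"
    unfolding h_def[abs_def] by (intro holomorphic_intros hol_int hol1 hol2 hol3)
  then have "h 1 = 0"
  proof (rule analytic_continuation[OF _ openA connA _ A0 _ _ A1, of _ "A \<inter> {c. Re c = 0}"])
    fix c assume c: "c \<in> A \<inter> {c. Re c = 0}"
    then have "cnj c = - c" by (simp add: complex_eq_iff)
    then have "?w c = ?z c" by (simp add: vec_eq_iff)
    then show "h c = 0"
      using clark_gram_diagonal[OF zA] c unfolding h_def phi_kernel_def by simp
  next
    obtain \<delta> where \<delta>: "\<delta> > 0" "ball 0 \<delta> \<subseteq> A" using openA A0 open_contains_ball by blast
    show "0 islimpt A \<inter> {c. Re c = 0}"
      unfolding islimpt_approachable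
    proof (intro allI impI)
      fix e :: real assume e: "e > 0"
      let ?c = "\<i> * of_real (min e \<delta> / 2)"
      have "cmod ?c < e" "cmod ?c < \<delta>" using e \<delta> by (auto simp: norm_mult)
      then show "\<exists>x'\<in>A \<inter> {c. Re c = 0}. x' \<noteq> 0 \<and> dist x' 0 < e"
        using \<delta> e by (intro bexI[of _ ?c]) (auto simp: subset_iff)
    qed
  qed auto
  then show ?thesis by (simp add: h_def md phi_kernel_def)
qed

text \<open>The factor makes the Gram matrix of these functions exactly \<open>phi_kernel C \<phi>\<close>, and makes their inner
  products with \<open>f\<close> the values of the Clark operator at \<open>f\<close>.\<close>

definition feature :: "complex^'n \<Rightarrow> complex^'n \<Rightarrow> complex" where
  "feature z = (\<lambda>x. (1 - \<alpha> * cnj (\<phi> z)) * C x z)"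

lemma kernel_L2: "z \<in> D \<Longrightarrow> (\<lambda>x. C x z) \<in> L2_space M"
  by (intro continuous_on_L2_radon[OF M compact_S] disc_algebra_continuous_S disc_algebra_kernel)

lemma feature_L2: "z \<in> D \<Longrightarrow> feature z \<in> L2_space M"
  unfolding feature_def
  by (rule semi_inner_space.scale_mem[OF L2_semi_inner_space kernel_L2])

lemma L2_ip_feature:
  assumes "z \<in> D" "f \<in> L2_space M"
  shows "L2_ip M f (feature z) = (1 - cnj \<alpha> * \<phi> z) * cauchy_integral C M f z"
  using semi_inner_space.ip_scale_right[OF L2_semi_inner_space assms(2) kernel_L2[OF assms(1)]]
  by (simp add: feature_def cauchy_integral_eq_L2_ip[OF M] assms)

lemma clark_operator_eq:
  "f \<in> L2_space M \<Longrightarrow> clark_operator D C \<phi> \<alpha> M f = restrict0 D (\<lambda>z. L2_ip M f (feature z))"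
  by (auto simp: clark_operator_def restrict0_def L2_ip_feature fun_eq_iff)

lemma feature_gram:
  assumes "z \<in> D" "w \<in> D"
  shows "L2_ip M (feature w) (feature z) = phi_kernel C \<phi> z w"
proof -
  have "L2_ip M (feature w) (feature z) = (1 - cnj \<alpha> * \<phi> z) * cauchy_integral C M (feature w) z"
    using assms by (intro L2_ip_feature feature_L2)
  also have "cauchy_integral C M (feature w) z = (\<integral>x. (1 - \<alpha> * cnj (\<phi> w)) * (C z x * C x w) \<partial>M)"
    unfolding cauchy_integral_def feature_def by (intro Bochner_Integration.integral_cong) auto
  also have "\<dots> = (1 - \<alpha> * cnj (\<phi> w)) * (\<integral>x. C z x * C x w \<partial>M)"
    by (rule Bochner_Integration.integral_mult_right_zero)
  finally show ?thesis unfolding clark_gram[OF assms, symmetric] by (simp only: ac_simps)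
qed

lemma cauchy_zero_iff_feature_orthogonal:
  assumes "f \<in> L2_space M"
  shows "(\<forall>z\<in>D. cauchy_integral C M f z = 0) \<longleftrightarrow> (\<forall>g\<in>feature ` D. L2_ip M f g = 0)"
  using denominator_nonzero(1) assms by (auto simp: L2_ip_feature)

lemma clark_operator_kernel_function:
  assumes z: "z \<in> D"
  shows "clark_operator D C \<phi> \<alpha> M (\<lambda>\<zeta>. C \<zeta> z) =
    restrict0 D (\<lambda>w. 1 / (1 - \<alpha> * cnj (\<phi> z)) * phi_kernel C \<phi> w z)"
proof -
  have "(1 - cnj \<alpha> * \<phi> w) * cauchy_integral C M (\<lambda>\<zeta>. C \<zeta> z) w =
      1 / (1 - \<alpha> * cnj (\<phi> z)) * phi_kernel C \<phi> w z" if "w \<in> D" for w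
    using clark_gram[OF that z] denominator_nonzero(2)[OF z]
    by (simp add: cauchy_integral_def field_simps)
  then show ?thesis by (auto simp: clark_operator_def restrict0_def fun_eq_iff)
qed

end

theorem theorem4p16:
  fixes D S :: "(complex^'n) set"
    and \<beta> :: "(complex^'n) measure"
    and C :: "complex^'n \<Rightarrow> complex^'n \<Rightarrow> complex"
    and \<phi> :: "complex^'n \<Rightarrow> complex"
    and \<mu> :: "complex \<Rightarrow> (complex^'n) measure"
    and H :: "(complex^'n \<Rightarrow> complex) set"
    and ip :: "(complex^'n \<Rightarrow> complex) \<Rightarrow> (complex^'n \<Rightarrow> complex) \<Rightarrow> complex"
  assumes "bounded_symmetric_domain D" and "convex D" and "circular D"
    and "silov_boundary D S"
    and "linear_automorphisms D \<subseteq> unitary_matrices"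
    and "S \<subseteq> sphere 0 1"
    and "invariant_prob D S \<beta>"
    and "hardy_kernel D \<beta> C"
    and "hol_on \<phi> D" and "\<phi> ` D \<subseteq> ball 0 1"
    and "\<And>\<alpha>. \<alpha> \<in> sphere 0 1 \<Longrightarrow> clark_measure D S C \<phi> \<alpha> (\<mu> \<alpha>)"
    and "reproducing_kernel_hilbert_space D H ip (phi_kernel C \<phi>)"
  shows "\<forall>\<alpha>\<in>sphere 0 1.
      partial_isometry_on (L2_space (\<mu> \<alpha>)) (L2_ip (\<mu> \<alpha>)) H ip (clark_operator D C \<phi> \<alpha> (\<mu> \<alpha>))
    \<and> clark_operator D C \<phi> \<alpha> (\<mu> \<alpha>) ` L2_space (\<mu> \<alpha>) = H
    \<and> kernel_on (L2_space (\<mu> \<alpha>)) (clark_operator D C \<phi> \<alpha> (\<mu> \<alpha>)) =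
        ortho_complement (L2_space (\<mu> \<alpha>)) (L2_ip (\<mu> \<alpha>)) (H2_measure (\<mu> \<alpha>))
    \<and> (\<forall>f\<in>L2_space (\<mu> \<alpha>). f \<in> kernel_on (L2_space (\<mu> \<alpha>)) (clark_operator D C \<phi> \<alpha> (\<mu> \<alpha>))
          \<longleftrightarrow> (\<forall>z\<in>D. cauchy_integral C (\<mu> \<alpha>) f z = 0))
    \<and> (\<forall>z\<in>D. clark_operator D C \<phi> \<alpha> (\<mu> \<alpha>) (\<lambda>\<zeta>. C \<zeta> z) =
          restrict0 D (\<lambda>w. 1 / (1 - \<alpha> * cnj (\<phi> z)) * phi_kernel C \<phi> w z))"
proof
  fix \<alpha> :: complex assume \<alpha>: "\<alpha> \<in> sphere 0 1"
  interpret clark_setting D S \<beta> C \<phi> \<alpha> "\<mu> \<alpha>"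
    using assms \<alpha> by unfold_locales (auto simp: bounded_symmetric_domain_def)
  let ?X = "L2_space (\<mu> \<alpha>)" and ?ip = "L2_ip (\<mu> \<alpha>)" and ?T = "clark_operator D C \<phi> \<alpha> (\<mu> \<alpha>)"
  note iso = feature_map_partial_isometry[OF L2_semi_inner_space L2_complete[OF finite_M[OF M]]
      assms(12) feature_L2 feature_gram clark_operator_eq]
  have kernel_eq: "kernel_on ?X ?T = ortho_complement ?X ?ip (feature ` D)"
    by (rule iso(3))
  have ker: "f \<in> kernel_on ?X ?T \<longleftrightarrow> (\<forall>z\<in>D. cauchy_integral C (\<mu> \<alpha>) f z = 0)" if "f \<in> ?X" for f
    using that cauchy_zero_iff_feature_orthogonal[OF that]
    unfolding kernel_eq ortho_complement_def by simp
  have "kernel_on ?X ?T = ortho_complement ?X ?ip (H2_measure (\<mu> \<alpha>))"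
  proof (rule set_eqI)
    fix f
    show "f \<in> kernel_on ?X ?T \<longleftrightarrow> f \<in> ortho_complement ?X ?ip (H2_measure (\<mu> \<alpha>))"
    proof (cases "f \<in> ?X")
      case True
      then show ?thesis
        using ker[OF True] cauchy_integral_zero_iff_orthogonal[OF M True]
        by (simp add: ortho_complement_def)
    qed (simp add: kernel_on_def ortho_complement_def)
  qed
  then show "partial_isometry_on ?X ?ip H ip ?T \<and> ?T ` ?X = H
    \<and> kernel_on ?X ?T = ortho_complement ?X ?ip (H2_measure (\<mu> \<alpha>))
    \<and> (\<forall>f\<in>?X. f \<in> kernel_on ?X ?T \<longleftrightarrow> (\<forall>z\<in>D. cauchy_integral C (\<mu> \<alpha>) f z = 0))
    \<and> (\<forall>z\<in>D. ?T (\<lambda>\<zeta>. C \<zeta> z) = restrict0 D (\<lambda>w. 1 / (1 - \<alpha> * cnj (\<phi> z)) * phi_kernel C \<phi> w z))"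
    using iso(1,2) ker clark_operator_kernel_function by blast
qed

end
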